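(* Let $q$ be a prime power with $q\equiv1\pmod6$, $f\in\mathbb F_q[T]$ monic and $\delta>0$. Write $u=q^{-s}$ and $\sigma=\mathrm{Re}(s)$. For $1/2\le\sigma\le3/2$ and $|u^3-q^{-4}|>\delta$, and every $\varepsilon>0$, $$\Psi_q(f,u)\ll_{\delta}|f|_q^{\frac12(\frac32-\sigma)+\varepsilon}.$$
   Context: $|f|_q=q^{\deg f}$. Cubic residue symbol $\chi_F$ (via a fixed isomorphism $\Omega$ from cube roots of unity in $\mathbb C^*$ to those in $\mathbb F_q^*$: $\chi_P(a)=0$ if $P\mid a$, else the root of unity $\alpha$ with $a^{(q^{\deg P}-1)/3}\equiv\Omega(\alpha)\bmod P$; multiplicative in $F$). $e_q(a)=e^{2\pi i\,\mathrm{tr}_{\mathbb F_q/\mathbb F_p}(a_1)/p}$ with $a_1$ the $1/T$-coefficient; $G_q(V,F)=\sum_{u\bmod F}\chi_F(u)e_q(uV/F)$. $\Psi_q(f,u)=\sum_{F\ \mathrm{monic}}G_q(f,F)u^{\deg F}$, convergent for small $|u|$ and extended meromorphically (it is a rational function of $u$). The implied constant depends on $\delta,\varepsilon,q$ but not on $f$. *)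

theory Defs
  imports
    "HOL-Complex_Analysis.Complex_Analysis"
    "HOL-Computational_Algebra.Computational_Algebra"
    "HOL-Number_Theory.Number_Theory"
begin

definition poly_abs :: "'a::finite_field poly \<Rightarrow> real" where
  "poly_abs f = (if f = 0 then 0 else real CARD('a) ^ degree f)"

definition cube_root_iso :: "(complex \<Rightarrow> 'a::finite_field) \<Rightarrow> bool" where
  "cube_root_iso \<Omega> \<longleftrightarrow>
     bij_betw \<Omega> {\<alpha>. \<alpha> ^ 3 = 1} {x. x ^ 3 = 1} \<and>
     (\<forall>\<alpha> \<beta>. \<alpha> ^ 3 = 1 \<and> \<beta> ^ 3 = 1 \<longrightarrow> \<Omega> (\<alpha> * \<beta>) = \<Omega> \<alpha> * \<Omega> \<beta>)"

definition cubic_symbol_prime ::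
    "(complex \<Rightarrow> 'a::finite_field) \<Rightarrow> 'a poly \<Rightarrow> 'a poly \<Rightarrow> complex" where
  "cubic_symbol_prime \<Omega> P a =
     (if P dvd a then 0
      else THE \<alpha>. \<alpha> ^ 3 = 1 \<and> [a ^ ((CARD('a) ^ degree P - 1) div 3) = [:\<Omega> \<alpha>:]] (mod P))"

text \<open>For \<open>F = 1\<close> the product is empty, so the symbol is 1 everywhere, including at \<open>a = 0\<close>.
  The exponent is the multiplicity of \<open>P\<close> in \<open>F\<close>; the library constant for it requires a
  factorial-semiring sort that polynomials over a plain \<open>finite_field\<close> do not have.\<close>

definition cubic_symbol ::
    "(complex \<Rightarrow> 'a::finite_field) \<Rightarrow> 'a poly \<Rightarrow> 'a poly \<Rightarrow> complex" where
  "cubic_symbol \<Omega> F a =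
     (\<Prod>P\<in>{P. irreducible P \<and> lead_coeff P = 1 \<and> P dvd F}.
        cubic_symbol_prime \<Omega> P a ^ Max {k. P ^ k dvd F})"

text \<open>
  The trace to the prime field, as the sum of the conjugates under the powers of the Frobenius
  automorphism; \<open>n\<close> is the degree of the field over its prime field.
\<close>

definition abs_trace :: "'a::finite_field \<Rightarrow> 'a" where
  "abs_trace x =
     (let n = (THE n. CARD('a) = CHAR('a) ^ n) in \<Sum>i<n. x ^ (CHAR('a) ^ i))"

text \<open>
  Elements of the completion at infinity are represented as formal Laurent series in the
  variable \<open>1/T\<close>. Hence \<open>T\<close> is \<open>fls_X_inv\<close>, and the coefficient of \<open>1/T\<close> has index 1.
  The trace is identified with its representative \<open>k < p\<close>.
\<close>

definition poly_to_fls_inf :: "'a::finite_field poly \<Rightarrow> 'a fls" where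
  "poly_to_fls_inf f = poly (map_poly fls_const f) fls_X_inv"

definition add_char :: "'a::finite_field fls \<Rightarrow> complex" where
  "add_char a =
     (let k = (THE k. k < CHAR('a) \<and> of_nat k = abs_trace (fls_nth a 1))
      in exp (2 * of_real pi * \<i> * of_nat k / of_nat CHAR('a)))"

definition gauss_sum ::
    "(complex \<Rightarrow> 'a::finite_field) \<Rightarrow> 'a poly \<Rightarrow> 'a poly \<Rightarrow> complex" where
  "gauss_sum \<Omega> V F =
     (\<Sum>u\<in>{u. u mod F = u}.
        cubic_symbol \<Omega> F u * add_char (poly_to_fls_inf (u * V) / poly_to_fls_inf F))"

text \<open>
  The meromorphic continuation to the whole plane of the series in \<open>u\<close> given near 0; it is
  unique because \<open>nicely_meromorphic_on\<close> excludes removable singularities and prescribes the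
  value 0 at poles.
\<close>

definition Psi :: "(complex \<Rightarrow> 'a::finite_field) \<Rightarrow> 'a poly \<Rightarrow> complex \<Rightarrow> complex" where
  "Psi \<Omega> f =
     (THE \<Phi>. \<Phi> nicely_meromorphic_on UNIV \<and>
       (\<forall>\<^sub>F u in nhds 0.
          ((\<lambda>F. gauss_sum \<Omega> f F * u ^ degree F) has_sum \<Phi> u) {F. lead_coeff F = 1}))"

end

theory Submission
  imports Defs "HOL-Algebra.Algebraic_Closure_Type"
begin

text \<open>
  Let \<open>C m\<close> be the sum of the Gauss sums \<open>G(f, F)\<close> over monic \<open>F\<close> of degree \<open>m\<close>, let \<open>n = deg f\<close> and
  \<open>r = n div 2\<close>. Group the fractions \<open>u / F\<close> with \<open>deg F = m > r\<close> by their Farey approximation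
  \<open>y / Q\<close> of order \<open>r\<close> and complete \<open>(y, Q)\<close> to a unimodular matrix; this replaces \<open>(u, F)\<close> by a pair
  \<open>(D, E)\<close> with \<open>D = u Q - y F\<close> of small degree. By cubic reciprocity \<open>chi F u\<close> factors as \<open>chi Q y\<close> times
  \<open>chi D E\<close> up to constants, and by the choice of \<open>r\<close> the additive character depends on \<open>E\<close> only through
  its leading coefficients. The sum over \<open>E\<close> is then explicit, so \<open>C m\<close> is an explicit linear combination
  of the \<open>C k\<close> with \<open>k \<le> r\<close>.

  The coefficients of this combination show that \<open>C m - q ^ 4 * C (m - 3)\<close> only involves \<open>C k\<close> with
  \<open>k\<close> close to \<open>n - m\<close>. Hence \<open>(1 - q ^ 4 * u ^ 3) * Psi f u\<close> is a polynomial of degree at most \<open>n + 4\<close>, and the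
  mean square bound for \<open>C k\<close> gives both \<open>q powr (3 m / 2)\<close> and \<open>q powr ((m + n) / 2)\<close> as bounds, up to
  a divisor function, for its \<open>m\<close>-th coefficient. Their combination is the claim.
\<close>

text \<open>The order \<open>n div 2\<close> of the dissection is pinned down from both sides.
  Replacing \<open>F\<close> by \<open>Q * E\<close> in the character leaves the error
  \<open>f * a * D ^ 2 / (F * Q ^ 2 * E)\<close>, invisible as soon as
  \<open>n \<le> 2 * r + 1\<close>, while \<open>2 * r \<le> n\<close> keeps every contributing
  degree of \<open>D\<close> below \<open>m - r\<close>. The complete sums of \<open>chi D\<close>
  detect cubes, so their normalised partial sums gain a factor \<open>q\<close> for every three
  degrees, and the number of \<open>E\<close> gains \<open>q ^ 3\<close>: hence \<open>q ^ 4\<close>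
  and the possible poles at \<open>u ^ 3 = q powr (- 4)\<close>. Multiplying by
  \<open>1 - q ^ 4 * u ^ 3\<close> leaves a window of four \<open>k\<close>, a relation between
  degrees \<open>m\<close> and \<open>n - m\<close> in the manner of a functional equation. The
  bound \<open>q powr (3 * k / 2)\<close> for \<open>C k\<close>, times \<open>q ^ (m - k)\<close>,
  is about \<open>q powr ((m + n) / 2)\<close> for such \<open>k\<close>. This dual bound and the
  direct one meet at \<open>m = n / 2\<close>, which is the origin of the exponent in the
  theorem.\<close>

hide_const (open) Polynomials.lead_coeff Polynomials.degree
  Divisibility.irreducible Divisibility.prime
  UnivPoly.up_ring.coeff UnivPoly.up_ring.monom Module.module.smult Coset.order

section \<open>Polynomials over a field\<close>

text \<open>The extended Euclidean algorithm. Coprimality is mostly used through Bezout identities,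
  which also supply the matrix completions below.\<close>

lemma poly_gcd_bezout:
  fixes a b :: "'a::field poly"
  shows "\<exists>g x y. g = x * a + y * b \<and> g dvd a \<and> g dvd b"
proof (induction "euclidean_size b" arbitrary: a b rule: less_induct)
  case less
  show ?case
  proof (cases "b = 0")
    case True
    have "a = 1 * a + 0 * b \<and> a dvd a \<and> a dvd b" using True by simp
    then show ?thesis by blast
  next
    case False
    then have "euclidean_size (a mod b) < euclidean_size b"
      by (rule mod_size_less)
    from less[OF this, of b] obtain g x y
      where g: "g = x * b + y * (a mod b)" "g dvd b" "g dvd a mod b" by blast
    have "a mod b = a - a div b * b" by (simp add: minus_div_mult_eq_mod)
    then have "g = y * a + (x - y * (a div b)) * b" unfolding g(1) by (simp add: ring_distribs mult_ac)
    moreover have "g dvd a" using g(2,3) by (simp add: dvd_mod_iff)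
    ultimately show ?thesis using g(2) by blast
  qed
qed

lemma poly_coprime_bezout:
  fixes a b :: "'a::field poly"
  assumes "coprime a b"
  obtains x y where "x * a + y * b = 1"
proof -
  obtain g x y where g: "g = x * a + y * b" "g dvd a" "g dvd b" using poly_gcd_bezout by blast
  then have "is_unit g" using assms coprime_common_divisor by blast
  then obtain h where "1 = g * h" by (elim dvdE)
  then have "(h * x) * a + (h * y) * b = 1" using g(1) by (simp add: algebra_simps)
  then show thesis by (rule that)
qed

lemma poly_bezout_coprime:
  fixes a b :: "'a::field poly"
  assumes "x * a + y * b = 1"
  shows "coprime a b"
  by (rule coprimeI) (metis assms dvd_add dvd_mult)

text \<open>Multiplying two Bezout identities gives one for the product.\<close>

lemma poly_coprime_mult_iff:
  fixes a b c :: "'a::field poly"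
  shows "coprime (a * b) c \<longleftrightarrow> coprime a c \<and> coprime b c"
proof
  assume *: "coprime (a * b) c"
  show "coprime a c \<and> coprime b c"
    using * by (auto intro!: coprimeI elim: coprime_common_divisor)
next
  assume "coprime a c \<and> coprime b c"
  then obtain x y x' y' where 1: "x * a + y * c = 1" and 2: "x' * b + y' * c = 1"
    by (metis poly_coprime_bezout)
  have "(x * a + y * c) * (x' * b + y' * c) = 1" by (simp only: 1 2 mult_1)
  then have "(x * x') * (a * b) + (x * a * y' + y * x' * b + y * y' * c) * c = 1"
    by (simp add: algebra_simps)
  then show "coprime (a * b) c" by (rule poly_bezout_coprime)
qed

lemma poly_coprime_dvd_mult:
  fixes a b c :: "'a::field poly"
  assumes "coprime a b" "a dvd b * c"
  shows "a dvd c"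
proof -
  obtain x y where "x * a + y * b = 1" using assms(1) by (rule poly_coprime_bezout)
  then have "c = (x * a + y * b) * c" by simp
  also have "\<dots> = a * (x * c) + y * (b * c)" by (simp add: algebra_simps)
  finally show ?thesis using assms(2) by (metis dvd_add dvd_mult dvd_triv_left)
qed

lemma poly_irreducible_coprime:
  fixes P a :: "'a::field poly"
  assumes "irreducible P"
  shows "coprime P a \<longleftrightarrow> \<not> P dvd a"
proof
  assume cop: "coprime P a"
  show "\<not> P dvd a"
  proof
    assume "P dvd a"
    then have "is_unit P" using cop by (meson coprime_common_divisor dvd_refl)
    then show False using assms by (simp add: Factorial_Ring.irreducible_def)
  qed
next
  assume n: "\<not> P dvd a"
  obtain g x y where g: "g = x * P + y * a" "g dvd P" "g dvd a" using poly_gcd_bezout by blast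
  have "is_unit g \<or> P dvd g"
  proof -
    obtain h where h: "P = g * h" using g(2) by (elim dvdE)
    then have "is_unit g \<or> is_unit h" using assms Factorial_Ring.irreducibleD by blast
    then show ?thesis
    proof
      assume "is_unit h"
      then obtain h' where "1 = h * h'" by (elim dvdE)
      then have "g = P * h'" using h by (metis mult.assoc mult.right_neutral)
      then show ?thesis by simp
    qed simp
  qed
  then have "is_unit g" using n g(3) dvd_trans by blast
  then obtain h where "1 = g * h" by (elim dvdE)
  then have "(h * x) * P + (h * y) * a = 1" using g(1) by (simp add: algebra_simps)
  then show "coprime P a" by (rule poly_bezout_coprime)
qed

lemma poly_monic_dvd_antisym:
  fixes p q :: "'a::field poly"
  assumes "lead_coeff p = 1" "lead_coeff q = 1" "p dvd q" "q dvd p"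
  shows "p = q"
proof -
  obtain h where h: "q = p * h" using assms(3) by (elim dvdE)
  obtain h' where h': "p = q * h'" using assms(4) by (elim dvdE)
  have "p \<noteq> 0" using assms(1) by auto
  then have "h * h' = 1" using h h' by (metis mult.assoc mult_cancel_left mult.right_neutral)
  then have "is_unit h" by (metis dvd_triv_left)
  then obtain c where "h = [:c:]" by (elim is_unit_polyE)
  moreover have "lead_coeff h = 1" using h assms(1,2) by (simp add: lead_coeff_mult)
  ultimately show ?thesis using h by simp
qed

lemma monic_degree_0:
  fixes p :: "'a::field poly"
  assumes "lead_coeff p = 1" "degree p = 0"
  shows "p = 1"
proof -
  obtain c where "p = [:c:]" using assms(2) by (auto elim: degree_eq_zeroE)
  then show ?thesis using assms(1) by (simp add: one_pCons)
qed

lemma poly_irreducible_degree_pos: "irreducible (P::'a::field poly) \<Longrightarrow> degree P > 0"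
  using is_unit_iff_degree[of P] by (auto simp: Factorial_Ring.irreducible_def)

text \<open>A divisor of least positive degree has no proper nonconstant factor; dividing by its
  leading coefficient makes it monic.\<close>

lemma poly_monic_prime_divisor:
  fixes F :: "'a::field poly"
  assumes "degree F > 0"
  obtains P where "irreducible P" "lead_coeff P = 1" "P dvd F"
proof -
  define S where "S = {p. p dvd F \<and> degree p > 0}"
  have "F \<in> S" using assms by (simp add: S_def)
  then obtain p where p: "p \<in> S" and min: "\<And>y. y \<in> S \<Longrightarrow> degree p \<le> degree y"
    using ex_has_least_nat[of "\<lambda>p. p \<in> S" F degree] by blast
  have p0: "p \<noteq> 0" using p by (auto simp: S_def)
  have "irreducible p"
  proof (rule Factorial_Ring.irreducibleI)
    show "p \<noteq> 0" by fact
    show "\<not> is_unit p" using p by (auto simp: S_def is_unit_iff_degree[OF p0])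
    fix a b assume ab: "p = a * b"
    then have ab0: "a \<noteq> 0" "b \<noteq> 0" using p0 by auto
    have deg: "degree p = degree a + degree b" using ab ab0 by (simp add: degree_mult_eq)
    show "is_unit a \<or> is_unit b"
    proof (rule ccontr)
      assume "\<not> (is_unit a \<or> is_unit b)"
      then have "degree a > 0" "degree b > 0" using ab0 by (auto simp: is_unit_iff_degree)
      then have "a \<in> S" using p ab by (auto simp: S_def intro: dvd_trans)
      then show False using min[of a] deg \<open>degree b > 0\<close> by simp
    qed
  qed
  define P where "P = smult (inverse (lead_coeff p)) p"
  have c: "inverse (lead_coeff p) \<noteq> 0" using p0 by simp
  have Pp: "P = [:inverse (lead_coeff p):] * p" by (simp add: P_def)
  have u: "is_unit [:inverse (lead_coeff p):]" using c by (simp add: is_unit_pCons_iff)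
  show thesis
  proof
    show "irreducible P" unfolding Pp by (rule iffD2[OF irreducible_mult_unit_left[OF u]]) fact
    show "lead_coeff P = 1" using p0 by (simp add: P_def)
    show "P dvd F" using p c by (simp add: P_def S_def smult_dvd_iff)
  qed
qed

text \<open>Induction over the prime factors, with no appeal to uniqueness of factorisation. It
  carries congruence, values at constants and reciprocity from prime moduli to all monic
  moduli.\<close>

lemma poly_monic_induct [consumes 1, case_names one mult]:
  fixes F :: "'a::field poly"
  assumes "lead_coeff F = 1" "Q 1"
    and step: "\<And>P F. irreducible P \<Longrightarrow> lead_coeff P = 1 \<Longrightarrow> lead_coeff F = 1 \<Longrightarrow> Q F \<Longrightarrow> Q (P * F)"
  shows "Q F"
  using assms(1)
proof (induction "degree F" arbitrary: F rule: less_induct)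
  case less
  show ?case
  proof (cases "degree F = 0")
    case True
    then show ?thesis using monic_degree_0[OF less.prems] assms(2) by simp
  next
    case False
    then obtain P where P: "irreducible P" "lead_coeff P = 1" "P dvd F"
      using poly_monic_prime_divisor by blast
    then obtain G where G: "F = P * G" by (elim dvdE)
    have "F \<noteq> 0" using False by auto
    then have "P \<noteq> 0" "G \<noteq> 0" using G by auto
    then have "degree G < degree F"
      using poly_irreducible_degree_pos[OF P(1)] by (simp add: G degree_mult_eq)
    moreover have "lead_coeff G = 1" using G P(2) less.prems by (simp add: lead_coeff_mult)
    ultimately have "Q G" using less.hyps by blast
    then show ?thesis unfolding G using step[OF P(1,2) \<open>lead_coeff G = 1\<close>] by blast
  qed
qed

section \<open>Polynomials of bounded degree and monic polynomials\<close>

definition poly_lt :: "nat \<Rightarrow> 'a::zero poly set" where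
  "poly_lt d = {u. \<forall>i\<ge>d. coeff u i = 0}"

lemma poly_lt_0 [simp]: "poly_lt 0 = {0}"
  by (auto simp: poly_lt_def poly_eq_iff)

text \<open>Coefficients define \<open>poly_lt\<close> so that sums and differences stay inside
  without case distinctions; the degree form has to name 0, since
  \<open>degree 0 = 0\<close>.\<close>

lemma poly_lt_iff_degree: "u \<in> poly_lt d \<longleftrightarrow> u = 0 \<or> degree u < d"
proof
  assume u: "u \<in> poly_lt d"
  show "u = 0 \<or> degree u < d"
  proof (rule ccontr)
    assume "\<not> (u = 0 \<or> degree u < d)"
    then have "coeff u (degree u) = 0" "u \<noteq> 0" using u by (auto simp: poly_lt_def)
    then show False by simp
  qed
qed (auto simp: poly_lt_def coeff_eq_0)

lemma zero_in_poly_lt [simp]: "0 \<in> poly_lt d"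
  by (simp add: poly_lt_def)

lemma poly_lt_add: "u \<in> poly_lt d \<Longrightarrow> v \<in> poly_lt d \<Longrightarrow> u + v \<in> (poly_lt d :: 'a::comm_monoid_add poly set)"
  by (simp add: poly_lt_def)

lemma poly_lt_diff: "u \<in> poly_lt d \<Longrightarrow> v \<in> poly_lt d \<Longrightarrow> u - v \<in> (poly_lt d :: 'a::ab_group_add poly set)"
  by (simp add: poly_lt_def)

lemma poly_lt_uminus: "u \<in> poly_lt d \<Longrightarrow> - u \<in> (poly_lt d :: 'a::ab_group_add poly set)"
  by (simp add: poly_lt_def)

lemma poly_lt_mono: "d \<le> e \<Longrightarrow> poly_lt d \<subseteq> poly_lt e"
  by (auto simp: poly_lt_def)

lemma poly_lt_mult:
  fixes u v :: "'a::idom poly"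
  assumes "u \<in> poly_lt d" "v \<in> poly_lt e" "d > 0" "e > 0" 
  shows "u * v \<in> poly_lt (d + e - 1)"
  using assms by (cases "u = 0 \<or> v = 0") (auto simp: poly_lt_iff_degree degree_mult_eq)

lemma poly_lt_Suc: "poly_lt (Suc d) = (\<lambda>(c, u). pCons c u) ` (UNIV \<times> poly_lt d)"
proof (intro Set.set_eqI iffI)
  fix p :: "'a poly" assume p: "p \<in> poly_lt (Suc d)"
  obtain c u where "p = pCons c u" by (cases p)
  moreover have "u \<in> poly_lt d" using p calculation by (force simp: poly_lt_def)
  ultimately show "p \<in> (\<lambda>(c, u). pCons c u) ` (UNIV \<times> poly_lt d)" by auto
qed (auto simp: poly_lt_def coeff_pCons split: nat.splits)

lemma finite_poly_lt [simp]: "finite (poly_lt d :: 'a::{zero,finite} poly set)"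
  by (induction d) (auto simp: poly_lt_Suc)

lemma card_poly_lt: "card (poly_lt d :: 'a::{zero,finite} poly set) = CARD('a) ^ d"
proof (induction d)
  case (Suc d)
  have "inj_on (\<lambda>(c, u). pCons c u) (UNIV \<times> (poly_lt d :: 'a poly set))" by (auto simp: inj_on_def)
  then show ?case using Suc by (simp add: poly_lt_Suc card_image card_cartesian_product)
qed simp

lemma poly_lt_mod: "F \<noteq> 0 \<Longrightarrow> u mod F \<in> poly_lt (degree F)" for F :: "'a::field poly"
  using degree_mod_less[of F u] by (auto simp: poly_lt_iff_degree)

lemma mod_poly_lt: "u \<in> poly_lt (degree F) \<Longrightarrow> u mod F = u" for F :: "'a::field poly"
  by (auto simp: poly_lt_iff_degree mod_poly_less)

lemma residues_eq_poly_lt: "F \<noteq> 0 \<Longrightarrow> {u. u mod F = u} = poly_lt (degree F)" for F :: "'a::field poly"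
  using mod_poly_lt poly_lt_mod[of F] by (auto, metis)

definition monics :: "nat \<Rightarrow> 'a::comm_semiring_1 poly set" where
  "monics d = {p. lead_coeff p = 1 \<and> degree p = d}"

lemma monics_eq: "monics d = (\<lambda>u. monom 1 d + u) ` (poly_lt d :: 'a::comm_ring_1 poly set)"
proof (intro Set.set_eqI iffI)
  fix p :: "'a poly" assume p: "p \<in> monics d"
  have "p = monom 1 d + (p - monom 1 d)" by simp
  moreover have "p - monom 1 d \<in> poly_lt d"
    using p by (auto simp: poly_lt_def monics_def coeff_eq_0)
  ultimately show "p \<in> (\<lambda>u. monom 1 d + u) ` poly_lt d" by blast
next
  fix p :: "'a poly" assume "p \<in> (\<lambda>u. monom 1 d + u) ` poly_lt d"
  then obtain u where u: "u \<in> poly_lt d" "p = monom 1 d + u" by auto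
  have 1: "coeff p d = 1" using u by (simp add: poly_lt_def)
  have 2: "degree p \<le> d" by (rule degree_le) (use u in \<open>auto simp: poly_lt_def\<close>)
  have "degree p = d" using 1 2 le_degree[of p d] by simp
  then show "p \<in> monics d" using 1 by (simp add: monics_def)
qed

lemma finite_monics [simp]: "finite (monics d :: 'a::{comm_ring_1,finite} poly set)"
  by (simp add: monics_eq)

lemma card_monics: "card (monics d :: 'a::{comm_ring_1,finite} poly set) = CARD('a) ^ d"
  by (simp add: monics_eq card_image card_poly_lt)

lemma monics_add:
  assumes "E \<in> monics M" "R \<in> poly_lt M"
  shows "E + R \<in> (monics M :: 'a::comm_ring_1 poly set)"
proof -
  obtain u where "u \<in> poly_lt M" "E = monom 1 M + u" using assms(1) by (auto simp: monics_eq)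
  then have "E + R = monom 1 M + (u + R)" "u + R \<in> poly_lt M"
    using assms(2) by (simp_all add: add.assoc poly_lt_add)
  then show ?thesis unfolding monics_eq by blast
qed

lemma sum_monics_shift:
  fixes R :: "'a::comm_ring_1 poly"
  assumes "R \<in> poly_lt M"
  shows "(\<Sum>E\<in>monics M. h (E + R)) = (\<Sum>E\<in>monics M. h E)"
  by (rule sum.reindex_bij_witness[of _ "\<lambda>E. E - R" "\<lambda>E. E + R"])
     (use monics_add[OF _ assms] monics_add[OF _ poly_lt_uminus[OF assms]] in auto)

lemma monics_mult:
  "A \<in> monics k \<Longrightarrow> B \<in> monics l \<Longrightarrow> A * B \<in> (monics (k + l) :: 'a::idom poly set)"
  using lead_coeff_mult[of A B] degree_mult_eq[of A B] by (force simp: monics_def)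

lemma monics_0: "monics 0 = {1 :: 'a::field poly}"
  using monic_degree_0 by (auto simp: monics_def)

lemma monics_nz: "F \<in> monics d \<Longrightarrow> F \<noteq> (0 :: 'a::comm_ring_1 poly)"
  by (auto simp: monics_def)

section \<open>Finite fields and their algebraic closure\<close>

lemma prime_CHAR_finite_field: "prime CHAR('a::finite_field)"
  by (rule prime_CHAR_semidom) (simp add: CHAR_pos_iff pos_char_exists)

lemma of_nat_eq_iff_mod_CHAR:
  "(of_nat m :: 'a::finite_field) = of_nat n \<longleftrightarrow> m mod CHAR('a) = n mod CHAR('a)"
  using of_nat_eq_iff_cong_CHAR[where 'a = 'a, of m n] by (simp add: cong_def)

text \<open>A maximal additive subgroup of \<open>p\<close>-power order must be everything: otherwise adjoin one
  more element.\<close>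

lemma CARD_eq_CHAR_power: "\<exists>n. CARD('a::finite_field) = CHAR('a) ^ n"
proof -
  define p where "p = CHAR('a)"
  have p: "prime p" unfolding p_def by (rule prime_CHAR_finite_field)
  define Q where "Q = (\<lambda>S :: 'a set. 0 \<in> S \<and> (\<forall>x\<in>S. \<forall>y\<in>S. x + y \<in> S) \<and> (\<exists>n. card S = p ^ n))"
  have "Q {0}" by (auto simp: Q_def intro: exI[of _ 0])
  moreover have "card S \<le> CARD('a)" if "Q S" for S by (rule card_mono) auto
  ultimately obtain S where S: "Q S" and max: "\<And>S'. Q S' \<Longrightarrow> card S' \<le> card S"
    using ex_has_greatest_nat[of Q "{0}" card "Suc CARD('a)"] by (auto simp: less_Suc_eq_le)
  have S_add: "x + y \<in> S" if "x \<in> S" "y \<in> S" for x y using S that by (auto simp: Q_def)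
  have S_mult: "of_nat n * x \<in> S" if "x \<in> S" for n x
    using S that by (induction n) (auto simp: Q_def algebra_simps)
  have p0: "(of_nat p :: 'a) = 0" by (simp add: p_def)
  have S_minus: "- x \<in> S" if "x \<in> S" for x
  proof -
    have "of_nat (p - 1) * x = (of_nat p - 1) * x"
      using prime_gt_0_nat[OF p] by (simp add: of_nat_diff)
    then show ?thesis using S_mult[OF that, of "p - 1"] p0 by simp
  qed
  have "S = UNIV"
  proof (rule ccontr)
    assume "S \<noteq> UNIV"
    then obtain x where x: "x \<notin> S" by auto
    define f where "f = (\<lambda>(s, i). s + of_nat i * x)"
    define S' where "S' = f ` (S \<times> {..<p})"
    \<comment> \<open>The translates of \<open>S\<close> by \<open>of_nat i * x\<close> with
      \<open>i < p\<close> are disjoint: a coincidence puts a multiple \<open>of_nat k * x\<close>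
      into \<open>S\<close> with \<open>k\<close> invertible modulo \<open>p\<close>, and then
      \<open>x\<close> itself.\<close>
    have key: "i = j" if "s + of_nat i * x = t + of_nat j * x" "s \<in> S" "t \<in> S" "i < p" "j < p" "i \<le> j"
      for s t i j
    proof (rule ccontr)
      assume "i \<noteq> j"
      define k where "k = j - i"
      have k: "0 < k" "k < p" using that \<open>i \<noteq> j\<close> by (auto simp: k_def)
      have "of_nat k * x = s + - t"
        using that by (simp add: k_def of_nat_diff algebra_simps)
      then have kx: "of_nat k * x \<in> S" using S_add[OF that(2) S_minus[OF that(3)]] by simp
      have "coprime k p" using k p by (metis coprime_commute nat_dvd_not_less prime_imp_coprime)
      then obtain l where "[k * l = Suc 0] (mod p)" using cong_solve_coprime_nat by blast
      then have "(of_nat (k * l) :: 'a) = of_nat 1"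
        unfolding of_nat_eq_iff_mod_CHAR by (simp add: cong_def p_def)
      moreover have "of_nat l * (of_nat k * x) = of_nat (k * l) * x" by (simp add: mult_ac)
      ultimately have "of_nat l * (of_nat k * x) = x" by simp
      then show False using S_mult[OF kx, of l] x by metis
    qed
    have inj: "inj_on f (S \<times> {..<p})"
    proof (rule inj_onI)
      fix a b
      assume ab: "a \<in> S \<times> {..<p}" "b \<in> S \<times> {..<p}" "f a = f b"
      obtain s i t j where *: "a = (s, i)" "b = (t, j)" by (metis surj_pair)
      have "i = j"
        using key[of s i t j] key[of t j s i] ab unfolding * by (cases "i \<le> j") (auto simp: f_def)
      then show "a = b" using ab unfolding * by (simp add: f_def)
    qed
    have "Q S'"
    proof -
      have "f (0, 0) \<in> S'" unfolding S'_def
        using S prime_gt_0_nat[OF p] by (intro imageI) (auto simp: Q_def)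
      then have "0 \<in> S'" by (simp add: f_def)
      moreover have "a + b \<in> S'" if "a \<in> S'" "b \<in> S'" for a b
      proof -
        obtain s i t j where *: "a = f (s, i)" "b = f (t, j)" "s \<in> S" "t \<in> S"
          using \<open>a \<in> S'\<close> \<open>b \<in> S'\<close> by (auto simp: S'_def)
        have "(of_nat ((i + j) mod p) :: 'a) = of_nat (i + j)"
          unfolding of_nat_eq_iff_mod_CHAR by (simp add: p_def)
        then have "a + b = f (s + t, (i + j) mod p)" by (simp add: * f_def algebra_simps)
        moreover have "(s + t, (i + j) mod p) \<in> S \<times> {..<p}"
          using S_add * prime_gt_0_nat[OF p] by simp
        ultimately show ?thesis unfolding S'_def by blast
      qed
      moreover have "\<exists>n. card S' = p ^ n"
      proof -
        obtain n where "card S = p ^ n" using S by (auto simp: Q_def)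
        then have "card S' = p ^ Suc n" by (simp add: S'_def card_image[OF inj] card_cartesian_product)
        then show ?thesis by blast
      qed
      ultimately show ?thesis by (simp add: Q_def)
    qed
    moreover have "card S' = card S * p"
      by (simp add: S'_def card_image[OF inj] card_cartesian_product)
    moreover have "card S > 0" using S prime_gt_0_nat[OF p] by (auto simp: Q_def card_gt_0_iff)
    ultimately have "card S * p \<le> card S" using max by metis
    then show False using \<open>card S > 0\<close> prime_gt_1_nat[OF p] by simp
  qed
  then show ?thesis using S by (simp add: Q_def p_def)
qed

lemma CARD_finite_field_gt_1: "CARD('a::finite_field) > 1"
proof -
  have "card {0, 1 :: 'a} \<le> CARD('a)" by (rule card_mono) auto
  then show ?thesis by simp
qed

section \<open>Evaluation in the algebraic closure and conjugate roots\<close>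

definition ac_eval :: "'a::field poly \<Rightarrow> 'a alg_closure \<Rightarrow> 'a alg_closure" where
  "ac_eval a x = poly (map_poly to_ac a) x"

lemma ac_eval_0 [simp]: "ac_eval 0 x = 0"
  by (simp add: ac_eval_def)

lemma ac_eval_pCons [simp]: "ac_eval (pCons c a) x = to_ac c + x * ac_eval a x"
  by (simp add: ac_eval_def map_poly_pCons)

lemma ac_eval_1 [simp]: "ac_eval 1 x = 1"
  by (simp add: one_pCons)

lemma ac_eval_add [simp]: "ac_eval (a + b) x = ac_eval a x + ac_eval b x"
proof -
  have "map_poly to_ac (a + b) = map_poly to_ac a + map_poly to_ac b"
    by (rule poly_eqI) (simp add: coeff_map_poly)
  then show ?thesis by (simp add: ac_eval_def)
qed

lemma ac_eval_smult [simp]: "ac_eval (smult c a) x = to_ac c * ac_eval a x"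
proof -
  have "map_poly to_ac (smult c a) = smult (to_ac c) (map_poly to_ac a)"
    by (rule poly_eqI) (simp add: coeff_map_poly)
  then show ?thesis by (simp add: ac_eval_def)
qed

lemma ac_eval_mult [simp]: "ac_eval (a * b) x = ac_eval a x * ac_eval b x"
  by (induction a) (auto simp: algebra_simps)

lemma ac_eval_diff [simp]: "ac_eval (a - b) x = ac_eval a x - ac_eval b x"
  using ac_eval_add[of "a - b" b x] by (simp add: algebra_simps)

lemma ac_eval_power [simp]: "ac_eval (a ^ n) x = ac_eval a x ^ n"
  by (induction n) auto

lemma ac_eval_dvd: "P dvd a \<Longrightarrow> ac_eval P x = 0 \<Longrightarrow> ac_eval a x = 0"
  by (elim dvdE) simp

text \<open>\<open>P\<close> is the minimal polynomial of \<open>x\<close> up to a constant, so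
  computing modulo \<open>P\<close> becomes computing with values at \<open>x\<close>.\<close>

lemma ac_eval_eq_0_iff:
  assumes "irreducible P" "ac_eval P x = 0"
  shows "ac_eval a x = 0 \<longleftrightarrow> P dvd a"
proof
  assume a: "ac_eval a x = 0"
  show "P dvd a"
  proof (rule ccontr)
    assume "\<not> P dvd a"
    then obtain s t where "s * P + t * a = 1"
      using poly_coprime_bezout poly_irreducible_coprime[OF assms(1)] by metis
    then have "ac_eval (s * P + t * a) x = 1" by simp
    then show False using a assms(2) by simp
  qed
qed (use ac_eval_dvd assms in blast)

lemma ac_eval_root_exists:
  assumes "degree P > 0"
  obtains x where "ac_eval P x = 0"
proof -
  have "degree (map_poly to_ac P) > 0"
    using assms by (simp add: degree_map_poly)
  then obtain x where "poly (map_poly to_ac P) x = 0" using alg_closed_imp_poly_has_root by blast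
  then show thesis using that by (simp add: ac_eval_def)
qed

lemma frobenius_add:
  fixes x y :: "'a::finite_field alg_closure"
  shows "(x + y) ^ (CARD('a) ^ i) = x ^ (CARD('a) ^ i) + y ^ (CARD('a) ^ i)"
proof -
  obtain n where n: "CARD('a) = CHAR('a) ^ n" using CARD_eq_CHAR_power by blast
  have "CARD('a) ^ i = CHAR('a alg_closure) ^ (n * i)" by (simp add: n power_mult)
  moreover have "prime CHAR('a alg_closure)" using prime_CHAR_finite_field[where 'a = 'a] by simp
  ultimately show ?thesis by (metis freshmans_dream')
qed

lemma frobenius_diff:
  fixes x y :: "'a::finite_field alg_closure"
  shows "(x - y) ^ (CARD('a) ^ i) = x ^ (CARD('a) ^ i) - y ^ (CARD('a) ^ i)"
  using frobenius_add[of "x - y" y i] by (simp add: algebra_simps)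

lemma frobenius_inj:
  fixes x y :: "'a::finite_field alg_closure"
  assumes "x ^ (CARD('a) ^ i) = y ^ (CARD('a) ^ i)"
  shows "x = y"
  using assms frobenius_diff[of x y i] by simp

lemma ac_eval_frobenius:
  fixes a :: "'a::finite_field poly"
  shows "ac_eval a x ^ (CARD('a) ^ i) = ac_eval a (x ^ (CARD('a) ^ i))"
proof (induction a)
  case 0
  then show ?case using CARD_finite_field_gt_1[where 'a = 'a] by (simp add: power_0_left)
next
  case (pCons c a)
  have "to_ac c ^ (CARD('a) ^ i) = to_ac c"
    by (metis finite_field_power_card_power_eq_same to_ac_power)
  then show ?case using pCons by (simp add: frobenius_add power_mult_distrib)
qed

text \<open>Two counts fix the period of \<open>x\<close> under the \<open>q\<close>-th power map.
  If \<open>x\<close> has period \<open>t\<close>, all \<open>q ^ d\<close> values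
  \<open>ac_eval a x\<close> with \<open>a\<close> in \<open>poly_lt d\<close> are roots of
  \<open>X ^ (q ^ t) - X\<close>, so \<open>t \<ge> d\<close>. On the other hand
  \<open>d + 1\<close> different conjugates would be too many roots of \<open>P\<close>, so some
  period is at most \<open>d\<close>.\<close>

lemma ac_conjugates:
  fixes P :: "'a::finite_field poly"
  assumes P: "irreducible P" and x: "ac_eval P x = 0"
  shows "x ^ (CARD('a) ^ degree P) = x"
    and "inj_on (\<lambda>i. x ^ (CARD('a) ^ i)) {..<degree P}"
proof -
  define q where "q = CARD('a)"
  define d where "d = degree P"
  have q1: "q > 1" unfolding q_def by (rule CARD_finite_field_gt_1)
  have P0: "P \<noteq> 0" using P by auto
  define S where "S = (\<lambda>a. ac_eval a x) ` poly_lt d"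
  have "inj_on (\<lambda>a. ac_eval a x) (poly_lt d)"
  proof (rule inj_onI)
    fix a b assume *: "a \<in> poly_lt d" "b \<in> poly_lt d" "ac_eval a x = ac_eval b x"
    then have "P dvd a - b" using ac_eval_eq_0_iff[OF P x, of "a - b"] by simp
    moreover have "a - b \<in> poly_lt d" using * by (simp add: poly_lt_diff)
    ultimately have "a - b = 0"
      by (metis P0 d_def dvd_imp_degree_le not_le poly_lt_iff_degree)
    then show "a = b" by simp
  qed
  then have cardS: "card S = q ^ d" by (simp add: S_def card_image card_poly_lt q_def)
  have period: "d \<le> t" if "x ^ (q ^ t) = x" "t > 0" for t
  proof -
    define f where "f = monom (1 :: 'a alg_closure) (q ^ t) - monom 1 1"
    have qt: "q ^ t > 1" using q1 that by (intro one_less_power) auto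
    then have "coeff f (q ^ t) = 1" by (simp add: f_def)
    then have f0: "f \<noteq> 0" by auto
    have "degree f \<le> q ^ t" unfolding f_def using qt by (intro degree_diff_le) (auto intro: order.trans[OF degree_monom_le])
    then have "card {y. poly f y = 0} \<le> q ^ t" using card_poly_roots_bound[OF f0] by simp
    moreover have "S \<subseteq> {y. poly f y = 0}"
      using that by (auto simp: S_def f_def poly_monom ac_eval_frobenius q_def)
    ultimately have "q ^ d \<le> q ^ t"
      using cardS card_mono[OF poly_roots_finite[OF f0]] by (metis order.trans)
    then show ?thesis using q1 by (simp add: power_increasing_iff)
  qed
  have shift: "x ^ (q ^ (j - i)) = x" if "x ^ (q ^ i) = x ^ (q ^ j)" "i \<le> j" for i j
  proof -
    have "(x ^ (q ^ (j - i))) ^ (q ^ i) = x ^ (q ^ i)"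
      using that by (simp flip: power_mult power_add)
    then show ?thesis using frobenius_inj unfolding q_def by blast
  qed
  have inj: "i = j" if "x ^ (q ^ i) = x ^ (q ^ j)" "i \<le> j" "j < d" for i j
    using shift[OF that(1,2)] period[of "j - i"] that by (cases "i = j") auto
  show "inj_on (\<lambda>i. x ^ (CARD('a) ^ i)) {..<degree P}"
    using inj by (intro inj_onI) (metis d_def q_def lessThan_iff nat_le_linear)
  have "\<not> inj_on (\<lambda>i. x ^ (q ^ i)) {..d}"
  proof
    assume i: "inj_on (\<lambda>i. x ^ (q ^ i)) {..d}"
    have m0: "map_poly to_ac P \<noteq> 0" using P0 by (metis degree_0 degree_map_poly map_poly_eq_0_iff to_ac_0 to_ac_eq_0_iff)
    have "(\<lambda>i. x ^ (q ^ i)) ` {..d} \<subseteq> {y. poly (map_poly to_ac P) y = 0}"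
    proof clarify
      fix i
      have "ac_eval P (x ^ (q ^ i)) = 0"
        using ac_eval_frobenius[of P x i] x q1 by (simp add: q_def power_0_left)
      then show "poly (map_poly to_ac P) (x ^ (q ^ i)) = 0" by (simp add: ac_eval_def)
    qed
    then have "card ((\<lambda>i. x ^ (q ^ i)) ` {..d}) \<le> card {y. poly (map_poly to_ac P) y = 0}"
      by (intro card_mono poly_roots_finite m0)
    also have "\<dots> \<le> degree (map_poly to_ac P)" by (rule card_poly_roots_bound[OF m0])
    finally show False using i by (simp add: card_image degree_map_poly d_def)
  qed
  then obtain i j where ij: "x ^ (q ^ i) = x ^ (q ^ j)" "i < j" "j \<le> d"
    by (auto simp: inj_on_def) (metis linorder_less_linear)
  then have "x ^ (q ^ (j - i)) = x" using shift by simp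
  moreover have "j - i = d" using period[OF calculation] ij by simp
  ultimately show "x ^ (CARD('a) ^ degree P) = x" by (simp add: q_def d_def)
qed

text \<open>The difference of \<open>P\<close> and the product over the conjugates of
  \<open>x\<close> has degree below \<open>degree P\<close>, but vanishes at all of these
  \<open>degree P\<close> conjugates.\<close>

lemma ac_eval_eq_prod:
  fixes P :: "'a::finite_field poly"
  assumes P: "irreducible P" "lead_coeff P = 1" and x: "ac_eval P x = 0"
  shows "ac_eval P y = (\<Prod>i<degree P. y - x ^ (CARD('a) ^ i))"
proof -
  define q where "q = CARD('a)"
  define d where "d = degree P"
  define g where "g = (\<Prod>i<d. [:- (x ^ (q ^ i)), 1:])"
  have degg: "degree g = d" unfolding g_def by (subst degree_prod_eq_sum_degree) auto
  have lcg: "lead_coeff g = 1" unfolding g_def by (simp add: lead_coeff_prod)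
  have degP: "degree (map_poly to_ac P) = d" by (simp add: degree_map_poly d_def)
  define h where "h = map_poly to_ac P - g"
  have "coeff h i = 0" if "i \<ge> d" for i
    using that degg degP lcg P(2)
    by (cases "i = d") (auto simp: h_def coeff_map_poly d_def coeff_eq_0)
  then have hlt: "h \<in> poly_lt d" by (simp add: poly_lt_def)
  have "h = 0"
  proof (rule ccontr)
    assume h0: "h \<noteq> 0"
    have "(\<lambda>i. x ^ (q ^ i)) ` {..<d} \<subseteq> {y. poly h y = 0}"
    proof clarify
      fix i assume "i < d"
      then have "poly g (x ^ (q ^ i)) = 0" by (auto simp: g_def poly_prod)
      moreover have "ac_eval P (x ^ (q ^ i)) = 0"
        using ac_eval_frobenius[of P x i] x CARD_finite_field_gt_1[where 'a = 'a]
        by (simp add: q_def power_0_left)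
      ultimately show "poly h (x ^ (q ^ i)) = 0" by (simp add: h_def ac_eval_def)
    qed
    then have "card ((\<lambda>i. x ^ (q ^ i)) ` {..<d}) \<le> card {y. poly h y = 0}"
      by (intro card_mono poly_roots_finite h0)
    also have "\<dots> \<le> degree h" by (rule card_poly_roots_bound[OF h0])
    also have "\<dots> < d" using hlt h0 by (simp add: poly_lt_iff_degree)
    finally show False using ac_conjugates(2)[OF P(1) x] by (simp add: card_image d_def q_def)
  qed
  then have "map_poly to_ac P = g" by (simp add: h_def)
  then show ?thesis by (simp add: ac_eval_def g_def poly_prod d_def q_def)
qed

section \<open>The cubic residue symbol\<close>

text \<open>A multiplicity, not a product: the exponent in \<open>cubic_symbol\<close>. The set
  under \<open>Max\<close> is finite for irreducible \<open>P\<close> and nonzero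
  \<open>F\<close>.\<close>

definition poly_mult :: "'a::field poly \<Rightarrow> 'a poly \<Rightarrow> nat" where
  "poly_mult P F = Max {k. P ^ k dvd F}"

lemma poly_power_dvd_bound:
  fixes P F :: "'a::field poly"
  assumes "irreducible P" "F \<noteq> 0" "P ^ k dvd F"
  shows "k \<le> degree F"
proof -
  have "degree (P ^ k) \<le> degree F" using assms by (intro dvd_imp_degree_le)
  moreover have "P \<noteq> 0" using assms(1) by auto
  ultimately have "k * degree P \<le> degree F" by (simp add: degree_power_eq)
  then show ?thesis using poly_irreducible_degree_pos[OF assms(1)]
    by (metis One_nat_def Suc_leI le_trans mult.right_neutral mult_le_mono2)
qed

lemma poly_power_dvd_iff_mult:
  fixes P F :: "'a::field poly"
  assumes "irreducible P" "F \<noteq> 0"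
  shows "P ^ k dvd F \<longleftrightarrow> k \<le> poly_mult P F"
proof -
  have "{k. P ^ k dvd F} \<subseteq> {..degree F}" using poly_power_dvd_bound[OF assms] by blast
  then have fin: "finite {k. P ^ k dvd F}" by (rule finite_subset) simp
  have "0 \<in> {k. P ^ k dvd F}" by simp
  then have "{k. P ^ k dvd F} \<noteq> {}" by blast
  from Max_in[OF fin this] have "P ^ poly_mult P F dvd F" by (simp add: poly_mult_def)
  then show ?thesis using Max_ge[OF fin, of k] power_le_dvd[of P "poly_mult P F" F k]
    by (auto simp: poly_mult_def)
qed

lemma poly_mult_eqI:
  fixes P F :: "'a::field poly"
  assumes "irreducible P" "\<not> P dvd G"
  shows "poly_mult P (P ^ k * G) = k"
proof -
  have P0: "P \<noteq> 0" using assms(1) by auto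
  have "G \<noteq> 0" using assms(2) by auto
  then have nz: "P ^ k * G \<noteq> 0" using P0 by simp
  have "k \<le> poly_mult P (P ^ k * G)" using poly_power_dvd_iff_mult[OF assms(1) nz, of k] by simp
  moreover have "\<not> Suc k \<le> poly_mult P (P ^ k * G)"
    using poly_power_dvd_iff_mult[OF assms(1) nz, of "Suc k"] assms(2) P0
    by (simp add: power_Suc2 del: power_Suc)
  ultimately show ?thesis by simp
qed

lemma poly_mult_decomp:
  fixes P F :: "'a::field poly"
  assumes "irreducible P" "F \<noteq> 0"
  obtains G where "F = P ^ poly_mult P F * G" "\<not> P dvd G"
proof -
  have "P ^ poly_mult P F dvd F" using poly_power_dvd_iff_mult[OF assms] by simp
  then obtain G where G: "F = P ^ poly_mult P F * G" by (elim dvdE)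
  have "\<not> P dvd G"
  proof
    assume "P dvd G"
    then have "P ^ Suc (poly_mult P F) dvd F"
      by (subst G) (simp add: power_Suc2 mult_dvd_mono del: power_Suc)
    then show False using poly_power_dvd_iff_mult[OF assms, of "Suc (poly_mult P F)"] by simp
  qed
  with G show thesis by (rule that)
qed

lemma poly_mult_mult:
  fixes P F G :: "'a::field poly"
  assumes "irreducible P" "F \<noteq> 0" "G \<noteq> 0"
  shows "poly_mult P (F * G) = poly_mult P F + poly_mult P G"
proof -
  obtain F' where F: "F = P ^ poly_mult P F * F'" "\<not> P dvd F'" using poly_mult_decomp assms by blast
  obtain G' where G: "G = P ^ poly_mult P G * G'" "\<not> P dvd G'" using poly_mult_decomp assms by blast
  have "F * G = P ^ (poly_mult P F + poly_mult P G) * (F' * G')"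
    by (subst F(1), subst G(1)) (simp add: power_add mult_ac)
  moreover have "\<not> P dvd F' * G'"
    using F(2) G(2) field_poly_irreducible_imp_prime[OF assms(1)] by (simp add: prime_elem_dvd_mult_iff)
  ultimately show ?thesis using poly_mult_eqI[OF assms(1)] by metis
qed

lemma poly_mult_eq_0:
  fixes P F :: "'a::field poly"
  assumes "irreducible P" "\<not> P dvd F"
  shows "poly_mult P F = 0"
  using poly_mult_eqI[OF assms, of 0] by simp

lemma finite_prime_divisors:
  fixes F :: "'a::finite_field poly"
  assumes "F \<noteq> 0"
  shows "finite {P. irreducible P \<and> lead_coeff P = 1 \<and> P dvd F}"
proof (rule finite_subset[OF _ finite_poly_lt[of "Suc (degree F)"]])
  show "{P. irreducible P \<and> lead_coeff P = 1 \<and> P dvd F} \<subseteq> poly_lt (Suc (degree F))"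
    using assms dvd_imp_degree_le[of _ F] by (auto simp: poly_lt_iff_degree less_Suc_eq_le)
qed

text \<open>Allows a common index set for several moduli: primes not dividing \<open>F\<close>
  contribute exponent 0.\<close>

lemma cubic_symbol_eq_prod:
  fixes F :: "'a::finite_field poly"
  assumes "F \<noteq> 0" "finite T" "\<And>P. irreducible P \<Longrightarrow> lead_coeff P = 1 \<Longrightarrow> P dvd F \<Longrightarrow> P \<in> T"
    "\<And>P. P \<in> T \<Longrightarrow> irreducible P \<and> lead_coeff P = 1"
  shows "cubic_symbol \<Omega> F a = (\<Prod>P\<in>T. cubic_symbol_prime \<Omega> P a ^ poly_mult P F)"
  unfolding cubic_symbol_def poly_mult_def[symmetric]
proof (rule prod.mono_neutral_left)
  show "\<forall>i\<in>T - {P. irreducible P \<and> lead_coeff P = 1 \<and> P dvd F}.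
      cubic_symbol_prime \<Omega> i a ^ poly_mult i F = 1"
    using assms(4) poly_mult_eq_0 by force
qed (use assms in auto)

lemma cubic_symbol_mult_modulus:
  fixes F G :: "'a::finite_field poly"
  assumes "F \<noteq> 0" "G \<noteq> 0"
  shows "cubic_symbol \<Omega> (F * G) a = cubic_symbol \<Omega> F a * cubic_symbol \<Omega> G a"
proof -
  define T where "T = {P. irreducible P \<and> lead_coeff P = 1 \<and> P dvd F * G}"
  have fin: "finite T" unfolding T_def using assms by (intro finite_prime_divisors) simp
  have "cubic_symbol \<Omega> (F * G) a = (\<Prod>P\<in>T. cubic_symbol_prime \<Omega> P a ^ poly_mult P (F * G))"
    using assms fin by (intro cubic_symbol_eq_prod) (auto simp: T_def)
  also have "\<dots> = (\<Prod>P\<in>T. cubic_symbol_prime \<Omega> P a ^ poly_mult P F * cubic_symbol_prime \<Omega> P a ^ poly_mult P G)"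
    using assms by (intro prod.cong) (auto simp: T_def poly_mult_mult power_add)
  also have "\<dots> = cubic_symbol \<Omega> F a * cubic_symbol \<Omega> G a"
  proof -
    have "cubic_symbol \<Omega> F a = (\<Prod>P\<in>T. cubic_symbol_prime \<Omega> P a ^ poly_mult P F)"
      using assms fin by (intro cubic_symbol_eq_prod) (auto simp: T_def)
    moreover have "cubic_symbol \<Omega> G a = (\<Prod>P\<in>T. cubic_symbol_prime \<Omega> P a ^ poly_mult P G)"
      using assms fin by (intro cubic_symbol_eq_prod) (auto simp: T_def)
    ultimately show ?thesis by (simp add: prod.distrib)
  qed
  finally show ?thesis .
qed

lemma cubic_symbol_1 [simp]: "cubic_symbol \<Omega> 1 a = 1"
proof -
  have "{P :: 'a poly. irreducible P \<and> lead_coeff P = 1 \<and> P dvd 1} = {}"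
    using irreducible_not_unit by blast
  then show ?thesis by (simp only: cubic_symbol_def prod.empty)
qed

lemma cubic_symbol_irreducible:
  assumes "irreducible P" "lead_coeff P = 1"
  shows "cubic_symbol \<Omega> P a = cubic_symbol_prime \<Omega> P a"
proof -
  have "P \<noteq> 0" using assms by auto
  have "cubic_symbol \<Omega> P a = (\<Prod>R\<in>{P}. cubic_symbol_prime \<Omega> R a ^ poly_mult R P)"
  proof (rule cubic_symbol_eq_prod)
    fix R assume R: "irreducible R" "lead_coeff R = 1" "R dvd P"
    have "\<not> coprime R P" using R poly_irreducible_coprime by blast
    then have "\<not> coprime P R" by (simp add: coprime_commute)
    then have "P dvd R" using poly_irreducible_coprime[OF assms(1)] by blast
    then show "R \<in> {P}" using poly_monic_dvd_antisym R assms(2) by blast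
  qed (use assms \<open>P \<noteq> 0\<close> in auto)
  moreover have "poly_mult P P = 1"
    using poly_mult_eqI[OF assms(1), of 1 1] assms(1) irreducible_not_unit by auto
  ultimately show ?thesis by simp
qed

section \<open>The symbol to prime moduli for a fixed isomorphism of cube roots of unity\<close>

locale cubic_residue =
  fixes \<Omega> :: "complex \<Rightarrow> 'a::finite_field"
  assumes iso: "cube_root_iso \<Omega>" and card_mod_6: "[CARD('a) = 1] (mod 6)"
begin

lemma q_gt_1: "CARD('a) > 1" by (rule CARD_finite_field_gt_1)

text \<open>The map sending \<open>c\<close> to \<open>c ^ N3\<close> is the cubic residue character
  of the constants with values in the field. Evenness of \<open>N3\<close>, which comes from odd
  \<open>q\<close>, frees reciprocity from signs.\<close>

definition N3 :: nat where "N3 = (CARD('a) - 1) div 3"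

lemma N3: "3 * N3 = CARD('a) - 1" "even N3" "N3 > 0"
proof -
  have "CARD('a) mod 6 = 1" using card_mod_6 by (simp add: cong_def)
  then have k: "CARD('a) = 6 * (CARD('a) div 6) + 1" by (metis mult_div_mod_eq)
  define k where "k = CARD('a) div 6"
  have C: "CARD('a) = 6 * k + 1" using k by (simp only: k_def)
  then have "N3 = 2 * k" by (simp add: N3_def)
  moreover have "k > 0" using C q_gt_1 by (cases k) simp_all
  ultimately show "3 * N3 = CARD('a) - 1" "even N3" "N3 > 0" by (simp_all add: C)
qed

lemma Omega_inj_on: "inj_on \<Omega> {\<alpha>. \<alpha> ^ 3 = 1}"
  and Omega_image: "\<Omega> ` {\<alpha>. \<alpha> ^ 3 = 1} = {x. x ^ 3 = 1}"
  using iso by (blast dest: bij_betw_imp_inj_on bij_betw_imp_surj_on iffD1[OF cube_root_iso_def])+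

lemma cube_root_inj: "\<alpha> ^ 3 = 1 \<Longrightarrow> \<beta> ^ 3 = 1 \<Longrightarrow> \<Omega> \<alpha> = \<Omega> \<beta> \<Longrightarrow> \<alpha> = \<beta>"
  by (rule inj_onD[OF Omega_inj_on]) simp_all

lemma cube_root_mult: "\<alpha> ^ 3 = 1 \<Longrightarrow> \<beta> ^ 3 = 1 \<Longrightarrow> \<Omega> (\<alpha> * \<beta>) = \<Omega> \<alpha> * \<Omega> \<beta>"
  using iso[unfolded cube_root_iso_def] by blast

lemma cube_root_surj: "x ^ 3 = 1 \<Longrightarrow> \<exists>\<alpha>. \<alpha> ^ 3 = 1 \<and> \<Omega> \<alpha> = x"
  using eqset_imp_iff[OF Omega_image, of x] by (auto simp: image_iff)

lemma cube_root_cube: "\<alpha> ^ 3 = 1 \<Longrightarrow> \<Omega> \<alpha> ^ 3 = 1"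
  using Omega_image imageI[of \<alpha> "{\<alpha>. \<alpha> ^ 3 = 1}" \<Omega>] by simp

lemma cube_root_1: "\<Omega> 1 = 1"
proof -
  have "\<Omega> 1 * \<Omega> 1 = \<Omega> 1 * 1" using cube_root_mult[of 1 1] by simp
  moreover have "\<Omega> 1 \<noteq> 0" using cube_root_cube[of 1] by auto
  ultimately show ?thesis by (metis mult_left_cancel)
qed

text \<open>A field has at most three cube roots of unity, and \<open>\<Omega>\<close> already
  supplies three in the base field, namely 1, \<open>w\<close> and \<open>w ^ 2\<close>.\<close>

lemma cube_roots_in_base:
  fixes y :: "'a alg_closure"
  assumes "y ^ 3 = 1"
  obtains c where "c ^ 3 = 1" "to_ac c = y"
proof -
  define \<zeta> where "\<zeta> = cis (2 * pi / 3)"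
  have "\<zeta> ^ 3 = cis (real 3 * (2 * pi / 3))" unfolding \<zeta>_def by (subst Complex.DeMoivre) simp
  then have "\<zeta> ^ 3 = 1" by simp
  moreover have "\<zeta> \<noteq> 1" by (simp add: \<zeta>_def complex_eq_iff cos_120)
  ultimately have \<zeta>: "\<zeta> ^ 3 = 1" "\<zeta> \<noteq> 1" by auto
  define w where "w = \<Omega> \<zeta>"
  have w: "w ^ 3 = 1" "w \<noteq> 1"
    using cube_root_cube[OF \<zeta>(1)] cube_root_inj[OF \<zeta>(1), of 1] \<zeta>(2) cube_root_1 by (auto simp: w_def)
  have "(w - 1) * (w ^ 2 + w + 1) = 0" using w(1) by (simp add: algebra_simps power3_eq_cube power2_eq_square)
  then have w2: "w ^ 2 + w + 1 = 0" using w(2) by simp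
  define v where "v = to_ac w"
  have v: "v ^ 2 + v + 1 = 0"
  proof -
    have "v ^ 2 + v + 1 = to_ac (w ^ 2 + w + 1)" by (simp add: v_def)
    then show ?thesis by (simp add: w2)
  qed
  have vv: "v ^ 2 = - v - 1" using v by (simp add: eq_neg_iff_add_eq_0 algebra_simps)
  have "(y - 1) * ((y - v) * (y - v ^ 2)) = (y - 1) * (y ^ 2 + y + 1) + (y - 1) * (v ^ 2 + v + 1) * (v - 1 - y)"
    by (simp add: algebra_simps power2_eq_square)
  also have "\<dots> = y ^ 3 - 1" by (simp add: v) (simp add: algebra_simps power3_eq_cube power2_eq_square)
  finally have "y = 1 \<or> y = v \<or> y = v ^ 2" using assms by auto
  then show thesis
  proof (elim disjE)
    assume "y = 1" then show thesis using that[of 1] by simp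
  next
    assume "y = v" then show thesis using that[of w] w by (simp add: v_def)
  next
    assume "y = v ^ 2"
    moreover have "(w ^ 2) ^ 3 = 1" using w(1) by (metis mult.commute power_mult power_one)
    ultimately show thesis using that[of "w ^ 2"] by (simp add: v_def)
  qed
qed

lemma geometric_sum_q: "(CARD('a) - 1) * (\<Sum>i<d. CARD('a) ^ i) = CARD('a) ^ d - 1"
proof -
  define k where "k = CARD('a) - 1"
  have k: "CARD('a) = Suc k" using q_gt_1 by (simp add: k_def)
  have "k * (\<Sum>i<d. Suc k ^ i) + 1 = Suc k ^ d" by (induction d) (auto simp: algebra_simps)
  then show ?thesis by (simp add: k)
qed

text \<open>Raising to this exponent is the norm from the residue field to the constants, a product
  of \<open>d\<close> conjugates, followed by the \<open>N3\<close>-th power.\<close>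

lemma residue_exponent: "(CARD('a) ^ d - 1) div 3 = N3 * (\<Sum>i<d. CARD('a) ^ i)"
  and residue_exponent_mult_3: "(CARD('a) ^ d - 1) div 3 * 3 = CARD('a) ^ d - 1"
proof -
  have "CARD('a) ^ d - 1 = 3 * (N3 * (\<Sum>i<d. CARD('a) ^ i))" using geometric_sum_q[of d] N3(1) by (simp add: mult.assoc[symmetric])
  then show "(CARD('a) ^ d - 1) div 3 = N3 * (\<Sum>i<d. CARD('a) ^ i)"
    "(CARD('a) ^ d - 1) div 3 * 3 = CARD('a) ^ d - 1" by simp_all
qed

lemma cong_const_iff:
  assumes "irreducible P" "ac_eval P x = 0"
  shows "[a = [:c:]] (mod P) \<longleftrightarrow> ac_eval a x = to_ac c"
  using ac_eval_eq_0_iff[OF assms, of "a - [:c:]"] by (simp add: cong_iff_dvd_diff)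

abbreviation chi_prime :: "'a poly \<Rightarrow> 'a poly \<Rightarrow> complex" where "chi_prime \<equiv> cubic_symbol_prime \<Omega>"

text \<open>Shows that the \<open>THE\<close> in the symbol is met by exactly one value: by
  \<open>ac_conjugates\<close> the power of \<open>ac_eval a x\<close> is a cube root of unity, by
  \<open>cube_roots_in_base\<close> it is a constant, and \<open>\<Omega>\<close> is bijective on
  cube roots of unity.\<close>

lemma symbol_prime:
  assumes P: "irreducible P" and x: "ac_eval P x = 0" and a: "\<not> P dvd a"
  shows "chi_prime P a ^ 3 = 1" (is ?A)
    and "to_ac (\<Omega> (chi_prime P a)) = ac_eval a x ^ ((CARD('a) ^ degree P - 1) div 3)" (is ?B)
proof -
  define y where "y = ac_eval a x ^ ((CARD('a) ^ degree P - 1) div 3)"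
  have ax: "ac_eval a x \<noteq> 0" using ac_eval_eq_0_iff[OF P x] a by simp
  have "Suc (CARD('a) ^ degree P - 1) = CARD('a) ^ degree P" using q_gt_1 by simp
  moreover have "ac_eval a x ^ (CARD('a) ^ degree P) = ac_eval a x"
    by (simp add: ac_eval_frobenius ac_conjugates(1)[OF P x])
  ultimately have "ac_eval a x ^ Suc (CARD('a) ^ degree P - 1) = ac_eval a x" by simp
  then have "ac_eval a x * ac_eval a x ^ (CARD('a) ^ degree P - 1) = ac_eval a x * 1"
    by (simp only: power_Suc mult_1_right)
  then have "ac_eval a x ^ (CARD('a) ^ degree P - 1) = 1"
    by (rule iffD1[OF mult_left_cancel[OF ax]])
  moreover have "(CARD('a) ^ degree P - 1) div 3 * 3 = CARD('a) ^ degree P - 1"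
    by (rule residue_exponent_mult_3)
  ultimately have "y ^ 3 = 1" by (simp add: y_def flip: power_mult)
  then obtain c where c: "c ^ 3 = 1" "to_ac c = y" by (rule cube_roots_in_base)
  then obtain \<alpha> where \<alpha>: "\<alpha> ^ 3 = 1" "\<Omega> \<alpha> = c" using cube_root_surj by blast
  have iff: "[a ^ ((CARD('a) ^ degree P - 1) div 3) = [:\<Omega> \<beta>:]] (mod P) \<longleftrightarrow> \<Omega> \<beta> = c" for \<beta>
    unfolding cong_const_iff[OF P x] ac_eval_power y_def[symmetric] c(2)[symmetric] to_ac_eq_iff
    by (rule eq_commute)
  have "chi_prime P a = \<alpha>"
    unfolding cubic_symbol_prime_def using a
    by (simp only: if_False iff) (rule the_equality, use \<alpha> cube_root_inj in auto)
  then show ?A ?B using \<alpha> c(2) by (simp_all add: y_def)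
qed

lemma symbol_prime_eqI:
  assumes P: "irreducible P" and x: "ac_eval P x = 0" and a: "\<not> P dvd a"
    and "\<beta> ^ 3 = 1" "to_ac (\<Omega> \<beta>) = ac_eval a x ^ ((CARD('a) ^ degree P - 1) div 3)"
  shows "chi_prime P a = \<beta>"
  using symbol_prime[OF P x a] assms(4,5) cube_root_inj by (metis to_ac_eq_iff)

lemma symbol_prime_0: "P dvd a \<Longrightarrow> chi_prime P a = 0"
  by (simp add: cubic_symbol_prime_def)

lemma symbol_prime_mult:
  assumes P: "irreducible P"
  shows "chi_prime P (a * b) = chi_prime P a * chi_prime P b"
proof (cases "P dvd a \<or> P dvd b")
  case True
  then show ?thesis by (auto simp: symbol_prime_0)
next
  case False
  have ab: "\<not> P dvd a * b"
    using False field_poly_irreducible_imp_prime[OF assms(1)] by (simp add: prime_elem_dvd_mult_iff)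
  obtain x where x: "ac_eval P x = 0" using ac_eval_root_exists poly_irreducible_degree_pos[OF P] by blast
  have a: "\<not> P dvd a" and b: "\<not> P dvd b" using False by auto
  show ?thesis
    by (rule symbol_prime_eqI[OF P x ab])
       (simp_all add: power_mult_distrib symbol_prime[OF P x a] symbol_prime[OF P x b] cube_root_mult)
qed

lemma symbol_prime_cong:
  assumes P: "irreducible P" and "P dvd a - b"
  shows "chi_prime P a = chi_prime P b"
proof (cases "P dvd a")
  case True
  moreover have "P dvd b" using dvd_diff[OF True assms(2)] by simp
  ultimately show ?thesis by (simp add: symbol_prime_0)
next
  case False
  then have b: "\<not> P dvd b" using assms(2) by (metis dvd_add_left_iff diff_add_cancel)
  obtain x where x: "ac_eval P x = 0" using ac_eval_root_exists poly_irreducible_degree_pos[OF P] by blast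
  have "ac_eval a x = ac_eval b x" using ac_eval_dvd[OF assms(2) x] by simp
  then show ?thesis using symbol_prime[OF P x b] by (intro symbol_prime_eqI[OF P x False]) auto
qed

section \<open>The cubic residue character of the constants\<close>

definition omega :: "'a \<Rightarrow> complex" where
  "omega c = (if c = 0 then 0 else the_inv_into {\<alpha>. \<alpha> ^ 3 = 1} \<Omega> (c ^ N3))"

lemma power_N3_cube: "c \<noteq> 0 \<Longrightarrow> (c ^ N3) ^ 3 = (1 :: 'a)"
proof -
  assume c: "c \<noteq> 0"
  have "c ^ Suc (CARD('a) - 1) = c" using q_gt_1 by (simp add: finite_field_power_card_eq_same del: power_Suc)
  then have "c * c ^ (CARD('a) - 1) = c * 1" by (simp only: power_Suc mult_1_right)
  then have "c ^ (CARD('a) - 1) = 1" by (rule iffD1[OF mult_left_cancel[OF c]])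
  then show ?thesis using N3(1) by (metis mult.commute power_mult)
qed

lemma omega: "c \<noteq> 0 \<Longrightarrow> omega c ^ 3 = 1" "c \<noteq> 0 \<Longrightarrow> \<Omega> (omega c) = c ^ N3"
proof -
  assume c: "c \<noteq> 0"
  have im: "c ^ N3 \<in> \<Omega> ` {\<alpha>. \<alpha> ^ 3 = 1}" using power_N3_cube[OF c] by (simp only: Omega_image mem_Collect_eq)
  have "omega c \<in> {\<alpha>. \<alpha> ^ 3 = 1}"
    unfolding omega_def using c the_inv_into_into[OF Omega_inj_on im order.refl] by simp
  then show "omega c ^ 3 = 1" by simp
  show "\<Omega> (omega c) = c ^ N3"
    unfolding omega_def using c f_the_inv_into_f[OF Omega_inj_on im] by simp
qed

lemma omega_0 [simp]: "omega 0 = 0"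
  by (simp add: omega_def)

lemma omega_eqI: "c \<noteq> 0 \<Longrightarrow> \<alpha> ^ 3 = 1 \<Longrightarrow> \<Omega> \<alpha> = c ^ N3 \<Longrightarrow> omega c = \<alpha>"
  using omega cube_root_inj by metis

lemma omega_mult: "omega (c * d) = omega c * omega d"
proof (cases "c = 0 \<or> d = 0")
  case False
  then show ?thesis by (intro omega_eqI) (auto simp: power_mult_distrib omega cube_root_mult)
qed auto

lemma omega_1 [simp]: "omega 1 = 1"
  by (rule omega_eqI) (auto simp: cube_root_1)

text \<open>Holds because \<open>N3\<close> is even. Signs can therefore be dropped in the symbol
  computations below.\<close>

lemma omega_uminus [simp]: "omega (- c) = omega c"
proof -
  have "omega (- 1) = 1" using N3(2) by (intro omega_eqI) (auto simp: cube_root_1)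
  then show ?thesis using omega_mult[of "-1" c] by simp
qed

lemma norm_omega: "c \<noteq> 0 \<Longrightarrow> norm (omega c) = 1"
  using omega(1)[of c] by (metis norm_one norm_power power_eq_1_iff norm_ge_zero zero_neq_numeral)

text \<open>A constant equals all its conjugates, so its norm from the residue field is its power
  with exponent \<open>degree P\<close>.\<close>

lemma symbol_prime_const:
  assumes P: "irreducible P"
  shows "chi_prime P [:c:] = omega c ^ degree P"
proof (cases "c = 0")
  case True
  then show ?thesis using poly_irreducible_degree_pos[OF P] by (simp add: symbol_prime_0)
next
  case False
  obtain x where x: "ac_eval P x = 0" using ac_eval_root_exists poly_irreducible_degree_pos[OF P] by blast
  have "degree P > 0" using poly_irreducible_degree_pos[OF P] .
  then have nd: "\<not> P dvd [:c:]" using False dvd_imp_degree_le[of P "[:c:]"] by auto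
  define d where "d = degree P"
  have pw: "(omega c ^ k) ^ 3 = 1 \<and> \<Omega> (omega c ^ k) = (c ^ N3) ^ k" for k
  proof (induction k)
    case (Suc k)
    have "(omega c ^ Suc k) ^ 3 = omega c ^ 3 * (omega c ^ k) ^ 3"
      by (simp only: power_Suc power_mult_distrib)
    then show ?case using Suc omega[OF False] cube_root_mult[of "omega c" "omega c ^ k"] by simp
  qed (simp add: cube_root_1)
  have "c ^ ((CARD('a) ^ d - 1) div 3) = (c ^ N3) ^ d"
  proof -
    have "c ^ ((CARD('a) ^ d - 1) div 3) = (\<Prod>i<d. (c ^ N3) ^ (CARD('a) ^ i))"
      by (simp only: residue_exponent power_mult power_sum)
    also have "\<dots> = (\<Prod>i<d. c ^ N3)"
      using finite_field_power_card_power_eq_same by (intro prod.cong) auto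
    finally show ?thesis by simp
  qed
  then show ?thesis
    using pw[of d] by (intro symbol_prime_eqI[OF P x nd]) (auto simp: d_def simp flip: to_ac_power)
qed

text \<open>Both symbols are the \<open>N3\<close>-th power of the resultant, written as a product over the conjugates
  of the roots \<open>x\<close> and \<open>y\<close>; its antisymmetry is invisible because \<open>N3\<close> is even.\<close>

lemma reciprocity_prime:
  assumes P: "irreducible P" "lead_coeff P = 1" and Q: "irreducible Q" "lead_coeff Q = 1"
  shows "chi_prime P Q = chi_prime Q P"
proof (cases "P = Q")
  case False
  have nPQ: "\<not> P dvd Q"
  proof
    assume "P dvd Q"
    then have "\<not> coprime P Q" using poly_irreducible_coprime[OF P(1)] by blast
    then have "Q dvd P" using poly_irreducible_coprime[OF Q(1)] by (simp add: coprime_commute)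
    then show False using \<open>P dvd Q\<close> False poly_monic_dvd_antisym P Q by blast
  qed
  have nQP: "\<not> Q dvd P"
    using nPQ poly_irreducible_coprime[OF P(1)] poly_irreducible_coprime[OF Q(1)] coprime_commute by blast
  obtain x where x: "ac_eval P x = 0" using ac_eval_root_exists poly_irreducible_degree_pos[OF P(1)] by blast
  obtain y where y: "ac_eval Q y = 0" using ac_eval_root_exists poly_irreducible_degree_pos[OF Q(1)] by blast
  define d e where "d = degree P" and "e = degree Q"
  define R where "R = (\<Prod>i<d. \<Prod>j<e. x ^ (CARD('a) ^ i) - y ^ (CARD('a) ^ j))"
  have "ac_eval Q x ^ ((CARD('a) ^ d - 1) div 3) = (\<Prod>i<d. ac_eval Q x ^ (CARD('a) ^ i)) ^ N3"
    by (simp only: residue_exponent mult.commute[of N3] power_mult power_sum)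
  also have "(\<Prod>i<d. ac_eval Q x ^ (CARD('a) ^ i)) = R"
    unfolding R_def ac_eval_frobenius by (simp only: ac_eval_eq_prod[OF Q y] e_def)
  finally have 1: "ac_eval Q x ^ ((CARD('a) ^ d - 1) div 3) = R ^ N3" .
  have "ac_eval P y ^ ((CARD('a) ^ e - 1) div 3) = (\<Prod>i<e. ac_eval P y ^ (CARD('a) ^ i)) ^ N3"
    by (simp only: residue_exponent mult.commute[of N3] power_mult power_sum)
  also have "(\<Prod>i<e. ac_eval P y ^ (CARD('a) ^ i)) = (\<Prod>j<e. \<Prod>i<d. y ^ (CARD('a) ^ j) - x ^ (CARD('a) ^ i))"
    unfolding ac_eval_frobenius by (simp only: ac_eval_eq_prod[OF P x] d_def)
  also have "\<dots> = (\<Prod>i<d. \<Prod>j<e. (- 1) * (x ^ (CARD('a) ^ i) - y ^ (CARD('a) ^ j)))"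
    by (subst prod.swap) simp
  also have "\<dots> = ((-1) ^ e) ^ d * R"
    unfolding R_def by (subst prod.distrib) (simp add: prod.distrib)
  also have "\<dots> ^ N3 = R ^ N3"
    using N3(2) by (simp add: power_mult_distrib flip: power_mult)
  finally have 2: "ac_eval P y ^ ((CARD('a) ^ e - 1) div 3) = R ^ N3" .
  show ?thesis
    using symbol_prime[OF Q(1) y nQP] 1 2 by (intro symbol_prime_eqI[OF P(1) x nPQ]) (auto simp: d_def e_def)
qed simp

section \<open>The symbol to composite moduli\<close>

abbreviation chi :: "'a poly \<Rightarrow> 'a poly \<Rightarrow> complex" where "chi \<equiv> cubic_symbol \<Omega>"

lemma chi_mult: "chi F (a * b) = chi F a * chi F b"
  unfolding cubic_symbol_def by (simp add: symbol_prime_mult power_mult_distrib prod.distrib)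

lemma chi_mult_prime:
  assumes "irreducible P" "lead_coeff P = 1" "lead_coeff F = 1"
  shows "chi (P * F) a = chi_prime P a * chi F a"
proof -
  have "P \<noteq> 0" "F \<noteq> 0" using assms by auto
  then show ?thesis using assms by (simp add: cubic_symbol_mult_modulus cubic_symbol_irreducible)
qed

lemma chi_cong:
  assumes "lead_coeff F = 1" "F dvd a - b"
  shows "chi F a = chi F b"
  using assms
proof (induction F rule: poly_monic_induct)
  case (mult P F)
  have "P dvd a - b" "F dvd a - b" using mult.prems by (blast dest: dvd_mult_left dvd_mult_right)+
  then have "chi_prime P a = chi_prime P b" "chi F a = chi F b"
    using symbol_prime_cong[OF mult.hyps(1)] mult.IH by blast+
  then show ?case using mult.hyps by (simp add: chi_mult_prime)
qed simp

lemma chi_const: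
  assumes "lead_coeff F = 1"
  shows "chi F [:c:] = omega c ^ degree F"
  using assms
proof (induction F rule: poly_monic_induct)
  case (mult P F)
  have "P \<noteq> 0" "F \<noteq> 0" using mult by auto
  then show ?case using mult by (simp add: chi_mult_prime symbol_prime_const degree_mult_eq power_add)
qed simp

lemma chi_1_right [simp]: "lead_coeff F = 1 \<Longrightarrow> chi F 1 = 1"
  using chi_const[of F 1] by (simp add: one_pCons)

lemma chi_smult: "lead_coeff F = 1 \<Longrightarrow> chi F (smult c a) = omega c ^ degree F * chi F a"
  using chi_mult[of F "[:c:]" a] by (simp add: chi_const)

lemma chi_uminus: "lead_coeff F = 1 \<Longrightarrow> chi F (- a) = chi F a"
  using chi_smult[of F "-1" a] by simp

lemma chi_coprime:
  assumes "lead_coeff F = 1"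
  shows "(if coprime F a then chi F a ^ 3 = 1 else chi F a = 0)"
  using assms
proof (induction F rule: poly_monic_induct)
  case (mult P F)
  obtain x where x: "ac_eval P x = 0" using ac_eval_root_exists poly_irreducible_degree_pos[OF mult(1)] by blast
  show ?case using mult.IH symbol_prime(1)[OF mult(1) x, of a] symbol_prime_0[of P a] mult(1-3)
    by (auto simp: chi_mult_prime poly_coprime_mult_iff poly_irreducible_coprime power_mult_distrib)
qed simp

lemma chi_cube: "lead_coeff F = 1 \<Longrightarrow> coprime F a \<Longrightarrow> chi F a ^ 3 = 1"
  using chi_coprime[of F a] by simp

lemma chi_eq_0: "lead_coeff F = 1 \<Longrightarrow> \<not> coprime F a \<Longrightarrow> chi F a = 0"
  using chi_coprime[of F a] by simp

lemma chi_nz: "lead_coeff F = 1 \<Longrightarrow> coprime F a \<Longrightarrow> chi F a \<noteq> 0"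
  using chi_cube[of F a] by auto

lemma norm_chi: "lead_coeff F = 1 \<Longrightarrow> coprime F a \<Longrightarrow> norm (chi F a) = 1"
  using chi_cube[of F a] by (metis norm_one norm_power power_eq_1_iff norm_ge_zero zero_neq_numeral)

lemma norm_chi_le: "lead_coeff F = 1 \<Longrightarrow> norm (chi F a) \<le> 1"
  using norm_chi[of F a] chi_eq_0[of F a] by (cases "coprime F a") auto

lemma reciprocity_aux:
  assumes "irreducible P" "lead_coeff P = 1" "lead_coeff G = 1"
  shows "chi G P = chi_prime P G"
  using assms(3)
proof (induction G rule: poly_monic_induct)
  case one
  then show ?case using chi_1_right[OF assms(2)] assms by (simp add: cubic_symbol_irreducible)
next
  case (mult R F)
  then show ?case using assms reciprocity_prime[of R P] by (simp add: chi_mult_prime symbol_prime_mult)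
qed

lemma reciprocity:
  assumes "lead_coeff F = 1" "lead_coeff G = 1"
  shows "chi F G = chi G F"
  using assms(1)
proof (induction F rule: poly_monic_induct)
  case (mult P F)
  then show ?case using assms(2) reciprocity_aux[of P G] by (simp add: chi_mult_prime chi_mult)
qed (use assms in simp)

text \<open>Orthogonality: multiplying the variable by some \<open>b\<close> with
  \<open>omega b \<noteq> 1\<close> scales the sum by \<open>omega b ^ j\<close>. Such
  \<open>b\<close> exists because \<open>X ^ N3 - 1\<close> has at most \<open>N3 < q - 1\<close>
  roots.\<close>

lemma sum_omega: "(\<Sum>c\<in>UNIV - {0}. omega c ^ j) = (if 3 dvd j then of_nat (CARD('a) - 1) else 0)"
proof (cases "3 dvd j")
  case True
  then obtain i where "j = 3 * i" by (elim dvdE)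
  then have "(\<Sum>c\<in>UNIV - {0}. omega c ^ j) = (\<Sum>c\<in>UNIV - {0 :: 'a}. 1)"
    by (intro sum.cong) (auto simp: power_mult omega)
  then show ?thesis using True by (simp add: card_Diff_singleton)
next
  case False
  have "\<exists>c::'a. c \<noteq> 0 \<and> c ^ N3 \<noteq> 1"
  proof (rule ccontr)
    assume *: "\<not> ?thesis"
    define f where "f = monom (1 :: 'a) N3 - 1"
    have "coeff f N3 = 1" using N3(3) by (simp add: f_def)
    then have f0: "f \<noteq> 0" by auto
    have "degree f \<le> N3" unfolding f_def by (intro degree_diff_le) (auto simp: degree_monom_le)
    moreover have "UNIV - {0} \<subseteq> {x. poly f x = 0}" using * by (auto simp: f_def poly_monom)
    then have "card (UNIV - {0 :: 'a}) \<le> card {x. poly f x = 0}" by (intro card_mono) auto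
    ultimately have "CARD('a) - 1 \<le> N3" using card_poly_roots_bound[OF f0] by (simp add: card_Diff_singleton)
    then show False using N3 by simp
  qed
  then obtain b :: 'a where b: "b \<noteq> 0" "b ^ N3 \<noteq> 1" by blast
  then have ob: "omega b \<noteq> 1" using omega(2)[OF b(1)] cube_root_1 by auto
  define z where "z = omega b"
  have z3: "z ^ 3 = 1" using omega(1)[OF b(1)] by (simp add: z_def)
  have zj: "z ^ j \<noteq> 1"
  proof
    assume 1: "z ^ j = 1"
    have "z ^ j = z ^ (3 * (j div 3) + j mod 3)" by simp
    also have "\<dots> = z ^ (j mod 3)" by (simp only: power_add power_mult z3 power_one mult_1)
    finally have 2: "z ^ (j mod 3) = 1" using 1 by simp
    have "j mod 3 = 1 \<or> j mod 3 = 2" using False by (auto simp: dvd_eq_mod_eq_0)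
    then show False using 2 z3 ob by (auto simp: z_def power2_eq_square power3_eq_cube)
  qed
  define S where "S = (\<Sum>c\<in>UNIV - {0 :: 'a}. omega c ^ j)"
  have "S = (\<Sum>c\<in>UNIV - {0}. omega (b * c) ^ j)"
    unfolding S_def by (rule sum.reindex_bij_witness[of _ "\<lambda>c. b * c" "\<lambda>c. c / b"]) (use b in auto)
  also have "\<dots> = z ^ j * S" by (simp add: omega_mult power_mult_distrib S_def z_def sum_distrib_left)
  finally have "S = 0" using zj by (simp add: mult_cancel_right1)
  then show ?thesis using False by (simp add: S_def)
qed

end

section \<open>The additive character\<close>

lemma fls_inf_0 [simp]: "poly_to_fls_inf 0 = 0"
  by (simp add: poly_to_fls_inf_def)

lemma fls_inf_pCons:
  "poly_to_fls_inf (pCons c p) = fls_const c + fls_X_inv * poly_to_fls_inf p"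
  by (simp add: poly_to_fls_inf_def map_poly_pCons)

lemma fls_inf_nth:
  "fls_nth (poly_to_fls_inf p) n = (if n \<le> 0 then coeff p (nat (- n)) else 0)"
proof (induction p arbitrary: n)
  case (pCons c p)
  have "fls_nth (poly_to_fls_inf (pCons c p)) n = fls_nth (fls_const c) n + fls_nth (poly_to_fls_inf p) (n + 1)"
    by (simp add: fls_inf_pCons fls_X_inv_times_conv_shift)
  also have "\<dots> = (if n \<le> 0 then coeff (pCons c p) (nat (- n)) else 0)"
  proof (cases "n < 0")
    case True
    then have "nat (- n) = Suc (nat (- (n + 1)))" by simp
    then show ?thesis using True pCons.IH[of "n + 1"] by (simp add: fls_const_nth)
  next
    case False
    then show ?thesis using pCons.IH[of "n + 1"] by (auto simp: fls_const_nth)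
  qed
  finally show ?case .
qed simp

lemma fls_inf_add: "poly_to_fls_inf (a + b) = poly_to_fls_inf a + poly_to_fls_inf b"
  by (rule fls_eqI) (simp add: fls_inf_nth)

lemma fls_inf_uminus: "poly_to_fls_inf (- a) = - poly_to_fls_inf a"
  by (rule fls_eqI) (simp add: fls_inf_nth)

lemma fls_inf_smult: "poly_to_fls_inf (smult c a) = fls_const c * poly_to_fls_inf a"
  by (rule fls_eqI) (simp add: fls_inf_nth)

lemma fls_inf_mult: "poly_to_fls_inf (a * b) = poly_to_fls_inf a * poly_to_fls_inf b"
proof (induction a)
  case (pCons c a)
  have "poly_to_fls_inf (pCons c a * b) = fls_const c * poly_to_fls_inf b + fls_X_inv * poly_to_fls_inf (a * b)"
    by (simp add: fls_inf_add fls_inf_smult fls_inf_pCons)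
  then show ?case using pCons by (simp add: fls_inf_pCons algebra_simps)
qed simp

lemma fls_inf_subdegree: "p \<noteq> 0 \<Longrightarrow> fls_subdegree (poly_to_fls_inf p) = - int (degree p)"
  by (rule fls_subdegree_eqI) (auto simp: fls_inf_nth coeff_eq_0)

lemma fls_inf_eq_0 [simp]: "poly_to_fls_inf p = 0 \<longleftrightarrow> p = 0"
proof
  assume "poly_to_fls_inf p = 0"
  then have "fls_nth (poly_to_fls_inf p) (- int (degree p)) = 0" by simp
  then show "p = 0" by (simp add: fls_inf_nth)
qed simp

abbreviation inf_frac :: "'a::finite_field poly \<Rightarrow> 'a poly \<Rightarrow> 'a fls" where
  "inf_frac A B \<equiv> poly_to_fls_inf A / poly_to_fls_inf B"

text \<open>In powers of \<open>1/T\<close> the expansion of \<open>A / B\<close> starts at index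
  \<open>degree B - degree A\<close>. The character reads index 1: it is trivial if this gap is at
  least 2, and sees the quotient of the leading coefficients if the gap is 1.\<close>

lemma inf_frac_nth_low:
  assumes "B \<noteq> 0" "A = 0 \<or> i < int (degree B) - int (degree A)"
  shows "fls_nth (inf_frac A B) i = 0"
proof (cases "A = 0")
  case False
  then have "fls_subdegree (inf_frac A B) = int (degree B) - int (degree A)"
    using assms(1) by (subst fls_divide_subdegree) (auto simp: fls_inf_subdegree)
  then show ?thesis using assms(2) False by simp
qed simp

lemma inf_frac_nth_lead:
  assumes "B \<noteq> 0" "A \<noteq> 0"
  shows "fls_nth (inf_frac A B) (int (degree B) - int (degree A)) = lead_coeff A / lead_coeff B"
  using fls_divide_nth_base[of "poly_to_fls_inf A" "poly_to_fls_inf B"] assms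
  by (simp add: fls_inf_subdegree fls_inf_nth)

section \<open>The character of the finite field through which \<open>add_char\<close>
  factors\<close>

definition psi0 :: "'a::finite_field \<Rightarrow> complex" where
  "psi0 c = (let k = (THE k. k < CHAR('a) \<and> of_nat k = abs_trace c)
      in exp (2 * of_real pi * \<i> * of_nat k / of_nat CHAR('a)))"

lemma add_char_eq_psi0: "add_char x = psi0 (fls_nth x 1)"
  by (simp add: add_char_def psi0_def)

context
begin

private lemma CHAR_gt_1: "CHAR('a::finite_field) > 1"
  using prime_gt_1_nat[OF prime_CHAR_finite_field] .

private lemma finite_field_degree:
  obtains n where "CARD('a::finite_field) = CHAR('a) ^ n" "n > 0"
    "\<And>x::'a. abs_trace x = (\<Sum>i<n. x ^ (CHAR('a) ^ i))"
proof -
  obtain n where n: "CARD('a) = CHAR('a) ^ n" using CARD_eq_CHAR_power by blast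
  have "(THE m. CARD('a) = CHAR('a) ^ m) = n"
    using CHAR_gt_1[where 'a = 'a] by (intro the_equality) (auto simp: n)
  then have "abs_trace x = (\<Sum>i<n. x ^ (CHAR('a) ^ i))" for x :: 'a
    by (simp add: abs_trace_def)
  moreover have "n > 0" using n CARD_finite_field_gt_1[where 'a = 'a] by (cases n) auto
  ultimately show thesis using that n by blast
qed

private lemma abs_trace_add: "abs_trace (x + y) = abs_trace x + abs_trace (y :: 'a::finite_field)"
proof -
  obtain n where "\<And>x::'a. abs_trace x = (\<Sum>i<n. x ^ (CHAR('a) ^ i))" by (metis finite_field_degree)
  moreover have "(x + y) ^ (CHAR('a) ^ i) = x ^ (CHAR('a) ^ i) + y ^ (CHAR('a) ^ i)" for i
    by (rule freshmans_dream'[OF prime_CHAR_finite_field refl])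
  ultimately show ?thesis by (simp add: sum.distrib)
qed

text \<open>The \<open>p\<close>-th power permutes the conjugates cyclically, as the last one
  returns to \<open>x\<close>. Hence the trace lies in the prime field.\<close>

private lemma abs_trace_power_CHAR: "abs_trace x ^ CHAR('a) = abs_trace (x :: 'a::finite_field)"
proof -
  obtain n where n: "CARD('a) = CHAR('a) ^ n" "\<And>x::'a. abs_trace x = (\<Sum>i<n. x ^ (CHAR('a) ^ i))" 
    by (metis finite_field_degree)
  have "(\<Sum>i<n. x ^ (CHAR('a) ^ i)) ^ CHAR('a) = (\<Sum>i<n. (x ^ (CHAR('a) ^ i)) ^ CHAR('a))"
    by (rule freshmans_dream_sum[OF prime_CHAR_finite_field refl])
  also have "\<dots> = (\<Sum>i<n. x ^ (CHAR('a) ^ Suc i))"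
    by (simp add: mult.commute flip: power_mult)
  also have "\<dots> + x = (\<Sum>i<n. x ^ (CHAR('a) ^ i)) + x"
  proof -
    have "x ^ (CHAR('a) ^ n) = x" using n(1) finite_field_power_card_eq_same[of x] by simp
    then show ?thesis using sum.lessThan_Suc_shift[of "\<lambda>i. x ^ (CHAR('a) ^ i)" n]
      by (simp add: add.commute)
  qed
  finally show ?thesis using n(2) by simp
qed

text \<open>The \<open>p\<close> different elements \<open>of_nat k\<close> are roots of
  \<open>X ^ p - X\<close>, which has no further ones. This makes the \<open>THE\<close> in
  \<open>psi0\<close> well defined.\<close>

private lemma prime_field_elements:
  fixes y :: "'a::finite_field"
  assumes "y ^ CHAR('a) = y"
  shows "\<exists>!k. k < CHAR('a) \<and> of_nat k = y"
proof -
  define p where "p = CHAR('a)"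
  have p1: "p > 1" unfolding p_def by (rule CHAR_gt_1)
  have inj: "inj_on (of_nat :: nat \<Rightarrow> 'a) {..<p}"
    by (rule inj_onI) (simp add: of_nat_eq_iff_mod_CHAR p_def)
  have fr: "(of_nat k :: 'a) ^ p = of_nat k" for k
  proof (induction k)
    case (Suc k)
    have "(1 + of_nat k :: 'a) ^ p = 1 ^ p + of_nat k ^ p"
      unfolding p_def by (rule freshmans_dream[OF prime_CHAR_finite_field refl])
    then show ?case using Suc by simp
  qed (use p1 in auto)
  define f where "f = monom (1 :: 'a) p - monom 1 1"
  have "coeff f p = 1" using p1 by (simp add: f_def)
  then have f0: "f \<noteq> 0" by auto
  have "degree f \<le> p" unfolding f_def
    using p1 by (intro degree_diff_le) (auto intro: order.trans[OF degree_monom_le])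
  then have le: "card {x. poly f x = 0} \<le> p" using card_poly_roots_bound[OF f0] by simp
  have "of_nat ` {..<p} = {x. poly f x = 0}"
  proof (rule card_seteq)
    show "of_nat ` {..<p} \<subseteq> {x. poly f x = 0}" using fr by (auto simp: f_def poly_monom)
    show "card {x. poly f x = 0} \<le> card ((of_nat :: nat \<Rightarrow> 'a) ` {..<p})" using le inj by (simp add: card_image)
  qed (simp add: poly_roots_finite f0)
  then have "y \<in> of_nat ` {..<p}" using assms by (auto simp: f_def poly_monom p_def)
  then show ?thesis using inj by (auto simp: p_def inj_on_def)
qed

private lemma psi0_power:
  obtains k where "k < CHAR('a::finite_field)" "of_nat k = abs_trace (c :: 'a)"
    "psi0 c = exp (2 * of_real pi * \<i> / of_nat CHAR('a)) ^ k"
proof -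
  define k where "k = (THE k. k < CHAR('a) \<and> of_nat k = abs_trace c)"
  have "k < CHAR('a) \<and> of_nat k = abs_trace c"
    unfolding k_def by (rule theI') (rule prime_field_elements[OF abs_trace_power_CHAR])
  moreover have "psi0 c = exp (of_nat k * (2 * of_real pi * \<i> / of_nat CHAR('a)))"
    unfolding psi0_def Let_def k_def[symmetric] by (simp add: mult_ac)
  then have "psi0 c = exp (2 * of_real pi * \<i> / of_nat CHAR('a)) ^ k"
    by (simp only: exp_of_nat_mult)
  ultimately show thesis using that by blast
qed

private lemma root_of_unity_power_CHAR: "exp (2 * of_real pi * \<i> / of_nat CHAR('a::finite_field)) ^ CHAR('a) = 1"
  using CHAR_gt_1[where 'a = 'a] by (simp flip: exp_of_nat_mult)

lemma psi0_add: "psi0 (a + b) = psi0 a * psi0 (b :: 'a::finite_field)"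
proof -
  define p where "p = CHAR('a)"
  define z where "z = exp (2 * of_real pi * \<i> / of_nat CHAR('a))"
  have zp: "z ^ p = 1" unfolding z_def p_def by (rule root_of_unity_power_CHAR)
  have zmod: "z ^ k = z ^ (k mod p)" for k
  proof -
    have "z ^ k = z ^ (p * (k div p) + k mod p)" by simp
    also have "\<dots> = z ^ (k mod p)" by (simp only: power_add power_mult zp power_one mult_1)
    finally show ?thesis .
  qed
  obtain k l m where k: "of_nat k = abs_trace a" "psi0 a = z ^ k" and l: "of_nat l = abs_trace b" "psi0 b = z ^ l"
    and m: "of_nat m = abs_trace (a + b)" "psi0 (a + b) = z ^ m"
    unfolding z_def by (metis psi0_power)
  have "(of_nat m :: 'a) = of_nat (k + l)" by (simp add: m k l abs_trace_add)
  then have "m mod p = (k + l) mod p" by (simp only: of_nat_eq_iff_mod_CHAR p_def)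
  then have "z ^ m = z ^ (k + l)" by (metis zmod)
  then show ?thesis by (simp add: k l m power_add)
qed

lemma norm_psi0 [simp]: "norm (psi0 (c :: 'a::finite_field)) = 1"
proof -
  obtain k where "psi0 c = exp (2 * of_real pi * \<i> / of_nat CHAR('a)) ^ k" by (metis psi0_power)
  then show ?thesis by (simp add: norm_power norm_exp_eq_Re)
qed

text \<open>The trace is a nonzero polynomial of degree below \<open>q\<close>, so it does not
  vanish everywhere; a nonzero trace gives an exponent \<open>0 < k < p\<close> and thus a root of
  unity other than 1.\<close>

lemma psi0_nontrivial: "\<exists>c :: 'a::finite_field. psi0 c \<noteq> 1"
proof -
  define p where "p = CHAR('a)"
  have p1: "p > 1" unfolding p_def by (rule CHAR_gt_1)
  obtain n where n: "CARD('a) = p ^ n" "n > 0" "\<And>x::'a. abs_trace x = (\<Sum>i<n. x ^ (p ^ i))" 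
    unfolding p_def by (metis finite_field_degree)
  have "\<exists>x :: 'a. abs_trace x \<noteq> 0"
  proof (rule ccontr)
    assume *: "\<not> ?thesis"
    define f where "f = (\<Sum>i<n. monom (1 :: 'a) (p ^ i))"
    have "coeff f (p ^ (n - 1)) = (\<Sum>i<n. if i = n - 1 then 1 else 0)"
      unfolding f_def coeff_sum using p1 by (intro sum.cong) auto
    also have "\<dots> = 1" using n(2) by simp
    finally have f0: "f \<noteq> 0" by auto
    have "degree f \<le> p ^ (n - 1)" unfolding f_def
      using p1 n(2) by (intro degree_sum_le) (auto intro!: order.trans[OF degree_monom_le] power_increasing)
    moreover have "{x. poly f x = 0} = UNIV" using * n(3) by (auto simp: f_def poly_sum poly_monom)
    ultimately have "p ^ n \<le> p ^ (n - 1)" using card_poly_roots_bound[OF f0] n(1) by simp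
    then show False using p1 n(2) by simp
  qed
  then obtain x :: 'a where x: "abs_trace x \<noteq> 0" by blast
  obtain k where k: "k < p" "of_nat k = abs_trace x" "psi0 x = exp (2 * of_real pi * \<i> / of_nat p) ^ k"
    unfolding p_def by (metis psi0_power)
  have k0: "k > 0" using k(2) x by (cases k) auto
  have "psi0 x \<noteq> 1"
  proof
    assume "psi0 x = 1"
    then have "exp (of_nat k * (2 * of_real pi * \<i> / of_nat p)) = 1" using k(3) by (simp only: exp_of_nat_mult)
    moreover have "of_nat k * (2 * of_real pi * \<i> / of_nat p) = \<i> * of_real (real k * (2 * pi) / real p)" by simp
    ultimately obtain m where m: "real k * (2 * pi) / real p = of_int (2 * m) * pi"
      by (auto simp only: exp_eq_1 Im_i_times Re_complex_of_real)
    then have "real k * (2 * pi) = of_int (2 * m) * pi * real p" using p1 by (simp only: divide_eq_eq)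
    then have "real k = of_int m * real p" by simp
    then have "int k = m * int p" by (metis of_int_eq_iff of_int_mult of_int_of_nat_eq)
    then have "p dvd k" by (metis dvd_triv_right int_dvd_int_iff)
    then show False using k(1) k0 by (simp add: nat_dvd_not_less)
  qed
  then show ?thesis by blast
qed

end

lemma psi0_0 [simp]: "psi0 (0 :: 'a::finite_field) = 1"
proof -
  have "psi0 (0 :: 'a) * psi0 (0 :: 'a) = psi0 (0 :: 'a) * 1" using psi0_add[of "0 :: 'a" 0] by simp
  moreover have "psi0 (0 :: 'a) \<noteq> 0" using norm_psi0[of "0 :: 'a"] by (metis norm_zero zero_neq_one)
  ultimately show ?thesis by (metis mult_left_cancel)
qed

lemma sum_psi0:
  assumes "b \<noteq> (0 :: 'a::finite_field)"
  shows "(\<Sum>c\<in>UNIV. psi0 (b * c)) = 0"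
proof -
  obtain d :: 'a where d: "psi0 d \<noteq> 1" using psi0_nontrivial by blast
  have "(\<Sum>c\<in>UNIV. psi0 (b * c)) = (\<Sum>c\<in>UNIV. psi0 (b * (c + d / b)))"
    by (rule sum.reindex_bij_witness[of _ "\<lambda>c. c + d / b" "\<lambda>c. c - d / b"]) auto
  also have "\<dots> = psi0 d * (\<Sum>c\<in>UNIV. psi0 (b * c))"
    using assms by (simp add: distrib_left psi0_add sum_distrib_left mult.commute)
  finally show ?thesis using d by (simp add: mult_cancel_right1)
qed

lemma add_char_add: "add_char (x + y) = add_char x * add_char y"
  by (simp add: add_char_eq_psi0 psi0_add)

lemma add_char_poly [simp]: "add_char (poly_to_fls_inf h) = 1"
  by (simp add: add_char_eq_psi0 fls_inf_nth)

lemma norm_add_char [simp]: "norm (add_char x) = 1"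
  by (simp add: add_char_eq_psi0)

lemma add_char_0 [simp]: "add_char 0 = 1"
  by (simp add: add_char_eq_psi0)

lemma add_char_uminus: "add_char (- x) = cnj (add_char x)"
proof -
  have "add_char x * add_char (- x) = 1" using add_char_add[of x "- x"] by simp
  moreover have "add_char x * cnj (add_char x) = 1"
    using complex_norm_square[of "add_char x"] by simp
  moreover have "add_char x \<noteq> 0" using norm_add_char[of x] by (metis norm_zero zero_neq_one)
  ultimately show ?thesis by (metis mult_left_cancel)
qed

lemma add_char_frac_small:
  assumes "B \<noteq> 0" "A = 0 \<or> degree A + 1 < degree B"
  shows "add_char (inf_frac A B) = 1"
  using inf_frac_nth_low[of B A 1] assms by (auto simp: add_char_eq_psi0)

lemma add_char_frac_lead:
  assumes "B \<noteq> 0" "A \<noteq> 0" "degree A + 1 = degree B"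
  shows "add_char (inf_frac A B) = psi0 (lead_coeff A / lead_coeff B)"
proof -
  have "int (degree B) - int (degree A) = 1" using assms(3) by simp
  then show ?thesis using inf_frac_nth_lead[OF assms(1,2)] by (simp add: add_char_eq_psi0)
qed

lemma add_char_frac_cong:
  assumes "B \<noteq> 0" "B dvd A - A'"
  shows "add_char (inf_frac A B) = add_char (inf_frac A' B)"
proof -
  obtain h where "A - A' = B * h" using assms(2) by (elim dvdE)
  then have "A = A' + B * h" by (simp add: algebra_simps)
  then have "inf_frac A B = inf_frac A' B + poly_to_fls_inf h"
    using assms(1) by (simp add: fls_inf_add fls_inf_mult field_simps)
  then show ?thesis by (simp add: add_char_add)
qed

lemma sum_add_char_frac:
  fixes A F :: "'a::finite_field poly"
  assumes "F \<noteq> 0"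
  shows "(\<Sum>w\<in>poly_lt (degree F). add_char (inf_frac (w * A) F)) = (if F dvd A then of_nat (CARD('a) ^ degree F) else 0)"
proof (cases "F dvd A")
  case True
  have "add_char (inf_frac (w * A) F) = 1" for w
    using add_char_frac_cong[OF assms, of "w * A" 0] True by simp
  then show ?thesis using True by (simp add: card_poly_lt)
next
  case False
  define A' where "A' = A mod F"
  have A'0: "A' \<noteq> 0" using False by (simp add: A'_def dvd_eq_mod_eq_0)
  then have dA: "degree A' < degree F" unfolding A'_def using degree_mod_less'[OF assms] by blast
  obtain d :: 'a where d: "psi0 d \<noteq> 1" using psi0_nontrivial by blast
  have d0: "d \<noteq> 0" using d by auto
  \<comment> \<open>\<open>b\<close> and the degree of \<open>v\<close> are chosen so that
    \<open>v * A'\<close> has degree \<open>degree F - 1\<close> and its leading coefficient divided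
    by that of \<open>F\<close> is \<open>d\<close>. Translation by \<open>v\<close> then multiplies
    the sum by \<open>psi0 d\<close>.\<close>
  define b where "b = d * lead_coeff F / lead_coeff A'"
  have b0: "b \<noteq> 0" using d0 assms A'0 by (simp add: b_def)
  define v where "v = monom b (degree F - 1 - degree A')"
  have v0: "v \<noteq> 0" using b0 by (simp add: v_def)
  have dv: "degree v = degree F - 1 - degree A'" using b0 by (simp add: v_def degree_monom_eq)
  have vlt: "v \<in> poly_lt (degree F)" using dv dA by (simp add: poly_lt_iff_degree)
  have "add_char (inf_frac (v * A) F) = add_char (inf_frac (v * A') F)"
  proof (rule add_char_frac_cong[OF assms])
    have "v * A - v * A' = F * (v * (A div F))"
      unfolding A'_def right_diff_distrib[symmetric] minus_mod_eq_mult_div by (simp add: mult_ac)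
    then show "F dvd v * A - v * A'" by simp
  qed
  also have "\<dots> = psi0 (lead_coeff (v * A') / lead_coeff F)"
    using v0 A'0 dA dv assms by (intro add_char_frac_lead) (auto simp: degree_mult_eq)
  also have "lead_coeff (v * A') / lead_coeff F = d"
    using A'0 assms b0 dv by (simp add: lead_coeff_mult) (simp add: v_def b_def)
  finally have ch: "add_char (inf_frac (v * A) F) = psi0 d" .
  define S where "S = (\<Sum>w\<in>poly_lt (degree F). add_char (inf_frac (w * A) F))"
  have "S = (\<Sum>w\<in>poly_lt (degree F). add_char (inf_frac ((w + v) * A) F))"
    unfolding S_def
    by (rule sum.reindex_bij_witness[of _ "\<lambda>w. w + v" "\<lambda>w. w - v"]) (auto simp: vlt poly_lt_add poly_lt_diff)
  also have "\<dots> = psi0 d * S"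
    unfolding S_def sum_distrib_left distrib_right fls_inf_add add_divide_distrib add_char_add ch
    by (intro sum.cong refl mult.commute)
  finally have "S = 0" using d by (simp add: mult_cancel_right1)
  then show ?thesis using False by (simp add: S_def)
qed

section \<open>Transformation of the cubic symbol under unimodular substitutions\<close>

text \<open>Built prime by prime. If \<open>P\<close> divides \<open>a + h * Q\<close>, then it
  divides neither \<open>F\<close>, by the induction hypothesis, nor \<open>Q\<close>; so passing
  from \<open>h\<close> to \<open>h + F\<close> repairs \<open>P\<close> and changes nothing modulo
  \<open>F\<close>.\<close>

lemma poly_coprime_shift_exists:
  fixes a Q F :: "'a::field poly"
  assumes "lead_coeff F = 1" "coprime a Q"
  shows "\<exists>h. coprime (a + h * Q) F"
  using assms(1)
proof (induction F rule: poly_monic_induct)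
  case (mult P F)
  then obtain h where h: "coprime (a + h * Q) F" by blast
  show ?case
  proof (cases "P dvd a + h * Q")
    case False
    then have "coprime P (a + h * Q)" using poly_irreducible_coprime[OF mult(1)] by blast
    then have "coprime (P * F) (a + h * Q)"
      using h by (simp add: poly_coprime_mult_iff coprime_commute)
    then show ?thesis by (auto simp: coprime_commute)
  next
    case True
    have nu: "\<not> is_unit P" using mult(1) by (simp add: irreducible_not_unit)
    have nF: "\<not> P dvd F" using True h nu coprime_common_divisor by blast
    have nQ: "\<not> P dvd Q"
    proof
      assume "P dvd Q"
      moreover from this have "P dvd a" using True by (simp add: dvd_add_left_iff)
      ultimately show False using assms(2) nu coprime_common_divisor by blast
    qed
    have "\<not> P dvd F * Q"
      using nF nQ field_poly_irreducible_imp_prime[OF mult(1)] by (simp add: prime_elem_dvd_mult_iff)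
    then have "\<not> P dvd (a + h * Q) + F * Q" using True by (simp add: dvd_add_right_iff)
    moreover have "(a + h * Q) + F * Q = a + (h + F) * Q" by (simp add: algebra_simps)
    ultimately have 1: "coprime P (a + (h + F) * Q)"
      using poly_irreducible_coprime[OF mult(1)] by simp
    obtain s t where st: "s * (a + h * Q) + t * F = 1" using poly_coprime_bezout[OF h] by blast
    have "s * (a + (h + F) * Q) + (t - s * Q) * F = 1" using st by (simp add: algebra_simps)
    then have "coprime (a + (h + F) * Q) F" by (rule poly_bezout_coprime)
    with 1 have "coprime (P * F) (a + (h + F) * Q)" by (simp add: poly_coprime_mult_iff coprime_commute)
    then show ?thesis by (auto simp: coprime_commute)
  qed
qed (auto intro: exI[of _ 0])

lemma monicsD: "F \<in> monics d \<Longrightarrow> lead_coeff F = 1 \<and> degree F = d"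
  unfolding monics_def by blast

lemma monics_lead: "F \<in> monics d \<Longrightarrow> lead_coeff F = 1"
  and monics_degree: "F \<in> monics d \<Longrightarrow> degree F = d"
  unfolding monics_def by blast+

lemma monicsI: "lead_coeff F = 1 \<Longrightarrow> degree F = d \<Longrightarrow> F \<in> monics d"
  unfolding monics_def by blast

lemma poly_lt_monoD: "u \<in> poly_lt d \<Longrightarrow> d \<le> e \<Longrightarrow> u \<in> poly_lt e"
  using poly_lt_mono by blast

context cubic_residue
begin

text \<open>Shifting \<open>a\<close> by a multiple of \<open>Q\<close> makes it coprime to \<open>F\<close>, and then
  \<open>- a' * u \<equiv> E' mod F\<close>, so that reciprocity applies even when \<open>Q\<close> and \<open>F\<close> have a common factor.\<close>

lemma chi_unimodular:
  assumes Q: "Q \<in> monics k" and E: "E \<in> monics M" and F: "F \<in> monics (k + M)"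
    and D0: "D0 \<in> monics d" and c: "c \<noteq> 0"
    and F_eq: "F = a * smult c D0 + Q * E" and u_eq: "u = b * smult c D0 + y * E"
    and det: "b * Q - a * y = 1"
  shows "chi F u = chi Q y * omega c ^ M * chi D0 E"
proof -
  define D where "D = smult c D0"
  have F_eq: "F = a * D + Q * E" and u_eq: "u = b * D + y * E"
    using F_eq u_eq by (simp_all add: D_def)
  note F1 = monics_lead[OF F] and Fd = monics_degree[OF F]
    and Q1 = monics_lead[OF Q] and Qd = monics_degree[OF Q]
    and D01 = monics_lead[OF D0] and D0d = monics_degree[OF D0]
  have D_eq: "D = u * Q - y * F"
  proof -
    have "u * Q - y * F = D * (b * Q - a * y)" unfolding F_eq u_eq by (simp add: algebra_simps)
    then show ?thesis by (simp add: det)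
  qed
  have E_eq: "E = b * F - a * u"
  proof -
    have "b * F - a * u = E * (b * Q - a * y)" unfolding F_eq u_eq by (simp add: algebra_simps)
    then show ?thesis by (simp add: det)
  qed
  show ?thesis
  proof (cases "coprime F u")
    case False
    have "\<not> coprime D0 E"
    proof
      assume "coprime D0 E"
      then obtain s t where "s * D0 + t * E = 1" by (rule poly_coprime_bezout)
      moreover have "D0 = smult (inverse c) D" using c by (simp add: D_def)
      ultimately have "smult (inverse c) s * D + t * E = 1" by simp
      then have "(smult (inverse c) s * - y + t * b) * F + (smult (inverse c) s * Q - t * a) * u = 1"
        by (subst (asm) D_eq, subst (asm) E_eq) (simp add: algebra_simps smult_diff_right smult_add_right)
      then show False using False poly_bezout_coprime by blast
    qed
    then have "chi D0 E = 0" using chi_eq_0[OF D01] by blast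
    moreover have "chi F u = 0" using chi_eq_0[OF F1] False by blast
    ultimately show ?thesis by simp
  next
    case True
    have "b * Q + (- y) * a = 1" using det by (simp add: algebra_simps)
    then have "coprime Q a" by (rule poly_bezout_coprime)
    then have "coprime a Q" by (simp add: coprime_commute)
    then obtain h0 where h0: "coprime (a + h0 * Q) F"
      using poly_coprime_shift_exists[OF F1] by blast
    \<comment> \<open>A monic multiple of \<open>F\<close> of large degree is added to
      \<open>h0\<close>. It dominates \<open>h0\<close>, \<open>a\<close> and \<open>E\<close>, so
      \<open>a'\<close> and \<open>E0\<close> become monic of known degree, as reciprocity requires,
      and coprimality to \<open>F\<close> is kept.\<close>
    define L where "L = Suc (degree h0 + degree a + degree E)"
    define h where "h = F * monom 1 L + h0"
    have hm: "h \<in> monics (k + M + L)"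
      unfolding h_def
    proof (rule monics_add)
      show "F * monom 1 L \<in> monics (k + M + L)"
        using F by (intro monics_mult) (auto simp: monics_def degree_monom_eq)
      show "h0 \<in> poly_lt (k + M + L)" by (simp add: poly_lt_iff_degree L_def)
    qed
    define H where "H = k + M + L"
    have hm: "h \<in> monics H" using hm by (simp add: H_def)
    define a' where "a' = a + h * Q"
    define E' where "E' = E - h * D"
    have a'm: "a' \<in> monics (H + k)"
      unfolding a'_def
      using monics_add[OF monics_mult[OF hm Q], of a]
      by (simp add: poly_lt_iff_degree H_def L_def add.commute)
    note a'1 = monics_lead[OF a'm] and a'd = monics_degree[OF a'm]
    have cop: "coprime a' F"
    proof -
      obtain s t where "s * (a + h0 * Q) + t * F = 1" using h0 by (rule poly_coprime_bezout)
      then have "s * a' + (t - s * monom 1 L * Q) * F = 1" by (simp add: a'_def h_def algebra_simps)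
      then show ?thesis by (rule poly_bezout_coprime)
    qed
    define E0 where "E0 = h * D0 - smult (inverse c) E"
    have E0m: "E0 \<in> monics (H + d)"
      unfolding E0_def diff_conv_add_uminus
      using monics_add[OF monics_mult[OF hm D0], of "- smult (inverse c) E"] c
      by (simp add: poly_lt_iff_degree H_def L_def)
    note E01 = monics_lead[OF E0m] and E0d = monics_degree[OF E0m]
    have E'_E0: "E' = smult (- c) E0" using c by (simp add: E'_def E0_def D_def smult_diff_right)
    have dvd1: "F dvd E' - - (a' * u)"
    proof -
      have "E' + a' * u = F * (b + h * y) + (h * (u * Q - y * F) - h * D)"
        unfolding E'_def a'_def by (subst (1) E_eq) (simp add: algebra_simps)
      then have "E' + a' * u = F * (b + h * y)" by (simp flip: D_eq)
      then show ?thesis by simp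
    qed
    have r1: "chi F E' = chi F a' * chi F u"
    proof -
      have "chi F E' = chi F (- (a' * u))" using chi_cong[OF F1 dvd1] by blast
      then show ?thesis by (simp only: chi_uminus[OF F1] chi_mult)
    qed
    have F': "F = a' * D + Q * E'" by (simp add: F_eq a'_def E'_def algebra_simps)
    have r2: "chi F E' = omega c ^ (k + M) * chi E0 F"
      by (simp only: E'_E0 chi_smult[OF F1] omega_uminus Fd reciprocity[OF F1 E01])
    have r3: "chi E0 F = chi E0 a' * (omega c ^ (H + d) * chi E0 D0)"
    proof -
      have "E0 dvd F - a' * D" by (simp add: F' E'_E0 dvd_smult)
      then have "chi E0 F = chi E0 (a' * D)" using chi_cong[OF E01] by blast
      then show ?thesis by (simp only: chi_mult D_def chi_smult[OF E01] E0d)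
    qed
    have r4: "omega c ^ d * chi E0 D0 = chi D0 E"
    proof -
      have "E' - E = D0 * (- smult c h)" by (simp add: E'_def D_def mult.commute)
      then have "D0 dvd E' - E" by (metis dvd_triv_left)
      then have "chi D0 E' = chi D0 E" using chi_cong[OF D01] by blast
      then show ?thesis
        by (simp only: E'_E0 chi_smult[OF D01] omega_uminus D0d reciprocity[OF D01 E01])
    qed
    have r5: "chi F a' = chi a' Q * (omega c ^ (H + k) * chi a' E0)"
    proof -
      have "a' dvd F - Q * E'" by (simp add: F')
      then have "chi a' F = chi a' (Q * E')" using chi_cong[OF a'1] by blast
      then show ?thesis
        by (simp only: chi_mult E'_E0 chi_smult[OF a'1] omega_uminus a'd reciprocity[OF F1 a'1])
    qed
    \<comment> \<open>The determinant gives \<open>a * y \<equiv> - 1\<close> modulo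
      \<open>Q\<close>, so the symbols of \<open>a\<close> and \<open>y\<close> modulo
      \<open>Q\<close> are inverse to each other.\<close>
    have r6: "chi a' Q * chi Q y = 1"
    proof -
      have "Q dvd a' - a" by (simp add: a'_def)
      then have 1: "chi Q a' = chi Q a" using chi_cong[OF Q1] by blast
      have "Q dvd a * y - - 1"
      proof -
        have "a * y - - 1 = Q * b" using det by (simp add: algebra_simps)
        then show ?thesis by simp
      qed
      then have "chi Q (a * y) = chi Q (- 1)" using chi_cong[OF Q1] by blast
      then show ?thesis
        by (simp only: reciprocity[OF a'1 Q1] 1 chi_mult[symmetric] chi_uminus[OF Q1] chi_1_right[OF Q1])
    qed
    have X: "chi E0 a' = chi a' E0" by (rule reciprocity[OF E01 a'1])
    \<comment> \<open>This auxiliary factor occurs on both sides of the final identity; coprimality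
      of \<open>a'\<close> and \<open>F\<close> makes it nonzero, and it cancels.\<close>
    have nz: "omega c ^ (H + k) * chi a' E0 \<noteq> 0"
      using chi_nz[OF F1, of a'] cop r5 by (auto simp: coprime_commute)
    have "(omega c ^ (H + k) * chi a' E0) * (chi a' Q * chi F u) = chi F a' * chi F u"
      unfolding r5 by (simp only: mult_ac)
    also have "\<dots> = chi F E'" by (rule r1[symmetric])
    also have "\<dots> = (omega c ^ (H + k) * chi a' E0) * (omega c ^ M * chi D0 E)"
      unfolding r2 r3 X r4[symmetric] by (simp only: power_add mult_ac)
    finally have "chi a' Q * chi F u = omega c ^ M * chi D0 E" using nz by (metis mult_left_cancel)
    then have "chi Q y * (omega c ^ M * chi D0 E) = chi Q y * (chi a' Q * chi F u)" by (simp only:)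
    also have "\<dots> = (chi a' Q * chi Q y) * chi F u" by (simp only: mult_ac)
    finally show ?thesis by (simp only: r6 mult_1 mult.assoc)
  qed
qed

end

section \<open>Farey dissection\<close>

lemma poly_lt_cancel_left:
  fixes p g :: "'a::idom poly"
  assumes "g * p \<in> poly_lt d" "g \<noteq> 0"
  shows "p \<in> poly_lt d"
  using assms by (cases "p = 0") (auto simp: poly_lt_iff_degree degree_mult_eq)

lemma poly_lt_mult_monic_iff:
  fixes u Q :: "'a::field poly"
  assumes "Q \<in> monics k"
  shows "u * Q \<in> poly_lt (m + k) \<longleftrightarrow> u \<in> poly_lt m"
  using assms monics_nz[OF assms]
  by (cases "u = 0") (auto simp: poly_lt_iff_degree degree_mult_eq monics_def)

text \<open>Monic denominators make the representation of a fraction unique. Denominator 1 occurs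
  only as \<open>(1, 0)\<close>, since \<open>poly_lt 0 = {0}\<close>.\<close>

definition farey :: "nat \<Rightarrow> ('a::field poly \<times> 'a poly) set" where
  "farey r = {(Q, y). \<exists>k\<le>r. Q \<in> monics k \<and> y \<in> poly_lt k \<and> coprime Q y}"

text \<open>Pigeonhole on the leading \<open>r\<close> coefficients of \<open>u * Q mod F\<close>; a denominator \<open>Q\<close> of least degree
  is automatically coprime to its numerator.\<close>

lemma farey_exists:
  fixes F u :: "'a::finite_field poly"
  assumes F: "F \<in> monics m" and u: "u \<in> poly_lt m" and rm: "r < m"
  shows "\<exists>Q y. (Q, y) \<in> farey r \<and> u * Q - y * F \<in> poly_lt (m - r)"
proof -
  define P where "P = (\<lambda>Q. Q \<noteq> 0 \<and> Q \<in> poly_lt (Suc r) \<and> (\<exists>y. u * Q - y * F \<in> poly_lt (m - r)))"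
  have F0: "F \<noteq> 0" and dF: "degree F = m" using F monics_nz by (auto simp: monics_def)
  define \<phi> where "\<phi> = (\<lambda>Q. poly_shift (m - r) ((u * Q) mod F))"
  have "\<phi> ` poly_lt (Suc r) \<subseteq> poly_lt r"
    using poly_lt_mod[OF F0] rm by (auto simp: \<phi>_def poly_lt_def coeff_poly_shift dF)
  then have "card (\<phi> ` poly_lt (Suc r)) \<le> CARD('a) ^ r"
    using card_mono[OF finite_poly_lt] by (metis card_poly_lt)
  also have "\<dots> < card (poly_lt (Suc r) :: 'a poly set)"
    using CARD_finite_field_gt_1[where 'a = 'a] by (simp add: card_poly_lt)
  finally have "\<not> inj_on \<phi> (poly_lt (Suc r))" using card_image by force
  then obtain Q1 Q2 where Q12: "Q1 \<in> poly_lt (Suc r)" "Q2 \<in> poly_lt (Suc r)" "Q1 \<noteq> Q2" "\<phi> Q1 = \<phi> Q2"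
    by (auto simp: inj_on_def)
  have "P (Q1 - Q2)" unfolding P_def
  proof (intro conjI exI)
    show "Q1 - Q2 \<noteq> 0" using Q12 by simp
    show "Q1 - Q2 \<in> poly_lt (Suc r)" using Q12 by (simp add: poly_lt_diff)
    have "u * (Q1 - Q2) - ((u * Q1) div F - (u * Q2) div F) * F = (u * Q1) mod F - (u * Q2) mod F"
      by (simp add: algebra_simps flip: minus_div_mult_eq_mod)
    moreover have "\<dots> \<in> poly_lt (m - r)"
    proof -
      have "coeff ((u * Q1) mod F) i = coeff ((u * Q2) mod F) i" if "i \<ge> m - r" for i
      proof -
        have "coeff (\<phi> Q1) (i - (m - r)) = coeff (\<phi> Q2) (i - (m - r))" using Q12 by simp
        then show ?thesis using that by (simp add: \<phi>_def coeff_poly_shift)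
      qed
      then show ?thesis by (simp add: poly_lt_def)
    qed
    ultimately show "u * (Q1 - Q2) - ((u * Q1) div F - (u * Q2) div F) * F \<in> poly_lt (m - r)" by simp
  qed
  then obtain Q where PQ: "P Q" and min: "\<And>Q'. P Q' \<Longrightarrow> degree Q \<le> degree Q'"
    using ex_has_least_nat[of P "Q1 - Q2" degree] by blast
  define l where "l = inverse (lead_coeff Q)"
  have l0: "l \<noteq> 0" using PQ by (simp add: l_def P_def)
  obtain y where y: "u * Q - y * F \<in> poly_lt (m - r)" using PQ by (auto simp: P_def)
  define Q' y' where "Q' = smult l Q" and "y' = smult l y"
  define k where "k = degree Q"
  have Q'm: "Q' \<in> monics k"
    using PQ l0 by (auto simp: Q'_def monics_def k_def l_def P_def)
  have kr: "k \<le> r" using PQ by (auto simp: P_def poly_lt_iff_degree k_def)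
  have D: "u * Q' - y' * F \<in> poly_lt (m - r)"
  proof -
    have "u * Q' - y' * F = smult l (u * Q - y * F)" by (simp add: Q'_def y'_def smult_diff_right)
    then show ?thesis using y by (auto simp: poly_lt_def)
  qed
  have "coprime Q' y'"
  proof (rule coprimeI)
    fix g assume g: "g dvd Q'" "g dvd y'"
    obtain Q2 where Q2: "Q' = g * Q2" using g(1) by (elim dvdE)
    obtain y2 where y2: "y' = g * y2" using g(2) by (elim dvdE)
    have nz: "g \<noteq> 0" "Q2 \<noteq> 0" using Q2 monics_nz[OF Q'm] by auto
    have "u * Q' - y' * F = g * (u * Q2 - y2 * F)" by (simp add: Q2 y2 algebra_simps)
    then have "u * Q2 - y2 * F \<in> poly_lt (m - r)" using D poly_lt_cancel_left nz(1) by metis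
    moreover have dg: "degree Q' = degree g + degree Q2" using Q2 nz by (simp add: degree_mult_eq)
    then have "degree Q2 \<le> k" using Q'm by (simp add: monics_def)
    then have "Q2 \<in> poly_lt (Suc r)" using kr by (simp add: poly_lt_iff_degree)
    ultimately have "P Q2" using nz by (auto simp: P_def)
    then have "k \<le> degree Q2" using min by (simp add: k_def)
    then have "degree g = 0" using dg Q'm by (simp add: monics_def)
    then show "is_unit g" using nz(1) is_unit_iff_degree by blast
  qed
  moreover have "y' \<in> poly_lt k"
  proof -
    have "u * Q' \<in> poly_lt (m + k)" using u poly_lt_mult_monic_iff[OF Q'm] by simp
    moreover have "u * Q' - y' * F \<in> poly_lt (m + k)" by (rule poly_lt_monoD[OF D]) simp
    ultimately have "u * Q' - (u * Q' - y' * F) \<in> poly_lt (m + k)" by (rule poly_lt_diff)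
    then have "y' * F \<in> poly_lt (k + m)" by (simp add: add.commute)
    then show ?thesis using poly_lt_mult_monic_iff[OF F] by simp
  qed
  ultimately have "(Q', y') \<in> farey r" using kr Q'm by (auto simp: farey_def)
  with D show ?thesis by blast
qed

text \<open>The determinant \<open>y' * Q - y * Q'\<close>, multiplied by \<open>F\<close>, is a
  combination of the two small differences and has degree below \<open>m\<close>, the degree of
  \<open>F\<close>; so it is zero. The Farey cells are therefore disjoint, with no overlap to
  correct for.\<close>

lemma farey_unique:
  fixes F u :: "'a::field poly"
  assumes F: "F \<in> monics m" and rm: "r < m"
    and 1: "(Q, y) \<in> farey r" "u * Q - y * F \<in> poly_lt (m - r)"
    and 2: "(Q', y') \<in> farey r" "u * Q' - y' * F \<in> poly_lt (m - r)"
  shows "Q = Q' \<and> y = y'"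
proof -
  obtain k where k: "k \<le> r" "Q \<in> monics k" "coprime Q y" using 1 by (auto simp: farey_def)
  obtain k' where k': "k' \<le> r" "Q' \<in> monics k'" "coprime Q' y'" using 2 by (auto simp: farey_def)
  have lt: "D * Q'' \<in> poly_lt m" if "D \<in> poly_lt (m - r)" "Q'' \<in> monics l" "l \<le> r" for D Q'' :: "'a poly" and l
  proof -
    have "D * Q'' \<in> poly_lt (m - r + l)" using that poly_lt_mult_monic_iff by blast
    then show ?thesis by (rule poly_lt_monoD) (use that rm in simp)
  qed
  have "(u * Q - y * F) * Q' - (u * Q' - y' * F) * Q \<in> poly_lt m"
    using lt[OF 1(2) k'(2,1)] lt[OF 2(2) k(2,1)] by (rule poly_lt_diff)
  moreover have "(u * Q - y * F) * Q' - (u * Q' - y' * F) * Q = (y' * Q - y * Q') * F"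
    by (simp add: algebra_simps)
  ultimately have "(y' * Q - y * Q') * F \<in> poly_lt (0 + m)" by simp
  then have eq: "y' * Q = y * Q'" using poly_lt_mult_monic_iff[OF F, of _ 0] by simp
  have "Q dvd y * Q'" by (metis eq dvd_triv_right)
  then have "Q dvd Q'" using poly_coprime_dvd_mult[OF k(3)] by blast
  have "Q' dvd y' * Q" by (metis eq dvd_triv_right)
  then have "Q' dvd Q" using poly_coprime_dvd_mult[OF k'(3)] by blast
  with \<open>Q dvd Q'\<close> have QQ: "Q = Q'"
    using k k' by (intro poly_monic_dvd_antisym) (auto simp: monics_def)
  moreover have "y = y'" using eq QQ monics_nz[OF k(2)] by simp
  ultimately show ?thesis by blast
qed

lemma farey_eq_Sigma:
  "farey r = (SIGMA Q:(\<Union>k\<le>r. monics k). {y \<in> poly_lt (degree Q). coprime Q y})"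
  by (auto simp: farey_def monics_def)

lemma finite_farey [simp]: "finite (farey r :: ('a::finite_field poly \<times> 'a poly) set)"
  unfolding farey_eq_Sigma by (intro finite_SigmaI finite_UN_I) auto

lemma sum_farey:
  fixes h :: "nat \<Rightarrow> 'a::finite_field poly \<Rightarrow> 'a poly \<Rightarrow> complex"
  shows "(\<Sum>(Q, y)\<in>farey r. h (degree Q) Q y)
       = (\<Sum>k\<le>r. \<Sum>Q\<in>monics k. \<Sum>y\<in>{y \<in> poly_lt k. coprime Q y}. h k Q y)"
proof -
  have "(\<Sum>(Q, y)\<in>farey r. h (degree Q) Q y)
     = (\<Sum>Q\<in>(\<Union>k\<le>r. monics k). \<Sum>y\<in>{y \<in> poly_lt (degree Q). coprime Q y}. h (degree Q) Q y)"
    unfolding farey_eq_Sigma by (rule sum.Sigma[symmetric]) auto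
  also have "\<dots> = (\<Sum>k\<le>r. \<Sum>Q\<in>monics k. \<Sum>y\<in>{y \<in> poly_lt (degree Q). coprime Q y}. h (degree Q) Q y)"
  proof (rule sum.UNION_disjoint)
    show "\<forall>i\<in>{..r}. \<forall>j\<in>{..r}. i \<noteq> j \<longrightarrow> monics i \<inter> monics j = ({} :: 'a poly set)"
      by (auto simp: monics_def)
  qed simp_all
  also have "\<dots> = (\<Sum>k\<le>r. \<Sum>Q\<in>monics k. \<Sum>y\<in>{y \<in> poly_lt k. coprime Q y}. h k Q y)"
    by (intro sum.cong refl) (auto simp: monics_def)
  finally show ?thesis .
qed

text \<open>\<open>a\<close> is reduced modulo \<open>Q\<close> because its size enters the error
  term of \<open>add_char_unimodular\<close>.\<close>

lemma unimodular_completion: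
  fixes Q y :: "'a::field poly"
  assumes Q: "Q \<in> monics k" and cop: "coprime Q y"
  obtains a b where "b * Q - a * y = 1" "a \<in> poly_lt k"
proof -
  obtain s t where st: "s * Q + t * y = 1" using cop by (rule poly_coprime_bezout)
  define a where "a = (- t) mod Q"
  define b where "b = s - ((- t) div Q) * y"
  have a: "a = - t - (- t) div Q * Q" unfolding a_def by (rule minus_div_mult_eq_mod[symmetric])
  have "b * Q - a * y = s * Q + t * y" unfolding a b_def by (simp add: algebra_simps)
  then have "b * Q - a * y = 1" using st by simp
  moreover have "a \<in> poly_lt k"
    using poly_lt_mod[of Q "- t"] Q monics_nz[OF Q] by (simp add: a_def monics_def)
  ultimately show thesis by (rule that)
qed

lemma monics_cancel:
  fixes Q E :: "'a::field poly"
  assumes "Q \<in> monics k" "Q * E \<in> monics m"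
  shows "E \<in> monics (m - k)"
proof (rule monicsI)
  have nz: "Q \<noteq> 0" "E \<noteq> 0" using monics_nz assms by force+
  show "lead_coeff E = 1"
    using monics_lead[OF assms(2)]
    by (simp only: lead_coeff_mult monics_lead[OF assms(1)] mult_1)
  show "degree E = m - k"
    using degree_mult_eq[OF nz] monicsD[OF assms(1)] monicsD[OF assms(2)] by simp
qed

lemma farey_cell_mult_mem:
  fixes a D :: "'a::field poly"
  assumes "a \<in> poly_lt k" "D \<in> poly_lt (m - r)" "k \<le> r" "r < m"
  shows "a * D \<in> poly_lt m"
proof (cases "k = 0")
  case False
  have "a * D \<in> poly_lt (k + (m - r) - 1)" using assms False by (intro poly_lt_mult) auto
  then show ?thesis by (rule poly_lt_monoD) (use assms in simp)
qed (use assms in simp)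

lemma farey_cell_denominator_mem:
  fixes a D Q E :: "'a::field poly"
  assumes "Q \<in> monics k" "E \<in> monics (m - k)"
    and a: "a \<in> poly_lt k" "D \<in> poly_lt (m - r)" "k \<le> r" "r < m"
  shows "a * D + Q * E \<in> monics m"
proof -
  have "Q * E \<in> monics m" using monics_mult[OF assms(1,2)] assms by simp
  then show ?thesis using monics_add[OF _ farey_cell_mult_mem[OF a]] by (simp add: add.commute)
qed

text \<open>The substitution has determinant 1, so the adjugate matrix inverts it. In the new
  variables the cell is a full product: \<open>D\<close> and \<open>E\<close> vary independently,
  which is what allows the sum over \<open>E\<close> to be evaluated.\<close>

lemma sum_farey_cell:
  fixes g :: "'a::finite_field poly \<Rightarrow> 'a poly \<Rightarrow> complex"
  assumes Q: "Q \<in> monics k" and y: "y \<in> poly_lt k" and kr: "k \<le> r" and rm: "r < m"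
    and det: "b * Q - a * y = 1" and a: "a \<in> poly_lt k"
  shows "(\<Sum>(F, u)\<in>{(F, u) \<in> monics m \<times> poly_lt m. u * Q - y * F \<in> poly_lt (m - r)}. g F u)
       = (\<Sum>D\<in>poly_lt (m - r). \<Sum>E\<in>monics (m - k). g (a * D + Q * E) (b * D + y * E))"
proof -
  note aD = farey_cell_mult_mem[OF a _ kr rm]
  note Fmem = farey_cell_denominator_mem[OF Q _ a _ kr rm]
  have inv1: "(b * D + y * E) * Q - y * (a * D + Q * E) = D" for D E
  proof -
    have "(b * D + y * E) * Q - y * (a * D + Q * E) = D * (b * Q - a * y)" by (simp add: algebra_simps)
    then show ?thesis by (simp add: det)
  qed
  have inv2: "b * (a * D + Q * E) - a * (b * D + y * E) = E" for D E
  proof -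
    have "b * (a * D + Q * E) - a * (b * D + y * E) = E * (b * Q - a * y)" by (simp add: algebra_simps)
    then show ?thesis by (simp add: det)
  qed
  have inv3: "a * (u * Q - y * F) + Q * (b * F - a * u) = F" for F u
  proof -
    have "a * (u * Q - y * F) + Q * (b * F - a * u) = F * (b * Q - a * y)" by (simp add: algebra_simps)
    then show ?thesis by (simp add: det)
  qed
  have inv4: "b * (u * Q - y * F) + y * (b * F - a * u) = u" for F u
  proof -
    have "b * (u * Q - y * F) + y * (b * F - a * u) = u * (b * Q - a * y)" by (simp add: algebra_simps)
    then show ?thesis by (simp add: det)
  qed
  have umem: "b * D + y * E \<in> poly_lt m" if "D \<in> poly_lt (m - r)" "E \<in> monics (m - k)" for D E
  proof -
    have "y * (a * D + Q * E) \<in> poly_lt (k + m)" using y poly_lt_mult_monic_iff[OF Fmem[OF that(2,1)]] by blast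
    moreover have "D \<in> poly_lt (k + m)" by (rule poly_lt_monoD[OF that(1)]) simp
    ultimately have "D + y * (a * D + Q * E) \<in> poly_lt (k + m)" by (intro poly_lt_add)
    moreover have "D + y * (a * D + Q * E) = (b * D + y * E) * Q" using inv1[of D E] by (simp add: algebra_simps)
    ultimately have "(b * D + y * E) * Q \<in> poly_lt (m + k)" by (simp add: add.commute)
    then show ?thesis using poly_lt_mult_monic_iff[OF Q] by blast
  qed
  have Emem: "b * F - a * u \<in> monics (m - k)"
    if "F \<in> monics m" "u * Q - y * F \<in> poly_lt (m - r)" for F u
  proof -
    have "Q * (b * F - a * u) = F - a * (u * Q - y * F)" using inv3[of u F] by (simp add: algebra_simps)
    moreover have "F - a * (u * Q - y * F) \<in> monics m"
      using monics_add[OF that(1) poly_lt_uminus[OF aD[OF that(2)]]] by simp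
    ultimately have *: "Q * (b * F - a * u) \<in> monics m" by simp
    show ?thesis by (rule monics_cancel[OF Q *])
  qed
  have "(\<Sum>(F, u)\<in>{(F, u) \<in> monics m \<times> poly_lt m. u * Q - y * F \<in> poly_lt (m - r)}. g F u)
      = (\<Sum>(D, E)\<in>poly_lt (m - r) \<times> monics (m - k). g (a * D + Q * E) (b * D + y * E))"
    by (rule sum.reindex_bij_witness[of _ "\<lambda>(D, E). (a * D + Q * E, b * D + y * E)"
          "\<lambda>(F, u). (u * Q - y * F, b * F - a * u)"])
       (use Fmem umem Emem in \<open>auto simp only: inv1 inv2 inv3 inv4 mem_Collect_eq split_conv mem_Times_iff fst_conv snd_conv\<close>)
  also have "\<dots> = (\<Sum>D\<in>poly_lt (m - r). \<Sum>E\<in>monics (m - k). g (a * D + Q * E) (b * D + y * E))"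
    by (rule sum.cartesian_product[symmetric])
  finally show ?thesis .
qed

lemma sum_farey_dissection:
  fixes g :: "'a::finite_field poly \<Rightarrow> 'a poly \<Rightarrow> complex"
  assumes rm: "r < m"
  shows "(\<Sum>F\<in>monics m. \<Sum>u\<in>poly_lt m. g F u)
       = (\<Sum>(Q, y)\<in>farey r. \<Sum>(F, u)\<in>{(F, u) \<in> monics m \<times> poly_lt m. u * Q - y * F \<in> poly_lt (m - r)}. g F u)"
proof -
  define S where "S = (monics m \<times> poly_lt m :: ('a poly \<times> 'a poly) set)"
  define ok :: "'a poly \<times> 'a poly \<Rightarrow> 'a poly \<times> 'a poly \<Rightarrow> bool"
    where "ok = (\<lambda>(F, u) (Q, y). (Q, y) \<in> farey r \<and> u * Q - y * F \<in> poly_lt (m - r))"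
  define loc where "loc = (\<lambda>x. SOME z. ok x z)"
  have ex: "ok x (loc x)" if "x \<in> S" for x
  proof -
    obtain F u where x: "x = (F, u)" "F \<in> monics m" "u \<in> poly_lt m" using \<open>x \<in> S\<close> by (auto simp: S_def)
    obtain Q y where "(Q, y) \<in> farey r" "u * Q - y * F \<in> poly_lt (m - r)" using farey_exists[OF x(2,3) rm] by blast
    then have "ok x (Q, y)" by (simp add: ok_def x)
    then show ?thesis unfolding loc_def by (rule someI)
  qed
  have loc_mem: "loc x \<in> farey r" if "x \<in> S" for x
    using ex[OF that] by (cases x; cases "loc x") (simp add: ok_def)
  have uniq: "z = z'" if "x \<in> S" "ok x z" "ok x z'" for x z z'
    using that farey_unique[OF _ rm, of "fst x" "fst z" "snd z" "snd x" "fst z'" "snd z'"]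
    by (auto simp: ok_def S_def prod_eq_iff split: prod.splits)
  have "(\<Sum>F\<in>monics m. \<Sum>u\<in>poly_lt m. g F u) = (\<Sum>(F, u)\<in>S. g F u)"
    unfolding S_def by (rule sum.cartesian_product)
  also have "\<dots> = (\<Sum>z\<in>farey r. \<Sum>(F, u)\<in>{x \<in> S. loc x = z}. g F u)"
    by (rule sum.group[symmetric]) (use loc_mem in \<open>auto simp: S_def\<close>)
  also have "\<dots> = (\<Sum>(Q, y)\<in>farey r. \<Sum>(F, u)\<in>{(F, u) \<in> S. u * Q - y * F \<in> poly_lt (m - r)}. g F u)"
  proof (rule sum.cong[OF refl])
    fix z :: "'a poly \<times> 'a poly" assume z: "z \<in> farey r"
    obtain Q y where zQ: "z = (Q, y)" by (cases z)
    have "{x \<in> S. loc x = z} = {(F, u) \<in> S. u * Q - y * F \<in> poly_lt (m - r)}"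
    proof (intro Set.set_eqI iffI)
      fix x assume "x \<in> {x \<in> S. loc x = z}"
      then have "x \<in> S" "ok x z" using ex by blast+
      then show "x \<in> {(F, u) \<in> S. u * Q - y * F \<in> poly_lt (m - r)}" by (auto simp: ok_def zQ)
    next
      fix x assume x: "x \<in> {(F, u) \<in> S. u * Q - y * F \<in> poly_lt (m - r)}"
      then have "x \<in> S" "ok x z" using z by (auto simp: ok_def zQ)
      then show "x \<in> {x \<in> S. loc x = z}" using uniq ex by blast
    qed
    then show "(\<Sum>(F, u)\<in>{x \<in> S. loc x = z}. g F u)
      = (case z of (Q, y) \<Rightarrow> \<Sum>(F, u)\<in>{(F, u) \<in> S. u * Q - y * F \<in> poly_lt (m - r)}. g F u)" by (simp add: zQ)
  qed
  finally show ?thesis by (simp add: S_def)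
qed

section \<open>The coefficients of the generating series\<close>

lemma sum_poly_lt_nonzero:
  fixes h :: "'a::{finite,field} poly \<Rightarrow> 'b::comm_monoid_add"
  shows "(\<Sum>D\<in>poly_lt N - {0}. h D) = (\<Sum>d<N. \<Sum>D0\<in>monics d. \<Sum>c\<in>UNIV - {0}. h (smult c D0))"
proof -
  have "(\<Sum>d<N. \<Sum>D0\<in>monics d. \<Sum>c\<in>UNIV - {0}. h (smult c D0))
      = (\<Sum>(d, D0, c)\<in>(SIGMA d:{..<N}. monics d \<times> (UNIV - {0})). h (smult c D0))"
    by (subst sum.Sigma[symmetric]) (simp_all add: sum.cartesian_product)
  also have "\<dots> = (\<Sum>D\<in>poly_lt N - {0}. h D)"
    by (rule sum.reindex_bij_witness[of _
          "\<lambda>D. (degree D, smult (inverse (lead_coeff D)) D, lead_coeff D)" "\<lambda>(d, D0, c). smult c D0"])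
       (auto simp: monics_def poly_lt_iff_degree)
  finally show ?thesis ..
qed

text \<open>The exact effect of moving \<open>E\<close> by \<open>R\<close>. The degree of the
  correction term decides whether the character notices the move.\<close>

lemma inf_frac_shift:
  assumes "B \<noteq> 0" "E \<noteq> 0" "E + R \<noteq> 0"
  shows "inf_frac A (B * (E + R)) = inf_frac A (B * E) + inf_frac (- (A * R)) (B * E * (E + R))"
proof -
  define e r b a where defs: "e = poly_to_fls_inf E" "r = poly_to_fls_inf R" "b = poly_to_fls_inf B" "a = poly_to_fls_inf A"
  have "poly_to_fls_inf (E + R) \<noteq> 0" using assms(3) by simp
  then have nz: "e + r \<noteq> 0" "e \<noteq> 0" "b \<noteq> 0" using assms by (auto simp: defs fls_inf_add)
  have "a / (b * (e + r)) = a / (b * e) + (- (a * r)) / (b * e * (e + r))"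
    using nz by (simp add: divide_simps) (simp add: algebra_simps)
  then show ?thesis by (simp add: defs fls_inf_mult fls_inf_add fls_inf_uminus)
qed

text \<open>The mean of the character over monic \<open>E\<close> in
  \<open>sum_add_char_monic\<close>: the fraction there has degree \<open>n + d - m - k\<close>, and
  the cases compare this with \<open>- 1\<close>, the degree at which the character becomes
  visible.\<close>

definition top_char :: "nat \<Rightarrow> nat \<Rightarrow> nat \<Rightarrow> nat \<Rightarrow> 'a::finite_field \<Rightarrow> complex" where
  "top_char n m k d c = (if n + d + 1 < m + k then 1 else if n + d + 1 = m + k then psi0 c else 0)"

lemma sum_add_char_monic:
  fixes f D0 Q :: "'a::finite_field poly"
  assumes f: "f \<in> monics n" and D0: "D0 \<in> monics d" and Q: "Q \<in> monics k" and c: "c \<noteq> 0"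
    and km: "k \<le> m" and bound: "n + 2 * d < 2 * m"
  shows "(\<Sum>E\<in>monics (m - k). add_char (inf_frac (smult c (f * D0)) (Q * Q * E)))
       = of_nat CARD('a) ^ (m - k) * top_char n m k d c"
proof -
  define A where "A = smult c (f * D0)"
  have fD: "f * D0 \<in> monics (n + d)" using f D0 by (rule monics_mult)
  have fDn: "lead_coeff (f * D0) = 1" "degree (f * D0) = n + d" using monicsD[OF fD] by blast+
  have dA: "degree A = n + d" using c fDn(2) by (simp add: A_def)
  have lA: "lead_coeff A = c" unfolding A_def lead_coeff_smult fDn(1) by simp
  have A0: "A \<noteq> 0" using lA c by auto
  have QQ: "Q * Q \<in> monics (k + k)" using Q Q by (rule monics_mult)
  have B: "Q * Q * E \<in> monics (m + k)" if "E \<in> monics (m - k)" for E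
    using monics_mult[OF QQ that] km by (simp add: add.commute)
  define H where "H = (\<lambda>E. add_char (inf_frac A (Q * Q * E)))"
  have "(\<Sum>E\<in>monics (m - k). H E) = of_nat CARD('a) ^ (m - k) * top_char n m k d c"
  proof (cases "n + d + 1 \<le> m + k")
    case True
    have "H E = top_char n m k d c" if "E \<in> monics (m - k)" for E
    proof (cases "n + d + 1 = m + k")
      case True
      then have "H E = psi0 (lead_coeff A / lead_coeff (Q * Q * E))" unfolding H_def
        using A0 dA monics_nz[OF B[OF that]] monics_degree[OF B[OF that]]
        by (intro add_char_frac_lead) auto
      also have "\<dots> = psi0 c" by (simp only: monics_lead[OF B[OF that]] lA div_by_1)
      finally show ?thesis using True by (simp add: top_char_def)
    next
      case False
      then have "H E = 1" unfolding H_def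
        using \<open>n + d + 1 \<le> m + k\<close> dA monics_nz[OF B[OF that]] monics_degree[OF B[OF that]]
        by (intro add_char_frac_small) auto
      then show ?thesis using False \<open>n + d + 1 \<le> m + k\<close> by (simp add: top_char_def)
    qed
    then show ?thesis by (simp add: card_monics)
  next
    case False
    \<comment> \<open>At this degree of the shift the correction in \<open>inf_frac_shift\<close>
      has degree exactly \<open>- 1\<close> and contributes \<open>psi0 (- c * v)\<close>; averaging
      over \<open>v\<close> then kills the sum. The hypothesis \<open>bound\<close> makes the
      subtraction exact.\<close>
    define s where "s = 2 * m - n - 1 - d"
    have s: "s < m - k" "n + d + s + 1 = 2 * m" using False bound by (auto simp: s_def)
    define S where "S = (\<Sum>E\<in>monics (m - k). H E)"
    have shift: "S = psi0 (- c * v) * S" for v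
    proof -
      define R where "R = monom v s"
      have R: "R \<in> poly_lt (m - k)" using s(1) by (auto simp: R_def poly_lt_def)
      have HR: "H (E + R) = psi0 (- c * v) * H E" if E: "E \<in> monics (m - k)" for E
      proof -
        have ER: "E + R \<in> monics (m - k)" using E R by (rule monics_add)
        define DD where "DD = Q * Q * E * (E + R)"
        have DD: "DD \<in> monics (m + k + (m - k))" unfolding DD_def by (intro monics_mult B E ER)
        have dDD: "degree DD = 2 * m" using monics_degree[OF DD] km by simp
        have "H (E + R) = H E * add_char (inf_frac (- (A * R)) DD)"
          unfolding H_def DD_def
          by (simp only: inf_frac_shift[OF monics_nz[OF QQ] monics_nz[OF E] monics_nz[OF ER]] add_char_add)
        also have "add_char (inf_frac (- (A * R)) DD) = psi0 (- c * v)"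
        proof (cases "v = 0")
          case False
          then have R0: "R \<noteq> 0" and dR: "degree R = s" by (simp_all add: R_def degree_monom_eq)
          have "add_char (inf_frac (- (A * R)) DD) = psi0 (lead_coeff (- (A * R)) / lead_coeff DD)"
            using A0 R0 monics_nz[OF DD] dA dR dDD s(2)
            by (intro add_char_frac_lead) (auto simp: degree_mult_eq)
          also have "lead_coeff (- (A * R)) = - c * v"
            unfolding lead_coeff_minus lead_coeff_mult lA using False by (simp add: R_def degree_monom_eq)
          finally show ?thesis by (simp only: monics_lead[OF DD] div_by_1)
        qed (simp add: R_def)
        finally show ?thesis by (simp only: mult.commute)
      qed
      have "S = (\<Sum>E\<in>monics (m - k). H (E + R))"
        unfolding S_def by (rule sum_monics_shift[OF R, symmetric])
      also have "\<dots> = psi0 (- c * v) * S" by (simp add: HR S_def sum_distrib_left)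
      finally show ?thesis .
    qed
    have "of_nat CARD('a) * S = (\<Sum>v\<in>(UNIV :: 'a set). S)" by simp
    also have "\<dots> = (\<Sum>v\<in>(UNIV :: 'a set). psi0 (- c * v) * S)" by (intro sum.cong refl shift)
    also have "\<dots> = 0" using sum_psi0[of "- c"] c by (simp add: sum_distrib_right[symmetric])
    finally have "S = 0" by simp
    then show ?thesis using False by (simp add: S_def top_char_def)
  qed
  then show ?thesis by (simp only: H_def A_def)
qed

context cubic_residue
begin

definition gsum :: "nat \<Rightarrow> 'a poly \<Rightarrow> complex" where
  "gsum m f = (\<Sum>F\<in>monics m. gauss_sum \<Omega> f F)"

text \<open>The inner sum is complete modulo \<open>D\<close>, so it vanishes unless
  \<open>D\<close> is a cube. This is how cubes, and with them the poles, enter.\<close>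

definition zsum :: "nat \<Rightarrow> complex" where
  "zsum d = (\<Sum>D\<in>monics d. \<Sum>v\<in>poly_lt d. chi D v)"

lemma gauss_sum_eq:
  assumes "F \<in> monics m"
  shows "gauss_sum \<Omega> f F = (\<Sum>u\<in>poly_lt m. chi F u * add_char (inf_frac (u * f) F))"
  using residues_eq_poly_lt[OF monics_nz[OF assms]] monicsD[OF assms]
  by (simp add: gauss_sum_def)

lemma gauss_sum_coprime:
  assumes "F \<in> monics m"
  shows "gauss_sum \<Omega> f F = (\<Sum>u\<in>{u \<in> poly_lt m. coprime F u}. chi F u * add_char (inf_frac (u * f) F))"
  unfolding gauss_sum_eq[OF assms]
  by (rule sum.mono_neutral_right) (use chi_eq_0[OF monics_lead[OF assms]] in auto)

lemma sum_chi_residues: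
  assumes D0: "D0 \<in> monics d"
  shows "(\<Sum>R\<in>poly_lt d. chi D0 (E + R)) = (\<Sum>v\<in>poly_lt d. chi D0 v)"
proof -
  have D1: "lead_coeff D0 = 1" and dd: "degree D0 = d" using monicsD[OF D0] by blast+
  have nz: "D0 \<noteq> 0" using monics_nz[OF D0] .
  have lt: "w mod D0 \<in> poly_lt d" for w using poly_lt_mod[OF nz] dd by simp
  have id: "w mod D0 = w" if "w \<in> poly_lt d" for w using mod_poly_lt[of w D0] that dd by simp
  show ?thesis
  proof (rule sum.reindex_bij_witness[of _ "\<lambda>v. (v - E) mod D0" "\<lambda>R. (E + R) mod D0"])
    fix R :: "'a poly" assume R: "R \<in> poly_lt d"
    have "((E + R) mod D0 - E) mod D0 = (E + R - E) mod D0" by (rule mod_diff_left_eq)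
    then show "((E + R) mod D0 - E) mod D0 = R" using id[OF R] by simp
    show "(E + R) mod D0 \<in> poly_lt d" by (rule lt)
    show "chi D0 ((E + R) mod D0) = chi D0 (E + R)"
      by (rule chi_cong[OF D1]) (metis dvd_minus_mod dvd_diff_commute)
  next
    fix v :: "'a poly" assume v: "v \<in> poly_lt d"
    have "(E + (v - E) mod D0) mod D0 = (E + (v - E)) mod D0" by (rule mod_add_right_eq)
    then show "(E + (v - E) mod D0) mod D0 = v" using id[OF v] by simp
    show "(v - E) mod D0 \<in> poly_lt d" by (rule lt)
  qed
qed

text \<open>The additive character does not change when \<open>E\<close> is shifted by a polynomial of degree less than
  \<open>d\<close>, so \<open>chi D0 E\<close> may be replaced by its average over the residues modulo \<open>D0\<close>.\<close>

lemma sum_chi_add_char_monic: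
  assumes f: "f \<in> monics n" and D0: "D0 \<in> monics d" and Q: "Q \<in> monics k" and c: "c \<noteq> 0"
    and kr: "k \<le> r" and d: "d < m - r" and nr: "n \<le> 2 * r + 1"
  shows "(\<Sum>E\<in>monics (m - k). chi D0 E * add_char (inf_frac (smult c (f * D0)) (Q * Q * E)))
       = of_nat CARD('a) ^ (m - k) * top_char n m k d c * ((\<Sum>v\<in>poly_lt d. chi D0 v) / of_nat CARD('a) ^ d)"
proof -
  \<comment> \<open>\<open>d \<le> m - r - 1\<close> and \<open>n \<le> 2 * r + 1\<close> give
    \<open>n + 2 * d \<le> 2 * m - 1\<close>, just enough for the character to be blind to shifts of
    degree below \<open>d\<close>.\<close>
  have km: "k \<le> m" and dM: "d \<le> m - k" and bound: "n + 2 * d < 2 * m" using kr d nr by auto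
  define A where "A = smult c (f * D0)"
  have dA: "degree A = n + d"
    using c monics_degree[OF monics_mult[OF f D0]] by (simp add: A_def)
  have QQ: "Q * Q \<in> monics (k + k)" using Q Q by (rule monics_mult)
  define H where "H = (\<lambda>E. add_char (inf_frac A (Q * Q * E)))"
  have shift: "H (E + R) = H E" if E: "E \<in> monics (m - k)" and R: "R \<in> poly_lt d" for E R
  proof -
    have ER: "E + R \<in> monics (m - k)" by (rule monics_add[OF E poly_lt_monoD[OF R dM]])
    define DD where "DD = Q * Q * E * (E + R)"
    have DD: "DD \<in> monics (k + k + (m - k) + (m - k))" unfolding DD_def by (intro monics_mult QQ E ER)
    have dDD: "degree DD = 2 * m" using monics_degree[OF DD] km by simp
    have "H (E + R) = H E * add_char (inf_frac (- (A * R)) DD)"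
      unfolding H_def DD_def
      by (simp only: inf_frac_shift[OF monics_nz[OF QQ] monics_nz[OF E] monics_nz[OF ER]] add_char_add)
    also have "add_char (inf_frac (- (A * R)) DD) = 1"
    proof (rule add_char_frac_small[OF monics_nz[OF DD]])
      show "- (A * R) = 0 \<or> degree (- (A * R)) + 1 < degree DD"
        using R dA dDD bound by (cases "A = 0 \<or> R = 0") (auto simp: degree_mult_eq poly_lt_iff_degree)
    qed
    finally show ?thesis by simp
  qed
  define S where "S = (\<Sum>E\<in>monics (m - k). chi D0 E * H E)"
  have "of_nat CARD('a) ^ d * S = (\<Sum>R\<in>(poly_lt d :: 'a poly set). S)" by (simp add: card_poly_lt)
  also have "\<dots> = (\<Sum>R\<in>poly_lt d. \<Sum>E\<in>monics (m - k). chi D0 (E + R) * H E)"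
  proof (rule sum.cong[OF refl])
    fix R :: "'a poly" assume R: "R \<in> poly_lt d"
    then have R': "R \<in> poly_lt (m - k)" using dM by (rule poly_lt_monoD)
    have "S = (\<Sum>E\<in>monics (m - k). chi D0 (E + R) * H (E + R))"
      unfolding S_def
      by (rule sum_monics_shift[OF R', where h = "\<lambda>E. chi D0 E * H E", symmetric])
    then show "S = (\<Sum>E\<in>monics (m - k). chi D0 (E + R) * H E)" by (simp add: shift R)
  qed
  also have "\<dots> = (\<Sum>E\<in>monics (m - k). (\<Sum>R\<in>poly_lt d. chi D0 (E + R)) * H E)"
    by (subst sum.swap) (simp add: sum_distrib_right)
  also have "\<dots> = (\<Sum>v\<in>poly_lt d. chi D0 v) * (\<Sum>E\<in>monics (m - k). H E)"
    by (simp add: sum_chi_residues[OF D0] sum_distrib_left)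
  also have "(\<Sum>E\<in>monics (m - k). H E) = of_nat CARD('a) ^ (m - k) * top_char n m k d c"
    unfolding H_def A_def by (rule sum_add_char_monic[OF f D0 Q c km bound])
  finally have "S = of_nat CARD('a) ^ (m - k) * top_char n m k d c * ((\<Sum>v\<in>poly_lt d. chi D0 v) / of_nat CARD('a) ^ d)"
    by (simp add: field_simps)
  then show ?thesis by (simp only: S_def H_def A_def)
qed

text \<open>The factor that the cell of \<open>y / Q\<close> contributes beyond
  \<open>chi Q y\<close> and the character of \<open>y * f / Q\<close>. It depends on
  \<open>Q\<close> only through its degree \<open>k\<close>, so summing over the cells reassembles
  Gauss sums of lower degree.\<close>

definition weight :: "nat \<Rightarrow> nat \<Rightarrow> nat \<Rightarrow> nat \<Rightarrow> complex" where
  "weight r n m k = of_nat CARD('a) ^ (m - k) *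
     (\<Sum>d<m - r. zsum d / of_nat CARD('a) ^ d * (\<Sum>c\<in>UNIV - {0}. omega c ^ (m - k) * top_char n m k d c))"

text \<open>As \<open>D = u * Q - y * F\<close>, the fraction \<open>u * f / F\<close> is
  \<open>y * f / Q\<close> plus \<open>f * D / (F * Q)\<close>. Writing \<open>Q * E\<close> for
  \<open>F\<close> in the latter is where the quadratic error in \<open>D\<close> arises; its degree
  is below \<open>- 1\<close> by \<open>nr\<close> and the size of \<open>a\<close> and
  \<open>D\<close>.\<close>

lemma add_char_unimodular:
  assumes f: "f \<in> monics n" and Q: "Q \<in> monics k" and E: "E \<in> monics (m - k)"
    and F: "F \<in> monics m" and F_eq: "F = a * D + Q * E" and u_eq: "u = b * D + y * E"
    and det: "b * Q - a * y = 1" and a: "a \<in> poly_lt k" and D: "D \<in> poly_lt (m - r)"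
    and kr: "k \<le> r" and rm: "r < m" and nr: "n \<le> 2 * r + 1"
  shows "add_char (inf_frac (u * f) F) = add_char (inf_frac (y * f) Q) * add_char (inf_frac (f * D) (Q * Q * E))"
proof -
  define fi Qi Ei Fi ai Di ui bi yi where defs: "fi = poly_to_fls_inf f" "Qi = poly_to_fls_inf Q"
    "Ei = poly_to_fls_inf E" "Fi = poly_to_fls_inf F" "ai = poly_to_fls_inf a" "Di = poly_to_fls_inf D"
    "ui = poly_to_fls_inf u" "bi = poly_to_fls_inf b" "yi = poly_to_fls_inf y"
  have nz: "Qi \<noteq> 0" "Ei \<noteq> 0" "Fi \<noteq> 0"
    using monics_nz[OF Q] monics_nz[OF E] monics_nz[OF F] by (simp_all add: defs)
  have e1: "Fi = ai * Di + Qi * Ei" unfolding defs F_eq by (simp add: fls_inf_add fls_inf_mult)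
  have "u * Q - y * F = D * (b * Q - a * y)" unfolding F_eq u_eq by (simp add: algebra_simps)
  then have "u * Q - y * F = D" by (simp only: det mult_1_right)
  then have "u * Q = y * F + D" by (simp add: algebra_simps)
  then have e2: "ui * Qi = yi * Fi + Di" unfolding defs by (metis fls_inf_add fls_inf_mult)
  have "ui * fi / Fi = yi * fi / Qi + fi * Di / (Fi * Qi)"
  proof -
    have "ui * fi / Fi = (ui * Qi) * fi / (Fi * Qi)" using nz by simp
    then show ?thesis unfolding e2 using nz by (simp add: field_simps)
  qed
  also have "fi * Di / (Fi * Qi) = fi * Di * (Qi * Ei) / (Fi * Qi * Qi * Ei)" using nz by simp
  also have "Qi * Ei = Fi - ai * Di" using e1 by simp
  also have "fi * Di * (Fi - ai * Di) / (Fi * Qi * Qi * Ei)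
      = fi * Di / (Qi * Qi * Ei) + (- (fi * ai * Di * Di)) / (Fi * Qi * Qi * Ei)"
    using nz by (simp add: divide_simps) (simp add: algebra_simps)
  finally have "inf_frac (u * f) F = inf_frac (y * f) Q + (inf_frac (f * D) (Q * Q * E)
      + inf_frac (- (f * a * D * D)) (F * Q * Q * E))"
    by (simp add: defs fls_inf_mult fls_inf_uminus)
  moreover have "add_char (inf_frac (- (f * a * D * D)) (F * Q * Q * E)) = 1"
  proof (rule add_char_frac_small)
    have DD: "F * Q * Q * E \<in> monics (m + k + k + (m - k))" by (intro monics_mult F Q E)
    then show "F * Q * Q * E \<noteq> 0" by (rule monics_nz)
    have dDD: "degree (F * Q * Q * E) = 2 * m + k" using monics_degree[OF DD] kr rm by simp
    show "- (f * a * D * D) = 0 \<or> degree (- (f * a * D * D)) + 1 < degree (F * Q * Q * E)"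
    proof (cases "a = 0 \<or> D = 0")
      case False
      then have "degree a < k" "degree D < m - r" using a D by (auto simp: poly_lt_iff_degree)
      moreover have "degree (- (f * a * D * D)) = n + degree a + degree D + degree D"
        using False monics_nz[OF f] monics_degree[OF f] by (simp add: degree_mult_eq)
      ultimately show ?thesis unfolding dDD using nr rm kr by linarith
    qed auto
  qed
  ultimately show ?thesis by (simp add: add_char_add)
qed

lemma sum_farey_cell_gauss:
  assumes f: "f \<in> monics n" and Q: "Q \<in> monics k" and y: "y \<in> poly_lt k" and cop: "coprime Q y"
    and kr: "k \<le> r" and rm: "r < m" and nr: "n \<le> 2 * r + 1"
  shows "(\<Sum>(F, u)\<in>{(F, u) \<in> monics m \<times> poly_lt m. u * Q - y * F \<in> poly_lt (m - r)}.
            chi F u * add_char (inf_frac (u * f) F))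
       = chi Q y * add_char (inf_frac (y * f) Q) * weight r n m k"
proof -
  obtain a b where det: "b * Q - a * y = 1" and a: "a \<in> poly_lt k" using unimodular_completion[OF Q cop] by blast
  define X0 where "X0 = chi Q y * add_char (inf_frac (y * f) Q)"
  define g where "g = (\<lambda>F u. chi F u * add_char (inf_frac (u * f) F))"
  let ?S = "\<lambda>D0 d. \<Sum>v\<in>poly_lt d. chi D0 v"
  let ?W = "\<lambda>d. \<Sum>c\<in>UNIV - {0}. omega c ^ (m - k) * top_char n m k d c"
  define T where "T = (\<lambda>D. \<Sum>E\<in>monics (m - k). g (a * D + Q * E) (b * D + y * E))"
  note Fmem = farey_cell_denominator_mem[OF Q _ a _ kr rm]
  have "(\<Sum>(F, u)\<in>{(F, u) \<in> monics m \<times> poly_lt m. u * Q - y * F \<in> poly_lt (m - r)}. g F u)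
      = (\<Sum>D\<in>poly_lt (m - r). T D)"
    unfolding T_def by (rule sum_farey_cell[OF Q y kr rm det a])
  also have "\<dots> = T 0 + (\<Sum>D\<in>poly_lt (m - r) - {0}. T D)"
    by (rule sum.remove) auto
  also have "T 0 = 0"
  proof -
    have "chi (Q * E) (y * E) = 0" if E: "E \<in> monics (m - k)" for E
    proof (rule chi_eq_0)
      have QE: "Q * E \<in> monics (k + (m - k))" using Q E by (rule monics_mult)
      then show "lead_coeff (Q * E) = 1" using monicsD by blast
      have "degree E > 0" using monics_degree[OF E] kr rm by simp
      then have "\<not> is_unit E" using is_unit_iff_degree[of E] monics_nz[OF E] by simp
      then show "\<not> coprime (Q * E) (y * E)" using coprime_common_divisor by (metis dvd_triv_right)
    qed
    then show ?thesis by (simp add: T_def g_def)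
  qed
  also have "(\<Sum>D\<in>poly_lt (m - r) - {0}. T D) = (\<Sum>d<m - r. \<Sum>D0\<in>monics d. \<Sum>c\<in>UNIV - {0}. T (smult c D0))"
    by (rule sum_poly_lt_nonzero)
  also have "\<dots> = (\<Sum>d<m - r. \<Sum>D0\<in>monics d. \<Sum>c\<in>UNIV - {0}.
      X0 * (omega c ^ (m - k) * (of_nat CARD('a) ^ (m - k) * top_char n m k d c *
        (?S D0 d / of_nat CARD('a) ^ d))))"
  proof (intro sum.cong refl)
    fix d and D0 :: "'a poly" and c :: 'a
    assume "d \<in> {..<m - r}" and D0: "D0 \<in> monics d" and "c \<in> UNIV - {0}"
    then have d: "d < m - r" and c: "c \<noteq> 0" by auto
    have D: "smult c D0 \<in> poly_lt (m - r)"
      using d D0 by (auto simp: poly_lt_iff_degree monics_def)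
    have "T (smult c D0) = (\<Sum>E\<in>monics (m - k). X0 * omega c ^ (m - k) *
        (chi D0 E * add_char (inf_frac (smult c (f * D0)) (Q * Q * E))))"
      unfolding T_def
    proof (rule sum.cong[OF refl])
      fix E :: "'a poly" assume E: "E \<in> monics (m - k)"
      note F = Fmem[OF E D]
      have F': "a * smult c D0 + Q * E \<in> monics (k + (m - k))" using F kr rm by simp
      have "chi (a * smult c D0 + Q * E) (b * smult c D0 + y * E) = chi Q y * omega c ^ (m - k) * chi D0 E"
        by (rule chi_unimodular[OF Q E F' D0 c refl refl det])
      moreover have "add_char (inf_frac ((b * smult c D0 + y * E) * f) (a * smult c D0 + Q * E))
          = add_char (inf_frac (y * f) Q) * add_char (inf_frac (f * smult c D0) (Q * Q * E))"
        by (rule add_char_unimodular[OF f Q E F refl refl det a D kr rm nr])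
      ultimately show "g (a * smult c D0 + Q * E) (b * smult c D0 + y * E)
        = X0 * omega c ^ (m - k) * (chi D0 E * add_char (inf_frac (smult c (f * D0)) (Q * Q * E)))"
        by (simp add: g_def X0_def mult_ac)
    qed
    also have "\<dots> = X0 * omega c ^ (m - k) * (of_nat CARD('a) ^ (m - k) * top_char n m k d c *
        (?S D0 d / of_nat CARD('a) ^ d))"
      by (simp only: sum_distrib_left[symmetric] sum_chi_add_char_monic[OF f D0 Q c kr d nr])
    finally show "T (smult c D0) = X0 * (omega c ^ (m - k) * (of_nat CARD('a) ^ (m - k) * top_char n m k d c *
        (?S D0 d / of_nat CARD('a) ^ d)))" by (simp only: mult.assoc)
  qed
  also have "\<dots> = X0 * (of_nat CARD('a) ^ (m - k) *
      (\<Sum>d<m - r. zsum d / of_nat CARD('a) ^ d * ?W d))"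
  proof -
    have "(\<Sum>D0\<in>monics d. \<Sum>c\<in>UNIV - {0}.
      X0 * (omega c ^ (m - k) * (of_nat CARD('a) ^ (m - k) * top_char n m k d c *
        (?S D0 d / of_nat CARD('a) ^ d))))
      = X0 * of_nat CARD('a) ^ (m - k) * (zsum d / of_nat CARD('a) ^ d * ?W d)"
      for d
    proof -
      have "(\<Sum>D0\<in>monics d. \<Sum>c\<in>UNIV - {0}.
        X0 * (omega c ^ (m - k) * (of_nat CARD('a) ^ (m - k) * top_char n m k d c *
          (?S D0 d / of_nat CARD('a) ^ d))))
        = (\<Sum>D0\<in>monics d. (X0 * of_nat CARD('a) ^ (m - k) / of_nat CARD('a) ^ d) *
            (?S D0 d * ?W d))"
        unfolding sum_distrib_left[of _ _ "UNIV - {0 :: 'a}"] by (intro sum.cong refl) (simp add: mult_ac)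
      also have "\<dots> = (X0 * of_nat CARD('a) ^ (m - k) / of_nat CARD('a) ^ d) *
            (zsum d * ?W d)"
        by (simp only: zsum_def sum_distrib_left[symmetric] sum_distrib_right[symmetric])
      finally show ?thesis by (simp add: mult_ac)
    qed
    then show ?thesis by (simp add: sum_distrib_left mult.assoc)
  qed
  finally show ?thesis by (simp add: X0_def g_def weight_def)
qed

lemma gsum_formula:
  assumes f: "f \<in> monics n" and rm: "r < m" and nr: "n \<le> 2 * r + 1"
  shows "gsum m f = (\<Sum>k\<le>r. gsum k f * weight r n m k)"
proof -
  have "gsum m f = (\<Sum>F\<in>monics m. \<Sum>u\<in>poly_lt m. chi F u * add_char (inf_frac (u * f) F))"
    unfolding gsum_def by (intro sum.cong refl gauss_sum_eq)
  also have "\<dots> = (\<Sum>(Q, y)\<in>farey r. \<Sum>(F, u)\<in>{(F, u) \<in> monics m \<times> poly_lt m. u * Q - y * F \<in> poly_lt (m - r)}.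
      chi F u * add_char (inf_frac (u * f) F))"
    by (rule sum_farey_dissection[OF rm])
  also have "\<dots> = (\<Sum>(Q, y)\<in>farey r. chi Q y * add_char (inf_frac (y * f) Q) * weight r n m (degree Q))"
  proof (intro sum.cong refl, clarify)
    fix Q y :: "'a poly" assume "(Q, y) \<in> farey r"
    then obtain k where k: "k \<le> r" "Q \<in> monics k" "y \<in> poly_lt k" "coprime Q y" by (auto simp: farey_def)
    have "degree Q = k" using monicsD[OF k(2)] by blast
    then show "(\<Sum>(F, u)\<in>{(F, u) \<in> monics m \<times> poly_lt m. u * Q - y * F \<in> poly_lt (m - r)}.
        chi F u * add_char (inf_frac (u * f) F)) = chi Q y * add_char (inf_frac (y * f) Q) * weight r n m (degree Q)"
      by (simp only: sum_farey_cell_gauss[OF f k(2,3,4,1) rm nr])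
  qed
  also have "\<dots> = (\<Sum>k\<le>r. \<Sum>Q\<in>monics k. \<Sum>y\<in>{y \<in> poly_lt k. coprime Q y}.
      chi Q y * add_char (inf_frac (y * f) Q) * weight r n m k)"
    by (rule sum_farey[where h = "\<lambda>k Q y. chi Q y * add_char (inf_frac (y * f) Q) * weight r n m k"])
  also have "\<dots> = (\<Sum>k\<le>r. gsum k f * weight r n m k)"
    unfolding gsum_def by (intro sum.cong refl) (simp add: sum_distrib_right gauss_sum_coprime)
  finally show ?thesis .
qed

end

section \<open>Evaluation of the weights\<close>

context cubic_residue
begin

definition zterm :: "nat \<Rightarrow> complex" where
  "zterm d = zsum d / of_nat CARD('a) ^ d"

lemma zsum_0: "zsum 0 = 1"
  by (simp add: zsum_def monics_0)

lemma sum_chi_monic: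
  assumes D0: "D0 \<in> monics d" and d: "d \<le> m"
  shows "(\<Sum>F\<in>monics m. chi D0 F) = of_nat CARD('a) ^ m * ((\<Sum>v\<in>poly_lt d. chi D0 v) / of_nat CARD('a) ^ d)"
proof -
  define S where "S = (\<Sum>F\<in>monics m. chi D0 F)"
  have "of_nat CARD('a) ^ d * S = (\<Sum>R\<in>(poly_lt d :: 'a poly set). S)" by (simp add: card_poly_lt)
  also have "\<dots> = (\<Sum>R\<in>poly_lt d. \<Sum>F\<in>monics m. chi D0 (F + R))"
  proof (rule sum.cong[OF refl])
    fix R :: "'a poly" assume "R \<in> poly_lt d"
    then have R: "R \<in> poly_lt m" using d by (rule poly_lt_monoD)
    show "S = (\<Sum>F\<in>monics m. chi D0 (F + R))"
      unfolding S_def by (rule sum_monics_shift[OF R, symmetric])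
  qed
  also have "\<dots> = of_nat CARD('a) ^ m * (\<Sum>v\<in>poly_lt d. chi D0 v)"
    by (subst sum.swap) (simp add: sum_chi_residues[OF D0] card_monics)
  finally show ?thesis by (simp add: S_def field_simps)
qed

text \<open>Reciprocity turns the sum over \<open>u mod F\<close> into sums to the moduli dividing out the leading
  coefficient of \<open>u\<close>, which gives a recursion for the sums of the complete character sums.\<close>

lemma zterm_rec:
  assumes "m > 0"
  shows "zterm m = (if 3 dvd m then of_nat (CARD('a) - 1) else 0) * (\<Sum>d<m. zterm d)"
proof -
  have chi0: "chi F 0 = 0" if "F \<in> monics m" for F
  proof (rule chi_eq_0)
    show "lead_coeff F = 1" using monicsD[OF that] by blast
    have "\<not> is_unit F"
      using is_unit_iff_degree[OF monics_nz[OF that]] monicsD[OF that] assms by simp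
    then show "\<not> coprime F 0" by simp
  qed
  have "zsum m = (\<Sum>F\<in>monics m. \<Sum>u\<in>poly_lt m - {0}. chi F u)"
    unfolding zsum_def
  proof (rule sum.cong[OF refl])
    fix F :: "'a poly" assume F: "F \<in> monics m"
    have "(\<Sum>v\<in>poly_lt m. chi F v) = chi F 0 + (\<Sum>u\<in>poly_lt m - {0}. chi F u)" by (rule sum.remove) auto
    then show "(\<Sum>v\<in>poly_lt m. chi F v) = (\<Sum>u\<in>poly_lt m - {0}. chi F u)" by (simp add: chi0[OF F])
  qed
  also have "\<dots> = (\<Sum>u\<in>poly_lt m - {0}. \<Sum>F\<in>monics m. chi F u)" by (rule sum.swap)
  also have "\<dots> = (\<Sum>d<m. \<Sum>D0\<in>monics d. \<Sum>c\<in>UNIV - {0}. \<Sum>F\<in>monics m. chi F (smult c D0))"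
    by (rule sum_poly_lt_nonzero)
  also have "\<dots> = (\<Sum>d<m. \<Sum>D0\<in>monics d. \<Sum>c\<in>UNIV - {0}. omega c ^ m *
      (of_nat CARD('a) ^ m * ((\<Sum>v\<in>poly_lt d. chi D0 v) / of_nat CARD('a) ^ d)))"
  proof (intro sum.cong refl)
    fix d and D0 :: "'a poly" and c :: 'a
    assume d: "d \<in> {..<m}" and D0: "D0 \<in> monics d"
    have "(\<Sum>F\<in>monics m. chi F (smult c D0)) = (\<Sum>F\<in>monics m. omega c ^ m * chi D0 F)"
    proof (rule sum.cong[OF refl])
      fix F :: "'a poly" assume F: "F \<in> monics m"
      have F1: "lead_coeff F = 1" and Fd: "degree F = m" using monicsD[OF F] by blast+
      have "lead_coeff D0 = 1" using monicsD[OF D0] by blast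
      then show "chi F (smult c D0) = omega c ^ m * chi D0 F"
        by (simp only: chi_smult[OF F1] Fd reciprocity[OF F1])
    qed
    then show "(\<Sum>F\<in>monics m. chi F (smult c D0)) = omega c ^ m *
      (of_nat CARD('a) ^ m * ((\<Sum>v\<in>poly_lt d. chi D0 v) / of_nat CARD('a) ^ d))"
      using d sum_chi_monic[OF D0, of m] by (simp add: sum_distrib_left[symmetric])
  qed
  also have "\<dots> = (\<Sum>c\<in>UNIV - {0}. omega c ^ m) * of_nat CARD('a) ^ m * (\<Sum>d<m. zterm d)"
    unfolding zterm_def zsum_def sum_divide_distrib
    by (simp only: sum_distrib_left[symmetric] sum_distrib_right[symmetric] mult.assoc[symmetric])
  finally show ?thesis by (simp add: zterm_def sum_omega)
qed

text \<open>By \<open>zterm_rec\<close> the partial sum is multiplied by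
  \<open>1 + (q - 1) = q\<close> when a positive degree divisible by 3 is passed, and stays the same
  otherwise.\<close>

lemma sum_zterm: "(\<Sum>d<Suc x. zterm d) = of_nat CARD('a) ^ (x div 3)"
proof (induction x)
  case 0
  then show ?case by (simp add: zterm_def zsum_0)
next
  case (Suc x)
  have "(\<Sum>d<Suc (Suc x). zterm d) = of_nat CARD('a) ^ (x div 3) *
      (1 + (if 3 dvd Suc x then of_nat (CARD('a) - 1) else 0))"
    unfolding sum.lessThan_Suc[of _ "Suc x"] zterm_rec[OF zero_less_Suc] Suc
    by (simp only: distrib_left mult_1_right mult_1_left mult.commute)
  also have "\<dots> = of_nat CARD('a) ^ (Suc x div 3)"
  proof (cases "3 dvd Suc x")
    case True
    then have "Suc x div 3 = Suc (x div 3)" by (simp add: div_Suc dvd_eq_mod_eq_0)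
    moreover have "1 + of_nat (CARD('a) - 1) = (of_nat CARD('a) :: complex)"
      using q_gt_1 by (simp add: of_nat_diff)
    ultimately show ?thesis using True by simp
  next
    case False
    then have "Suc x div 3 = x div 3" by (simp add: div_Suc dvd_eq_mod_eq_0)
    then show ?thesis using False by simp
  qed
  finally show ?case .
qed

lemma zterm_Suc: "zterm (Suc x) = (if 3 dvd Suc x then of_nat (CARD('a) - 1) else 0) * of_nat CARD('a) ^ (x div 3)"
  using zterm_rec[of "Suc x"] sum_zterm[of x] by simp

text \<open>Gauss sums over the constants. They come from the single degree of \<open>D\<close> for
  which the fraction in \<open>top_char\<close> has degree \<open>- 1\<close>; the trivial bound is
  enough.\<close>

definition tau :: "nat \<Rightarrow> complex" where
  "tau j = (\<Sum>c\<in>UNIV - {0}. omega c ^ j * psi0 c)"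

lemma norm_tau_le: "norm (tau j) \<le> real CARD('a)"
proof -
  have "norm (tau j) \<le> (\<Sum>c\<in>UNIV - {0 :: 'a}. 1)"
    unfolding tau_def by (rule sum_norm_le) (simp add: norm_mult norm_power norm_omega)
  also have "\<dots> \<le> real CARD('a)" by (simp add: card_Diff_singleton)
  finally show ?thesis .
qed

lemma tau_add_3: "tau (j + 3) = tau j"
  unfolding tau_def by (rule sum.cong) (auto simp: power_add omega(1))

text \<open>Degrees \<open>d\<close> below \<open>m + k - n - 1\<close> see no character and give
  \<open>sum_omega\<close>, the degree equal to it gives \<open>tau\<close>, larger ones vanish.
  With \<open>k \<le> r\<close> and \<open>2 * r \<le> n\<close> this critical degree stays below
  \<open>m - r\<close>, so the truncation of the sum in \<open>weight\<close> loses nothing.\<close>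

lemma weight_eq:
  assumes "2 * r \<le> n" "k \<le> r" "r < m"
  shows "weight r n m k = (if n + 1 \<le> m + k then of_nat CARD('a) ^ (m - k) *
    ((if 3 dvd m - k then of_nat (CARD('a) - 1) else 0) * (\<Sum>d<m + k - n - 1. zterm d)
      + tau (m - k) * zterm (m + k - n - 1)) else 0)"
proof -
  define j where "j = m - k"
  define K :: complex where "K = (if 3 dvd j then of_nat (CARD('a) - 1) else 0)"
  have csum: "(\<Sum>c\<in>UNIV - {0}. omega c ^ j * top_char n m k d c)
     = (if n + d + 1 < m + k then K else if n + d + 1 = m + k then tau j else 0)" for d
    using sum_omega[of j] by (simp add: top_char_def tau_def K_def)
  have w: "weight r n m k = of_nat CARD('a) ^ j *
      (\<Sum>d<m - r. zterm d * (if n + d + 1 < m + k then K else if n + d + 1 = m + k then tau j else 0))"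
    unfolding weight_def zterm_def j_def[symmetric] csum ..
  show ?thesis
  proof (cases "n + 1 \<le> m + k")
    case True
    define x where "x = m + k - n - 1"
    have x: "m + k = n + x + 1" "Suc x \<le> m - r" using True assms by (auto simp: x_def)
    have "(\<Sum>d<m - r. zterm d * (if n + d + 1 < m + k then K else if n + d + 1 = m + k then tau j else 0))
       = (\<Sum>d<Suc x. zterm d * (if n + d + 1 < m + k then K else if n + d + 1 = m + k then tau j else 0))"
      using x by (intro sum.mono_neutral_right) auto
    also have "\<dots> = (\<Sum>d<x. zterm d * K) + zterm x * tau j" using x by simp
    also have "\<dots> = K * (\<Sum>d<x. zterm d) + tau j * zterm x" by (simp add: sum_distrib_left mult.commute)
    finally show ?thesis using True by (simp add: w K_def j_def x_def)
  next
    case False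
    then show ?thesis by (simp add: w)
  qed
qed

text \<open>Passing from \<open>m - 3\<close> to \<open>m\<close> multiplies the power of
  \<open>q\<close> in front by \<open>q ^ 3\<close> and every \<open>zterm\<close> expression by
  \<open>q\<close>; residues modulo 3 do not change. The last hypothesis keeps the critical degree
  at \<open>m - 3\<close> positive, since \<open>zterm 0\<close> does not follow the pattern of
  \<open>zterm_Suc\<close>.\<close>

lemma weight_rec:
  assumes "2 * r \<le> n" "k \<le> r" "r + 3 < m" "n + 5 \<le> m + k"
  shows "weight r n m k = of_nat CARD('a) ^ 4 * weight r n (m - 3) k"
proof -
  define x where "x = m + k - n - 5"
  define j where "j = m - 3 - k"
  have e: "m + k - n - 1 = Suc (x + 3)" "(m - 3) + k - n - 1 = Suc x" "m - k = j + 3" "m - 3 - k = j"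
    "n + 1 \<le> m + k" "n + 1 \<le> m - 3 + k" using assms by (auto simp: x_def j_def)
  have 1: "weight r n m k = of_nat CARD('a) ^ (j + 3) * ((if 3 dvd j + 3 then of_nat (CARD('a) - 1) else 0) *
     of_nat CARD('a) ^ ((x + 3) div 3) + tau (j + 3) *
     ((if 3 dvd Suc (x + 3) then of_nat (CARD('a) - 1) else 0) * of_nat CARD('a) ^ ((x + 3) div 3)))"
    using weight_eq[of r n k m] assms e(5) unfolding e(1,3) sum_zterm zterm_Suc by simp
  have 2: "weight r n (m - 3) k = of_nat CARD('a) ^ j * ((if 3 dvd j then of_nat (CARD('a) - 1) else 0) *
     of_nat CARD('a) ^ (x div 3) + tau j *
     ((if 3 dvd Suc x then of_nat (CARD('a) - 1) else 0) * of_nat CARD('a) ^ (x div 3)))"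
    using weight_eq[of r n k "m - 3"] assms e(6) unfolding e(2,4) sum_zterm zterm_Suc by simp
  have d1: "3 dvd j + 3 \<longleftrightarrow> 3 dvd j" by (simp add: dvd_add_left_iff)
  have "3 dvd Suc x + 3 \<longleftrightarrow> 3 dvd Suc x" by (rule dvd_add_left_iff) simp
  then have d2: "3 dvd Suc (x + 3) \<longleftrightarrow> 3 dvd Suc x" by simp
  have d3: "(x + 3) div 3 = Suc (x div 3)" by simp
  have alg: "Z ^ (j + 3) * (K * Z ^ Suc y + T * (L * Z ^ Suc y)) = Z ^ 4 * (Z ^ j * (K * Z ^ y + T * (L * Z ^ y)))"
    for Z K T L :: complex and y
  proof -
    have "Z ^ (j + 3) = Z ^ j * Z ^ 3" "Z ^ Suc y = Z * Z ^ y" "Z ^ 4 = Z ^ 3 * Z"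
      by (simp_all add: power_add power3_eq_cube power4_eq_xxxx)
    then show ?thesis by (simp only: ring_distribs mult_ac)
  qed
  show ?thesis unfolding 1 2 d1 d2 d3 tau_add_3 by (rule alg)
qed

text \<open>In the range left over by \<open>weight_rec\<close> only \<open>zterm d\<close> with
  \<open>d \<le> 3\<close> occur, so the exponents \<open>div 3\<close> are still 0 and essentially
  the power of \<open>q\<close> in front remains.\<close>

lemma norm_weight_le:
  assumes "2 * r \<le> n" "k \<le> r" "r < m" "m + k \<le> n + 4"
  shows "norm (weight r n m k) \<le> 2 * real CARD('a) ^ (m - k + 2)"
proof (cases "n + 1 \<le> m + k")
  case True
  define x where "x = m + k - n - 1"
  have x: "x \<le> 3" using assms by (simp add: x_def)
  let ?q = "real CARD('a)"
  have q1: "1 \<le> ?q" using q_gt_1 by simp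
  have K: "norm (if 3 dvd m - k then of_nat (CARD('a) - 1) else 0 :: complex) \<le> ?q"
    by (cases "3 dvd m - k") (simp_all only: if_True if_False norm_of_nat norm_zero of_nat_le_iff diff_le_self of_nat_0_le_iff)
  have S: "norm (\<Sum>d<x. zterm d) \<le> 1"
  proof (cases x)
    case (Suc y)
    then have "y div 3 = 0" using x by simp
    then show ?thesis using Suc sum_zterm[of y] by simp
  qed simp
  have Z: "norm (zterm x) \<le> ?q"
  proof (cases x)
    case 0
    then show ?thesis using q1 by (simp add: zterm_def zsum_0)
  next
    case (Suc y)
    then have "y div 3 = 0" using x by simp
    then show ?thesis unfolding Suc zterm_Suc
      by (cases "3 dvd Suc y")
        (simp_all only: if_True if_False norm_of_nat norm_zero of_nat_le_iff diff_le_self of_nat_0_le_iff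
          power_0 mult_1_right)
  qed
  define Y where "Y = (if 3 dvd m - k then of_nat (CARD('a) - 1) else 0) * (\<Sum>d<x. zterm d) + tau (m - k) * zterm x"
  have "norm Y \<le> ?q * 1 + ?q * ?q"
    unfolding Y_def
    by (rule norm_triangle_le, intro add_mono; unfold norm_mult; intro mult_mono K S Z norm_tau_le) auto
  also have "\<dots> \<le> 2 * ?q ^ 2" using q1 by (simp add: power2_eq_square)
  finally have "?q ^ (m - k) * norm Y \<le> ?q ^ (m - k) * (2 * ?q ^ 2)" using q1 by (intro mult_left_mono) auto
  moreover have "weight r n m k = of_nat CARD('a) ^ (m - k) * Y"
    unfolding weight_eq[OF assms(1-3)] Y_def x_def using True by (simp only: if_True)
  ultimately show ?thesis by (simp add: norm_mult norm_power power_add mult_ac power2_eq_square)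
next
  case False
  then show ?thesis using weight_eq[OF assms(1-3)] by simp
qed

section \<open>The mean square of Gauss sums\<close>

lemma gauss_sum_twist:
  assumes F: "F \<in> monics m" and w: "coprime F w"
  shows "norm (gauss_sum \<Omega> (f * w) F) = norm (gauss_sum \<Omega> f F)"
proof -
  have F1: "lead_coeff F = 1" and Fd: "degree F = m" using monicsD[OF F] by blast+
  have F0: "F \<noteq> 0" by (rule monics_nz[OF F])
  obtain s t where st: "s * F + t * w = 1" using w by (rule poly_coprime_bezout)
  have lt: "a mod F \<in> poly_lt m" for a using poly_lt_mod[OF F0] Fd by simp
  have id: "a mod F = a" if "a \<in> poly_lt m" for a using mod_poly_lt[of a F] that Fd by simp
  have tw: "(u * (w * t)) mod F = u" if "u \<in> poly_lt m" for u
  proof -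
    have "w * t = 1 - s * F" using st by (simp add: algebra_simps)
    then have "u * (w * t) = u * (1 - s * F)" by (simp only:)
    also have "\<dots> = u + F * (- (u * s))" by (simp add: algebra_simps)
    finally have "u * (w * t) = u + F * (- (u * s))" .
    then have "(u * (w * t)) mod F = u mod F" by (simp only: mod_mult_self2)
    then show ?thesis using id[OF that] by simp
  qed
  have "gauss_sum \<Omega> f F = (\<Sum>u\<in>poly_lt m. chi F (u * w) * add_char (inf_frac (u * w * f) F))"
    unfolding gauss_sum_eq[OF F]
  proof (rule sum.reindex_bij_witness[of _ "\<lambda>u. (u * w) mod F" "\<lambda>u. (u * t) mod F"])
    fix u :: "'a poly" assume u: "u \<in> poly_lt m"
    show "(u * t) mod F * w mod F = u" 
      unfolding mod_mult_left_eq using tw[OF u] by (simp only: mult.assoc mult.commute[of t w])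
    show "(u * t) mod F \<in> poly_lt m" by (rule lt)
    have d: "F dvd u * t mod F * w - u"
      using \<open>(u * t) mod F * w mod F = u\<close> by (metis dvd_minus_mod)
    have "F dvd u * t mod F * w * f - u * f"
      using d by (metis dvd_mult2 left_diff_distrib)
    then show "chi F (u * t mod F * w) * add_char (inf_frac (u * t mod F * w * f) F) = chi F u * add_char (inf_frac (u * f) F)"
      using chi_cong[OF F1 d] add_char_frac_cong[OF F0] by simp
  next
    fix u :: "'a poly" assume u: "u \<in> poly_lt m"
    show "(u * w) mod F * t mod F = u" 
      unfolding mod_mult_left_eq using tw[OF u] by (simp only: mult.assoc mult.commute[of t w])
    show "(u * w) mod F \<in> poly_lt m" by (rule lt)
  qed
  also have "\<dots> = chi F w * gauss_sum \<Omega> (f * w) F"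
    unfolding gauss_sum_eq[OF F] sum_distrib_left by (intro sum.cong refl) (simp add: chi_mult mult_ac)
  finally show ?thesis using norm_chi[OF F1 w] by (simp add: norm_mult)
qed

text \<open>The mean square of \<open>G(f w, F)\<close> over all \<open>w mod F\<close> is easily computed, and all \<open>w\<close> coprime to
  \<open>F\<close> contribute equally to it.\<close>

lemma norm_gauss_sum_sq_le:
  assumes g: "g \<in> monics e" and F: "F \<in> monics m" and F_eq: "F = g * F1" and f_eq: "f = g * f1"
    and cop: "coprime F1 f1"
  shows "norm (gauss_sum \<Omega> f F) ^ 2 \<le> real CARD('a) ^ (m + e)"
proof -
  let ?I = "\<lambda>u v. if F dvd (u - v) * f then of_nat (CARD('a) ^ m) else (0::complex)"
  define U where "U = {u \<in> poly_lt m. coprime F u}"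
  have fin: "finite U" by (simp add: U_def)
  have F0: "F \<noteq> 0" and Fd: "degree F = m" and Fl: "lead_coeff F = 1"
    using monics_nz[OF F] monicsD[OF F] by blast+
  have g0: "g \<noteq> 0" by (rule monics_nz[OF g])
  have F10: "F1 \<noteq> 0" using F0 F_eq by auto
  have Une: "U \<noteq> {}"
  proof -
    \<comment> \<open>The class of 1 is represented by \<open>1 mod F\<close>, which is 0 when
      \<open>F = 1\<close>.\<close>
    have "coprime F (1 mod F)"
    proof (rule coprimeI)
      fix c assume "c dvd F" "c dvd 1 mod F"
      then show "is_unit c" by (simp add: dvd_mod_iff)
    qed
    then have "1 mod F \<in> U" using poly_lt_mod[OF F0, of 1] Fd by (simp add: U_def)
    then show ?thesis by blast
  qed
  define G where "G = (\<lambda>w. gauss_sum \<Omega> (f * w) F)"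
  have Gw: "G w = (\<Sum>u\<in>U. chi F u * add_char (inf_frac (w * (u * f)) F))" for w
    unfolding G_def U_def gauss_sum_coprime[OF F] by (simp add: mult_ac)
  have "of_real (\<Sum>w\<in>poly_lt m. norm (G w) ^ 2)
      = (\<Sum>w\<in>poly_lt m. \<Sum>u\<in>U. \<Sum>v\<in>U. chi F u * cnj (chi F v) * add_char (inf_frac (w * ((u - v) * f)) F))"
  proof -
    have "complex_of_real (norm (G w) ^ 2)
        = (\<Sum>u\<in>U. \<Sum>v\<in>U. chi F u * cnj (chi F v) * add_char (inf_frac (w * ((u - v) * f)) F))" for w
    proof -
      have ac: "add_char (inf_frac (w * ((u - v) * f)) F)
          = add_char (inf_frac (w * (u * f)) F) * cnj (add_char (inf_frac (w * (v * f)) F))" for u v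
      proof -
        have "w * ((u - v) * f) = w * (u * f) + - (w * (v * f))" by (simp add: algebra_simps)
        then have "inf_frac (w * ((u - v) * f)) F = inf_frac (w * (u * f)) F + - inf_frac (w * (v * f)) F"
          by (simp only: fls_inf_add fls_inf_uminus add_divide_distrib minus_divide_left)
        then show ?thesis by (simp only: add_char_add add_char_uminus)
      qed
      have "complex_of_real (norm (G w) ^ 2) = G w * cnj (G w)"
        by (rule complex_norm_square)
      also have "\<dots> = (\<Sum>u\<in>U. \<Sum>v\<in>U. (chi F u * add_char (inf_frac (w * (u * f)) F)) *
          cnj (chi F v * add_char (inf_frac (w * (v * f)) F)))"
        unfolding Gw cnj_sum by (rule sum_product)
      finally show ?thesis unfolding ac by (simp only: complex_cnj_mult mult_ac)
    qed
    then show ?thesis by (simp only: of_real_sum)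
  qed
  also have "\<dots> = (\<Sum>u\<in>U. \<Sum>v\<in>U. chi F u * cnj (chi F v) * ?I u v)"
  proof -
    have "(\<Sum>w\<in>poly_lt m. \<Sum>u\<in>U. \<Sum>v\<in>U. chi F u * cnj (chi F v) * add_char (inf_frac (w * ((u - v) * f)) F))
      = (\<Sum>u\<in>U. \<Sum>v\<in>U. \<Sum>w\<in>poly_lt m. chi F u * cnj (chi F v) * add_char (inf_frac (w * ((u - v) * f)) F))"
      by (subst sum.swap, rule sum.cong[OF refl], rule sum.swap)
    then show ?thesis using sum_add_char_frac[OF F0, unfolded Fd] by (simp only: sum_distrib_left[symmetric])
  qed
  finally have eq: "complex_of_real (\<Sum>w\<in>poly_lt m. norm (G w) ^ 2) = (\<Sum>u\<in>U. \<Sum>v\<in>U. chi F u * cnj (chi F v) * ?I u v)" .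
  have inner: "norm (\<Sum>v\<in>U. chi F u * cnj (chi F v) * ?I u v)
      \<le> real CARD('a) ^ (m + e)" if u: "u \<in> U" for u
  proof -
    define V where "V = {v \<in> U. F dvd (u - v) * f}"
    \<comment> \<open>Cancelling \<open>g\<close> turns \<open>F dvd (u - v) * f\<close> into
      \<open>F1 dvd u - v\<close>, which leaves one free polynomial in \<open>poly_lt e\<close>;
      this is the loss \<open>q ^ e\<close> against the coprime case.\<close>
    have "V \<subseteq> (\<lambda>s. u - F1 * s) ` poly_lt e"
    proof
      fix v assume v: "v \<in> V"
      then have "g * F1 dvd g * ((u - v) * f1)" by (simp add: V_def F_eq f_eq mult_ac)
      then have "F1 dvd f1 * (u - v)" using g0 by (simp add: mult.commute)
      then have "F1 dvd u - v" by (rule poly_coprime_dvd_mult[OF cop])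
      then obtain s where s: "u - v = F1 * s" by (elim dvdE)
      have "u - v \<in> poly_lt m" using u v by (auto simp: U_def V_def intro: poly_lt_diff)
      have "s \<in> poly_lt e"
      proof (cases "s = 0")
        case False
        have "F1 * s \<noteq> 0" using False F10 by simp
        then have "degree (F1 * s) < m" using \<open>u - v \<in> poly_lt m\<close> unfolding s poly_lt_iff_degree by blast
        moreover have "degree (F1 * s) = degree F1 + degree s" using False F10 by (simp add: degree_mult_eq)
        moreover have "m = e + degree F1"
          using Fd g0 F10 monics_degree[OF g] by (simp add: F_eq degree_mult_eq)
        ultimately show ?thesis by (simp add: poly_lt_iff_degree)
      qed simp
      then show "v \<in> (\<lambda>s. u - F1 * s) ` poly_lt e"
        using s by (intro image_eqI[of _ _ s]) (auto simp: algebra_simps)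
    qed
    then have "card V \<le> card ((\<lambda>s. u - F1 * s) ` poly_lt e)" by (intro card_mono) auto
    also have "\<dots> \<le> CARD('a) ^ e" using card_image_le[OF finite_poly_lt[of e]] by (metis card_poly_lt)
    finally have cV: "card V \<le> CARD('a) ^ e" .
    have "norm (\<Sum>v\<in>U. chi F u * cnj (chi F v) * ?I u v)
        \<le> (\<Sum>v\<in>U. if F dvd (u - v) * f then real CARD('a) ^ m else 0)"
    proof (rule sum_norm_le)
      fix v assume "v \<in> U"
      have "norm (chi F u) * norm (chi F v) \<le> 1 * 1" by (intro mult_mono norm_chi_le[OF Fl]) auto
      then show "norm (chi F u * cnj (chi F v) * ?I u v)
        \<le> (if F dvd (u - v) * f then real CARD('a) ^ m else 0)"
        by (auto simp: norm_mult norm_power intro: mult_left_le_one_le)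
    qed
    also have "\<dots> = (\<Sum>v\<in>V. real CARD('a) ^ m)"
      unfolding V_def by (rule sum.inter_filter[OF fin, symmetric])
    also have "\<dots> \<le> real (CARD('a) ^ e) * real CARD('a) ^ m"
      using cV by (simp del: of_nat_power)
    finally show ?thesis by (simp add: power_add mult.commute)
  qed
  have "real (card U) * norm (gauss_sum \<Omega> f F) ^ 2 = (\<Sum>w\<in>U. norm (G w) ^ 2)"
    using gauss_sum_twist[OF F] by (simp add: G_def U_def)
  also have "\<dots> \<le> (\<Sum>w\<in>poly_lt m. norm (G w) ^ 2)"
    by (rule sum_mono2) (auto simp: U_def)
  also have "\<dots> = norm (complex_of_real (\<Sum>w\<in>poly_lt m. norm (G w) ^ 2))"
    unfolding norm_of_real by (rule abs_of_nonneg[symmetric]) (simp add: sum_nonneg)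
  also have "\<dots> \<le> (\<Sum>u\<in>U. real CARD('a) ^ (m + e))"
    unfolding eq by (rule sum_norm_le) (rule inner)
  finally have "real (card U) * norm (gauss_sum \<Omega> f F) ^ 2 \<le> real (card U) * real CARD('a) ^ (m + e)" by simp
  moreover have "card U > 0" using fin Une by (simp add: card_gt_0_iff)
  ultimately show ?thesis by simp
qed

end

section \<open>The divisor bound\<close>

definition monic_divisors :: "'a::field poly \<Rightarrow> 'a poly set" where
  "monic_divisors f = {g. lead_coeff g = 1 \<and> g dvd f}"

lemma finite_monic_divisors [simp]:
  fixes f :: "'a::finite_field poly"
  assumes "f \<noteq> 0"
  shows "finite (monic_divisors f)"
proof (rule finite_subset[OF _ finite_poly_lt[of "Suc (degree f)"]])
  show "monic_divisors f \<subseteq> poly_lt (Suc (degree f))"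
    using assms dvd_imp_degree_le[of _ f] by (auto simp: monic_divisors_def poly_lt_iff_degree less_Suc_eq_le)
qed

lemma poly_dvd_prime_power_mult:
  fixes P h g :: "'a::field poly"
  assumes P: "irreducible P"
  shows "h dvd P ^ a * g \<Longrightarrow> \<exists>i\<le>a. \<exists>h'. h = P ^ i * h' \<and> h' dvd g"
proof (induction a arbitrary: h)
  case 0
  then show ?case by auto
next
  case (Suc a)
  show ?case
  proof (cases "P dvd h")
    case True
    then obtain h1 where h1: "h = P * h1" by (elim dvdE)
    have "P \<noteq> 0" using P by auto
    then have "h1 dvd P ^ a * g" using Suc.prems h1 by (simp add: mult.assoc)
    then obtain i h' where i: "i \<le> a" "h1 = P ^ i * h'" "h' dvd g" using Suc.IH by blast
    then have "h = P ^ Suc i * h'" by (simp add: h1 mult.assoc)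
    then show ?thesis using i by (intro exI[of _ "Suc i"]) auto
  next
    case False
    then have "coprime P h" using poly_irreducible_coprime[OF P] by blast
    then have "coprime h P" by (simp add: coprime_commute)
    moreover have "h dvd P * (P ^ a * g)" using Suc.prems by (simp add: mult.assoc)
    ultimately have "h dvd P ^ a * g" by (rule poly_coprime_dvd_mult)
    then show ?thesis using Suc.IH[of h] le_SucI by blast
  qed
qed

lemma card_monic_divisors_prime_power:
  fixes P g :: "'a::finite_field poly"
  assumes P: "irreducible P" "lead_coeff P = 1" and "g \<noteq> 0"
  shows "card (monic_divisors (P ^ a * g)) \<le> (a + 1) * card (monic_divisors g)"
proof -
  have "monic_divisors (P ^ a * g) \<subseteq> (\<lambda>(i, h). P ^ i * h) ` ({..a} \<times> monic_divisors g)"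
  proof
    fix h assume "h \<in> monic_divisors (P ^ a * g)"
    then have h: "lead_coeff h = 1" "h dvd P ^ a * g" by (auto simp: monic_divisors_def)
    obtain i h' where i: "i \<le> a" "h = P ^ i * h'" "h' dvd g"
      using poly_dvd_prime_power_mult[OF P(1) h(2)] by blast
    have "lead_coeff (P ^ i) * lead_coeff h' = 1" using h(1) unfolding i(2) lead_coeff_mult .
    then have "lead_coeff h' = 1" unfolding lead_coeff_power P(2) by simp
    then show "h \<in> (\<lambda>(i, h). P ^ i * h) ` ({..a} \<times> monic_divisors g)"
      using i by (intro image_eqI[of _ _ "(i, h')"]) (auto simp: monic_divisors_def)
  qed
  then have "card (monic_divisors (P ^ a * g)) \<le> card ((\<lambda>(i, h). P ^ i * h) ` ({..a} \<times> monic_divisors g))"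
    using assms(3) by (intro card_mono) auto
  also have "\<dots> \<le> card ({..a} \<times> monic_divisors g)" using assms(3) by (intro card_image_le) auto
  finally show ?thesis by (simp add: card_cartesian_product)
qed

text \<open>A prime power \<open>P ^ a\<close> contributes the factor \<open>a + 1\<close>. It is at most \<open>|P ^ a| powr \<epsilon>\<close> for
  primes of large degree, and at most a constant times that for the finitely many others.\<close>

lemma card_monic_divisors_bound:
  fixes \<epsilon> :: real
  assumes eps: "\<epsilon> > 0"
  shows "\<exists>C. \<forall>f :: 'a::finite_field poly. lead_coeff f = 1 \<longrightarrow>
    real (card (monic_divisors f)) \<le> C * real CARD('a) powr (\<epsilon> * real (degree f))"
proof -
  define q where "q = real CARD('a)"
  have q1: "q > 1" using CARD_finite_field_gt_1[where 'a = 'a] by (simp add: q_def)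
  have lq: "ln q > 0" using q1 by simp
  define K where "K = max 1 (1 / (\<epsilon> * ln q))"
  have K1: "K \<ge> 1" by (simp add: K_def)
  have Keq: "K * (\<epsilon> * ln q) \<ge> 1"
  proof -
    have "1 / (\<epsilon> * ln q) * (\<epsilon> * ln q) \<le> K * (\<epsilon> * ln q)"
      using eps lq by (intro mult_right_mono) (auto simp: K_def)
    then show ?thesis using eps lq by simp
  qed
  define L where "L = nat \<lceil>1 / (\<epsilon> * ln q)\<rceil>"
  have L: "\<epsilon> * real L * ln q \<ge> 1"
  proof -
    have "1 / (\<epsilon> * ln q) \<le> real L" unfolding L_def by (rule real_nat_ceiling_ge)
    then have "1 / (\<epsilon> * ln q) * (\<epsilon> * ln q) \<le> real L * (\<epsilon> * ln q)"
      using eps lq by (intro mult_right_mono) auto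
    then show ?thesis using eps lq by (simp add: mult_ac)
  qed
  have pw: "q powr t \<ge> 1 + t * ln q" for t
    using q1 exp_ge_add_one_self[of "t * ln q"] by (simp add: powr_def)
  have large: "real a + 1 \<le> q powr (\<epsilon> * real (a * e))" if "e \<ge> L" for a e
  proof -
    have "real a * 1 \<le> real a * (\<epsilon> * real L * ln q)" using L by (intro mult_left_mono) auto
    also have "\<dots> \<le> real a * (\<epsilon> * real e * ln q)"
      using that eps lq by (intro mult_left_mono mult_right_mono) auto
    finally show ?thesis using pw[of "\<epsilon> * real (a * e)"] by (simp add: mult_ac)
  qed
  have small: "real a + 1 \<le> K * q powr (\<epsilon> * real (a * e))" if "e > 0" for a e
  proof -
    have "real a * 1 \<le> real a * (K * (\<epsilon> * ln q))" using Keq by (intro mult_left_mono) auto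
    also have "\<dots> \<le> K * (\<epsilon> * real (a * e) * ln q)"
    proof -
      have "K * (\<epsilon> * ln q) * real a * 1 \<le> K * (\<epsilon> * ln q) * real a * real e"
        using that K1 eps lq by (intro mult_left_mono) auto
      then show ?thesis by (simp add: mult_ac)
    qed
    finally have "real a + 1 \<le> K * (1 + \<epsilon> * real (a * e) * ln q)" using K1 by (simp add: distrib_left)
    also have "\<dots> \<le> K * q powr (\<epsilon> * real (a * e))" using K1 pw by (intro mult_left_mono) auto
    finally show ?thesis .
  qed
  \<comment> \<open>Each prime of degree below \<open>L\<close> costs one factor \<open>K\<close>;
    their number is bounded independently of \<open>f\<close>, hence so is
    \<open>K ^ card (T f)\<close>.\<close>
  define T where "T = (\<lambda>f :: 'a poly. {P. irreducible P \<and> lead_coeff P = 1 \<and> P dvd f \<and> degree P < L})"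
  have finT: "finite (T f)" for f
    by (rule finite_subset[OF _ finite_poly_lt[of L]]) (auto simp: T_def poly_lt_iff_degree)
  have main: "real (card (monic_divisors f)) \<le> K ^ card (T f) * q powr (\<epsilon> * real (degree f))"
    if "lead_coeff f = 1" for f :: "'a poly"
    using that
  proof (induction "degree f" arbitrary: f rule: less_induct)
    case less
    show ?case
    proof (cases "degree f = 0")
      case True
      then have f: "f = 1" using monic_degree_0 less.prems by blast
      have "monic_divisors f \<subseteq> {1}"
      proof
        fix g assume "g \<in> monic_divisors f"
        then have "lead_coeff g = 1" "g dvd 1" by (auto simp: monic_divisors_def f)
        then show "g \<in> {1}" using poly_monic_dvd_antisym[of g 1] by simp
      qed
      then have "card (monic_divisors f) \<le> card {1 :: 'a poly}" by (intro card_mono) auto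
      moreover have "1 \<le> K ^ card (T f)" using K1 by (simp add: one_le_power)
      ultimately show ?thesis using True q1 by simp
    next
      case False
      then obtain P where P: "irreducible P" "lead_coeff P = 1" "P dvd f" using poly_monic_prime_divisor by blast
      have f0: "f \<noteq> 0" using False by auto
      define a where "a = poly_mult P f"
      obtain g where g: "f = P ^ a * g" "\<not> P dvd g" unfolding a_def using poly_mult_decomp[OF P(1) f0] by blast
      have a1: "a \<ge> 1" using poly_power_dvd_iff_mult[OF P(1) f0, of 1] P(3) by (simp add: a_def)
      have nz: "P \<noteq> 0" "g \<noteq> 0" using f0 g a1 by auto
      have dP: "degree P > 0" using poly_irreducible_degree_pos[OF P(1)] .
      have df: "degree f = a * degree P + degree g"
        unfolding g(1) using nz by (simp add: degree_mult_eq degree_power_eq)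
      then have lt: "degree g < degree f" using a1 dP by simp
      have "lead_coeff (P ^ a) * lead_coeff g = 1" using less.prems unfolding g(1) lead_coeff_mult .
      then have lg: "lead_coeff g = 1" unfolding lead_coeff_power P(2) by simp
      have IH: "real (card (monic_divisors g)) \<le> K ^ card (T g) * q powr (\<epsilon> * real (degree g))"
        using less.hyps[OF lt lg] .
      have sub: "T g \<subseteq> T f - {P}" unfolding T_def using g by auto
      have fac: "K ^ card (T g) * (real a + 1) \<le> K ^ card (T f) * q powr (\<epsilon> * real (a * degree P))"
      proof (cases "degree P < L")
        case True
        then have "P \<in> T f" using P by (simp add: T_def)
        then have "card (T f - {P}) = card (T f) - 1" "card (T f) \<ge> 1"
          using finT[of f] by (auto simp: card_Diff_singleton Suc_le_eq card_gt_0_iff)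
        then have c: "Suc (card (T g)) \<le> card (T f)" using card_mono[OF _ sub] finT[of f] by simp
        have "K ^ card (T g) * (real a + 1) \<le> K ^ card (T g) * (K * q powr (\<epsilon> * real (a * degree P)))"
          using small[OF dP] K1 by (intro mult_left_mono) auto
        also have "\<dots> = K ^ Suc (card (T g)) * q powr (\<epsilon> * real (a * degree P))" by simp
        also have "\<dots> \<le> K ^ card (T f) * q powr (\<epsilon> * real (a * degree P))"
          using power_increasing[OF c K1] by (intro mult_right_mono) auto
        finally show ?thesis .
      next
        case False
        have c: "card (T g) \<le> card (T f)" using sub finT[of f] by (intro card_mono) auto
        show ?thesis using large[of "degree P" a] False power_increasing[OF c K1] K1
          by (intro mult_mono) auto
      qed
      have "real (card (monic_divisors (P ^ a * g))) \<le> real ((a + 1) * card (monic_divisors g))"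
        using card_monic_divisors_prime_power[OF P(1,2) nz(2), of a] by (simp only: of_nat_le_iff)
      also have "\<dots> = (real a + 1) * real (card (monic_divisors g))"
        by (simp only: of_nat_mult of_nat_add of_nat_1)
      finally have "real (card (monic_divisors f)) \<le> (real a + 1) * real (card (monic_divisors g))"
        by (simp only: g(1)[symmetric])
      also have "\<dots> \<le> (real a + 1) * (K ^ card (T g) * q powr (\<epsilon> * real (degree g)))"
        using IH by (intro mult_left_mono) auto
      also have "\<dots> = (K ^ card (T g) * (real a + 1)) * q powr (\<epsilon> * real (degree g))" by simp
      also have "\<dots> \<le> (K ^ card (T f) * q powr (\<epsilon> * real (a * degree P))) * q powr (\<epsilon> * real (degree g))"
        using fac by (intro mult_right_mono) auto
      also have "\<dots> = K ^ card (T f) * q powr (\<epsilon> * real (degree f))"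
        by (simp add: df distrib_left powr_add)
      finally show ?thesis .
    qed
  qed
  have "real (card (monic_divisors f)) \<le> K ^ card (poly_lt L :: 'a poly set) * q powr (\<epsilon> * real (degree f))"
    if "lead_coeff f = 1" for f :: "'a poly"
  proof -
    have "card (T f) \<le> card (poly_lt L :: 'a poly set)"
      by (rule card_mono) (auto simp: T_def poly_lt_iff_degree)
    then have "K ^ card (T f) \<le> K ^ card (poly_lt L :: 'a poly set)" using K1 by (rule power_increasing)
    then show ?thesis using main[OF that] by (meson mult_right_mono order.trans powr_ge_zero)
  qed
  then show ?thesis unfolding q_def by blast
qed

section \<open>Bounds for the coefficients\<close>

context cubic_residue
begin

text \<open>Half-integral powers of \<open>q\<close> become natural powers of \<open>sqrt_q\<close>,
  so exponents can be compared in \<open>nat\<close>.\<close>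

definition sqrt_q :: real where "sqrt_q = sqrt (real CARD('a))"

lemma sqrt_q_sq: "sqrt_q ^ 2 = real CARD('a)"
  by (simp add: sqrt_q_def)

lemma sqrt_q_ge_1: "sqrt_q \<ge> 1"
  using q_gt_1 by (simp add: sqrt_q_def)

lemma q_power_eq: "real CARD('a) ^ k = sqrt_q ^ (2 * k)"
  by (simp only: power_mult sqrt_q_sq)

text \<open>\<open>g\<close> is the monic gcd of \<open>f\<close> and \<open>F\<close>. Its identity
  is given up, since the sum over \<open>F\<close> will be bounded by one over all monic divisors of
  \<open>f\<close>.\<close>

lemma norm_gauss_sum_le:
  assumes f: "lead_coeff f = 1" and F: "F \<in> monics m"
  shows "\<exists>g\<in>monic_divisors f. g dvd F \<and> norm (gauss_sum \<Omega> f F) \<le> sqrt_q ^ (m + degree g)"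
proof -
  have F0: "F \<noteq> 0" by (rule monics_nz[OF F])
  obtain g0 x y where g0: "g0 = x * F + y * f" "g0 dvd F" "g0 dvd f" using poly_gcd_bezout by blast
  have g0nz: "g0 \<noteq> 0" using F0 g0(2) by auto
  define l where "l = inverse (lead_coeff g0)"
  have l0: "l \<noteq> 0" using g0nz by (simp add: l_def)
  define g where "g = smult l g0"
  have g1: "lead_coeff g = 1" using g0nz by (simp add: g_def l_def)
  have gd: "g dvd F" "g dvd f" using g0 l0 by (simp_all add: g_def smult_dvd_iff)
  obtain F1 where F1: "F = g * F1" using gd(1) by (elim dvdE)
  obtain f1 where f1: "f = g * f1" using gd(2) by (elim dvdE)
  have gnz: "g \<noteq> 0" using g1 by auto
  have g_eq: "g = smult l x * F + smult l y * f" by (simp add: g_def g0(1) smult_add_right)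
  have "g * (smult l x * F1 + smult l y * f1) = smult l x * (g * F1) + smult l y * (g * f1)"
    by (simp only: distrib_left mult.left_commute[of g])
  also have "\<dots> = g * 1" unfolding F1[symmetric] f1[symmetric] g_eq[symmetric] by simp
  finally have "smult l x * F1 + smult l y * f1 = 1" using gnz by (metis mult_left_cancel)
  then have cop: "coprime F1 f1" by (rule poly_bezout_coprime)
  have gm: "g \<in> monics (degree g)" using g1 by (simp add: monicsI)
  have "norm (gauss_sum \<Omega> f F) ^ 2 \<le> (sqrt_q ^ (m + degree g)) ^ 2"
    using norm_gauss_sum_sq_le[OF gm F F1 f1 cop] by (simp add: q_power_eq power_mult[symmetric] mult.commute)
  then have "norm (gauss_sum \<Omega> f F) \<le> sqrt_q ^ (m + degree g)"
    by (rule power2_le_imp_le) (use sqrt_q_ge_1 in simp)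
  then show ?thesis using gd g1 by (auto simp: monic_divisors_def)
qed

text \<open>The \<open>q ^ (m - e)\<close> multiples of a divisor of degree \<open>e\<close>, each
  with bound \<open>q powr ((m + e) / 2)\<close>, sum to at most
  \<open>q powr ((3 * m - e) / 2)\<close>; the saving in \<open>e\<close> is dropped.\<close>

lemma sum_norm_gauss_sum_le:
  assumes f: "lead_coeff f = 1"
  shows "(\<Sum>F\<in>monics m. norm (gauss_sum \<Omega> f F)) \<le> real (card (monic_divisors f)) * sqrt_q ^ (3 * m)"
proof -
  have f0: "f \<noteq> 0" using f by auto
  have sq0: "sqrt_q \<ge> 0" using sqrt_q_ge_1 by simp
  have "(\<Sum>F\<in>monics m. norm (gauss_sum \<Omega> f F))
      \<le> (\<Sum>F\<in>monics m. \<Sum>g\<in>monic_divisors f. if g dvd F then sqrt_q ^ (m + degree g) else 0)"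
  proof (rule sum_mono)
    fix F :: "'a poly" assume F: "F \<in> monics m"
    obtain g where g: "g \<in> monic_divisors f" "g dvd F" "norm (gauss_sum \<Omega> f F) \<le> sqrt_q ^ (m + degree g)"
      using norm_gauss_sum_le[OF f F] by blast
    have "(if g dvd F then sqrt_q ^ (m + degree g) else 0)
        \<le> (\<Sum>g\<in>monic_divisors f. if g dvd F then sqrt_q ^ (m + degree g) else 0)"
      by (rule member_le_sum[OF g(1)]) (use f0 sq0 in auto)
    then show "norm (gauss_sum \<Omega> f F) \<le> (\<Sum>g\<in>monic_divisors f. if g dvd F then sqrt_q ^ (m + degree g) else 0)"
      using g by simp
  qed
  also have "\<dots> = (\<Sum>g\<in>monic_divisors f. \<Sum>F\<in>monics m. if g dvd F then sqrt_q ^ (m + degree g) else 0)"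
    by (rule sum.swap)
  also have "\<dots> \<le> (\<Sum>g\<in>monic_divisors f. sqrt_q ^ (3 * m))"
  proof (rule sum_mono)
    fix g assume "g \<in> monic_divisors f"
    then have gm: "g \<in> monics (degree g)" by (auto simp: monic_divisors_def monicsI)
    define e where "e = degree g"
    have gm: "g \<in> monics e" using gm by (simp add: e_def)
    have gd: "degree g = e" by (simp add: e_def)
    have "(\<Sum>F\<in>monics m. if g dvd F then sqrt_q ^ (m + degree g) else 0)
        = real (card {F \<in> monics m. g dvd F}) * sqrt_q ^ (m + e)"
      by (subst sum.inter_filter[symmetric]) (simp_all add: gd)
    also have "\<dots> \<le> sqrt_q ^ (3 * m)"
    proof (cases "e \<le> m")
      case True
      have "{F \<in> monics m. g dvd F} \<subseteq> (\<lambda>h. g * h) ` monics (m - e)"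
        using monics_cancel[OF gm] by (auto elim!: dvdE)
      then have "card {F \<in> monics m. g dvd F} \<le> card ((\<lambda>h. g * h) ` (monics (m - e) :: 'a poly set))"
        by (intro card_mono) auto
      also have "\<dots> \<le> CARD('a) ^ (m - e)"
        using card_image_le[OF finite_monics[of "m - e"]] by (metis card_monics)
      finally have "real (card {F \<in> monics m. g dvd F}) \<le> real CARD('a) ^ (m - e)"
        by (metis of_nat_le_iff of_nat_power)
      then have "real (card {F \<in> monics m. g dvd F}) * sqrt_q ^ (m + e) \<le> sqrt_q ^ (2 * (m - e)) * sqrt_q ^ (m + e)"
        unfolding q_power_eq using sq0 by (intro mult_right_mono) auto
      also have "\<dots> = sqrt_q ^ (2 * (m - e) + (m + e))" by (simp only: power_add)
      also have "\<dots> \<le> sqrt_q ^ (3 * m)" using True by (intro power_increasing sqrt_q_ge_1) auto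
      finally show ?thesis .
    next
      case False
      have "{F \<in> monics m. g dvd F} = {}"
        using False gd dvd_imp_degree_le[of g] monics_nz by (fastforce simp: monics_def)
      then show ?thesis by (simp only: card.empty of_nat_0 mult_zero_left zero_le_power[OF sq0])
    qed
    finally show "(\<Sum>F\<in>monics m. if g dvd F then sqrt_q ^ (m + degree g) else 0) \<le> sqrt_q ^ (3 * m)" .
  qed
  finally show ?thesis by simp
qed

lemma norm_gsum_le:
  assumes "lead_coeff f = 1"
  shows "norm (gsum m f) \<le> real (card (monic_divisors f)) * sqrt_q ^ (3 * m)"
  unfolding gsum_def using norm_sum sum_norm_gauss_sum_le[OF assms] by (rule order.trans)

text \<open>The coefficients of \<open>(1 - q ^ 4 * u ^ 3) * Psi f u\<close>.\<close>

definition num_coeff :: "'a poly \<Rightarrow> nat \<Rightarrow> complex" where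
  "num_coeff f m = gsum m f - (if 3 \<le> m then of_nat CARD('a) ^ 4 * gsum (m - 3) f else 0)"

lemma norm_num_coeff_le:
  assumes f: "lead_coeff f = 1"
  shows "norm (num_coeff f m) \<le> 2 * real (card (monic_divisors f)) * sqrt_q ^ (3 * m)"
proof -
  define d where "d = real (card (monic_divisors f))"
  have d0: "d \<ge> 0" by (simp add: d_def)
  have "norm (if 3 \<le> m then of_nat CARD('a) ^ 4 * gsum (m - 3) f else 0) \<le> d * sqrt_q ^ (3 * m)"
  proof (cases "3 \<le> m")
    case True
    have "norm (of_nat CARD('a) ^ 4 * gsum (m - 3) f) \<le> sqrt_q ^ (2 * 4) * (d * sqrt_q ^ (3 * (m - 3)))"
      unfolding norm_mult norm_power norm_of_nat q_power_eq d_def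
      using norm_gsum_le[OF f] sqrt_q_ge_1 by (intro mult_left_mono) auto
    also have "\<dots> = d * sqrt_q ^ (2 * 4 + 3 * (m - 3))" by (simp only: power_add mult_ac)
    also have "\<dots> \<le> d * sqrt_q ^ (3 * m)"
      using True d0 by (intro mult_left_mono power_increasing sqrt_q_ge_1) auto
    finally show ?thesis using True by simp
  qed (use d0 sqrt_q_ge_1 in simp)
  then show ?thesis
    using norm_gsum_le[OF f, of m] norm_triangle_ineq4[of "gsum m f" "if 3 \<le> m then of_nat CARD('a) ^ 4 * gsum (m - 3) f else 0"]
    by (simp add: num_coeff_def d_def)
qed

abbreviation wdiff :: "nat \<Rightarrow> nat \<Rightarrow> nat \<Rightarrow> nat \<Rightarrow> complex" where
  "wdiff r n m k \<equiv> weight r n m k - of_nat CARD('a) ^ 4 * weight r n (m - 3) k"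

text \<open>Both \<open>m\<close> and \<open>m - 3\<close> exceed \<open>n div 2\<close>, so
  \<open>gsum_formula\<close> applies to each. Terms with \<open>m + k \<ge> n + 5\<close> cancel by
  \<open>weight_rec\<close>, and those with \<open>m + k \<le> n\<close> have weight 0.\<close>

lemma num_coeff_formula:
  assumes f: "f \<in> monics n" and m: "n div 2 + 3 < m"
  shows "num_coeff f m = (\<Sum>k\<in>{k. k \<le> n div 2 \<and> n + 1 \<le> m + k \<and> m + k \<le> n + 4}.
     gsum k f * wdiff (n div 2) n m k)"
proof -
  define r where "r = n div 2"
  have r: "2 * r \<le> n" "n \<le> 2 * r + 1" by (auto simp: r_def)
  have "num_coeff f m = (\<Sum>k\<le>r. gsum k f * wdiff r n m k)"
    using gsum_formula[OF f _ r(2), of m] gsum_formula[OF f _ r(2), of "m - 3"] m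
    by (simp add: num_coeff_def r_def sum_distrib_left right_diff_distrib sum_subtractf mult_ac)
  also have "\<dots> = (\<Sum>k\<in>{k. k \<le> r \<and> n + 1 \<le> m + k \<and> m + k \<le> n + 4}.
     gsum k f * wdiff r n m k)"
  proof (rule sum.mono_neutral_right)
    show "\<forall>k\<in>{..r} - {k. k \<le> r \<and> n + 1 \<le> m + k \<and> m + k \<le> n + 4}.
        gsum k f * wdiff r n m k = 0"
    proof
      fix k assume k: "k \<in> {..r} - {k. k \<le> r \<and> n + 1 \<le> m + k \<and> m + k \<le> n + 4}"
      then have kr: "k \<le> r" by simp
      show "gsum k f * wdiff r n m k = 0"
      proof (cases "n + 5 \<le> m + k")
        case True
        then show ?thesis using weight_rec[OF r(1) kr _ True] m by (simp add: r_def)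
      next
        case False
        then have "\<not> n + 1 \<le> m + k" using k by auto
        then show ?thesis using weight_eq[OF r(1) kr, of m] weight_eq[OF r(1) kr, of "m - 3"] m
          by (simp add: r_def)
      qed
    qed
  qed auto
  finally show ?thesis by (simp only: r_def)
qed

lemma num_coeff_eq_0:
  assumes "f \<in> monics n" "n + 4 < m"
  shows "num_coeff f m = 0"
proof -
  have "{k. k \<le> n div 2 \<and> n + 1 \<le> m + k \<and> m + k \<le> n + 4} = {}" using assms(2) by auto
  moreover have "n div 2 + 3 < m" using assms(2) by simp
  ultimately show ?thesis using num_coeff_formula[OF assms(1), of m] by (simp only: sum.empty)
qed

text \<open>There are at most four \<open>k\<close>, and each contributes at most
  \<open>4 * sqrt_q ^ (3 * k + 2 * (m - k + 3))\<close> times the divisor count; with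
  \<open>m + k \<le> n + 4\<close> the exponent is at most \<open>m + n + 10\<close>, whence 16 and
  10. For \<open>m \<le> n div 2 + 3\<close> the direct bound suffices, as
  \<open>3 * m \<le> m + n + 6\<close>.\<close>

lemma norm_num_coeff_le':
  assumes f: "f \<in> monics n"
  shows "norm (num_coeff f m) \<le> 16 * sqrt_q ^ 10 * real (card (monic_divisors f)) * sqrt_q ^ (m + n)"
proof (cases "n div 2 + 3 < m")
  case False
  have f1: "lead_coeff f = 1" using monicsD[OF f] by blast
  define d where "d = real (card (monic_divisors f))"
  have "norm (num_coeff f m) \<le> 2 * d * sqrt_q ^ (3 * m)" unfolding d_def by (rule norm_num_coeff_le[OF f1])
  also have "\<dots> \<le> 16 * d * sqrt_q ^ (10 + (m + n))"
    using False sqrt_q_ge_1 by (intro mult_mono power_increasing) (auto simp: d_def)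
  finally show ?thesis by (simp add: power_add d_def mult_ac)
next
  case True
  have f1: "lead_coeff f = 1" using monicsD[OF f] by blast
  define d where "d = real (card (monic_divisors f))"
  have d0: "d \<ge> 0" by (simp add: d_def)
  define r where "r = n div 2"
  have r2: "2 * r \<le> n" by (simp add: r_def)
  define K where "K = {k. k \<le> r \<and> n + 1 \<le> m + k \<and> m + k \<le> n + 4}"
  have "K \<subseteq> {n + 1 - m..<n + 1 - m + 4}" by (auto simp: K_def)
  then have "card K \<le> card {n + 1 - m..<n + 1 - m + 4}" by (rule card_mono[rotated]) simp
  then have cK: "card K \<le> 4" by simp
  have summand: "norm (gsum k f * wdiff r n m k)
      \<le> 4 * d * sqrt_q ^ (10 + (m + n))" if "k \<in> K" for k
  proof -
    have k: "k \<le> r" "m + k \<le> n + 4" using that by (auto simp: K_def)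
    have km: "k \<le> m" "k + 3 \<le> m" using k True by (auto simp: r_def)
    have w1: "norm (weight r n m k) \<le> 2 * sqrt_q ^ (2 * (m - k + 2))"
      using norm_weight_le[OF r2 k(1) _ k(2)] True unfolding q_power_eq r_def by simp
    have w2: "norm (weight r n (m - 3) k) \<le> 2 * sqrt_q ^ (2 * (m - 3 - k + 2))"
      using norm_weight_le[OF r2 k(1), of "m - 3"] k True unfolding q_power_eq r_def by simp
    have "norm (wdiff r n m k)
        \<le> norm (weight r n m k) + sqrt_q ^ (2 * 4) * norm (weight r n (m - 3) k)"
      using norm_triangle_ineq4[of "weight r n m k" "of_nat CARD('a) ^ 4 * weight r n (m - 3) k"]
      unfolding norm_mult norm_power norm_of_nat q_power_eq .
    also have "\<dots> \<le> 2 * sqrt_q ^ (2 * (m - k + 2)) + sqrt_q ^ (2 * 4) * (2 * sqrt_q ^ (2 * (m - 3 - k + 2)))"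
      using w1 w2 sqrt_q_ge_1 by (intro add_mono mult_left_mono) auto
    also have "\<dots> = 2 * sqrt_q ^ (2 * (m - k + 2)) + 2 * sqrt_q ^ (2 * 4 + 2 * (m - 3 - k + 2))"
      by (simp only: power_add mult_ac)
    also have "\<dots> \<le> 2 * sqrt_q ^ (2 * (m - k + 3)) + 2 * sqrt_q ^ (2 * (m - k + 3))"
      using km by (intro add_mono mult_left_mono power_increasing sqrt_q_ge_1) auto
    finally have w: "norm (wdiff r n m k) \<le> 4 * sqrt_q ^ (2 * (m - k + 3))"
      by simp
    have "norm (gsum k f * wdiff r n m k)
        \<le> (d * sqrt_q ^ (3 * k)) * (4 * sqrt_q ^ (2 * (m - k + 3)))"
      unfolding norm_mult d_def using norm_gsum_le[OF f1] w sqrt_q_ge_1 by (intro mult_mono) auto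
    also have "\<dots> = 4 * d * sqrt_q ^ (3 * k + 2 * (m - k + 3))" by (simp add: power_add)
    also have "\<dots> \<le> 4 * d * sqrt_q ^ (10 + (m + n))"
      using k km d0 by (intro mult_left_mono power_increasing sqrt_q_ge_1) auto
    finally show ?thesis .
  qed
  have "norm (num_coeff f m) \<le> (\<Sum>k\<in>K. 4 * d * sqrt_q ^ (10 + (m + n)))"
    unfolding num_coeff_formula[OF f True] K_def[unfolded r_def, symmetric]
    by (rule sum_norm_le) (use summand in \<open>simp add: r_def\<close>)
  also have "\<dots> = real (card K) * (4 * d * sqrt_q ^ (10 + (m + n)))" by simp
  also have "\<dots> \<le> 4 * (4 * d * sqrt_q ^ (10 + (m + n)))"
    using cK d0 sqrt_q_ge_1 by (intro mult_right_mono) auto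
  finally show ?thesis by (simp add: power_add d_def mult_ac)
qed

end

section \<open>Meromorphic continuation\<close>

text \<open>The difference, with removable singularities removed, vanishes near 0 and hence
  everywhere. So \<open>f\<close> and \<open>g\<close> agree near each point except perhaps at it,
  and the convention of \<open>nicely_meromorphic_on\<close>, the limit or 0 at a pole, fixes the
  value there.\<close>

lemma nicely_meromorphic_eqI:
  assumes f: "f nicely_meromorphic_on UNIV" and g: "g nicely_meromorphic_on UNIV"
    and eq: "\<forall>\<^sub>F z in nhds 0. f z = g z"
  shows "f = g"
proof
  fix z
  define h where "h = (\<lambda>z. f z - g z)"
  have mero: "h meromorphic_on UNIV" unfolding h_def
    using f g by (intro meromorphic_intros) (auto simp: nicely_meromorphic_on_def)
  then have k: "remove_sings h nicely_meromorphic_on UNIV" by (rule remove_sings_nicely_meromorphic)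
  obtain e where e: "e > 0" "\<And>z. z \<in> ball 0 e \<Longrightarrow> f z = g z"
    using eq unfolding eventually_nhds_metric by (auto simp: dist_commute)
  have zero: "remove_sings h w = 0" if "w \<in> ball 0 e" for w
  proof (rule remove_sings_eqI)
    have "\<forall>\<^sub>F z in at w. z \<in> ball 0 e" using that by (intro eventually_at_in_open') auto
    then have "\<forall>\<^sub>F z in at w. h z = 0" by eventually_elim (simp add: h_def e(2))
    then show "h \<midarrow>w\<rightarrow> 0" by (rule tendsto_eventually)
  qed
  have "remove_sings h constant_on UNIV"
  proof (rule constant_on_extend_nicely_meromorphic_on[OF k, of "ball 0 e"])
    show "remove_sings h constant_on ball 0 e" using zero by (auto simp: constant_on_def)
  qed (use e(1) in auto)
  then have rs0: "remove_sings h w = 0" for w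
    using zero[of 0] e(1) by (auto simp: constant_on_def)
  have "isolated_singularity_at h z"
    using mero meromorphic_on_isolated_singularity by (metis UNIV_I meromorphic_on_subset subset_UNIV)
  then have "\<forall>\<^sub>F w in at z. remove_sings h w = h w" by (rule eventually_remove_sings_eq_at)
  then have "\<forall>\<^sub>F w in at z. 0 = h w" by (simp only: rs0)
  then have ev: "\<forall>\<^sub>F w in at z. f w = g w" by eventually_elim (simp add: h_def)
  have pole: "is_pole f z \<longleftrightarrow> is_pole g z" by (rule is_pole_cong[OF ev refl])
  have F: "(is_pole f z \<and> f z = 0) \<or> f \<midarrow>z\<rightarrow> f z" and G: "(is_pole g z \<and> g z = 0) \<or> g \<midarrow>z\<rightarrow> g z"
    using f g by (auto simp: nicely_meromorphic_on_def)
  have np: "\<not> is_pole h' z" if "h' \<midarrow>z\<rightarrow> l" for h' :: "complex \<Rightarrow> complex" and l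
    using that not_tendsto_and_filterlim_at_infinity[of "at z" h' l] by (auto simp: is_pole_def)
  show "f z = g z"
  proof (cases "is_pole f z")
    case True
    then have "f z = 0" "g z = 0" using F G pole np[of f "f z"] np[of g "g z"] by auto
    then show ?thesis by simp
  next
    case False
    then have "f \<midarrow>z\<rightarrow> f z" "g \<midarrow>z\<rightarrow> g z" using F G pole by auto
    moreover have "f \<midarrow>z\<rightarrow> g z" using \<open>g \<midarrow>z\<rightarrow> g z\<close> ev by (simp add: tendsto_cong)
    ultimately show ?thesis using LIM_unique by blast
  qed
qed

context cubic_residue
begin

definition num :: "'a poly \<Rightarrow> nat \<Rightarrow> complex \<Rightarrow> complex" where
  "num f n u = (\<Sum>m\<le>n + 4. num_coeff f m * u ^ m)"

definition den :: "complex \<Rightarrow> complex" where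
  "den u = 1 - of_nat CARD('a) ^ 4 * u ^ 3"

text \<open>Absolute convergence, by comparison with a geometric series of ratio
  \<open>1 / 2\<close>, permits grouping by degree. Multiplying by \<open>den u\<close> then leaves
  only finitely many terms, by \<open>num_coeff_eq_0\<close>.\<close>

lemma gauss_series_has_sum:
  assumes f: "f \<in> monics n" and u: "sqrt_q ^ 3 * norm u \<le> 1 / 2"
  shows "((\<lambda>F. gauss_sum \<Omega> f F * u ^ degree F) has_sum (num f n u / den u)) {F. lead_coeff F = 1}"
proof -
  have f1: "lead_coeff f = 1" using monicsD[OF f] by blast
  define d where "d = real (card (monic_divisors f))"
  have d0: "d \<ge> 0" by (simp add: d_def)
  define h where "h = (\<lambda>(m, F). gauss_sum \<Omega> f F * u ^ m)"
  define g where "g = (\<lambda>m. (\<Sum>F\<in>monics m. norm (gauss_sum \<Omega> f F)) * norm u ^ m)"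
  have g_le: "g m \<le> d * (1 / 2) ^ m" for m
  proof -
    have "g m \<le> (d * sqrt_q ^ (3 * m)) * norm u ^ m"
      unfolding g_def d_def by (intro mult_right_mono sum_norm_gauss_sum_le[OF f1]) auto
    also have "\<dots> = d * (sqrt_q ^ 3 * norm u) ^ m" by (simp add: power_mult power_mult_distrib)
    also have "\<dots> \<le> d * (1 / 2) ^ m" using u d0 sqrt_q_ge_1 by (intro mult_left_mono power_mono) auto
    finally show ?thesis .
  qed
  have g0: "g m \<ge> 0" for m unfolding g_def by (intro mult_nonneg_nonneg sum_nonneg) auto
  have "summable (\<lambda>m. d * (1 / 2 :: real) ^ m)" by (intro summable_mult summable_geometric) simp
  then have "summable g" by (rule summable_comparison_test'[where N = 0]) (use g_le g0 in auto)
  then have gs: "g summable_on UNIV" using g0 by (simp add: summable_on_UNIV_nonneg_real_iff)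
  have "(\<lambda>x. norm (h x)) summable_on Sigma UNIV monics"
  proof (rule summable_on_SigmaI[OF _ gs])
    fix m :: nat
    have "((\<lambda>F. norm (h (m, F))) has_sum (\<Sum>F\<in>monics m. norm (h (m, F)))) (monics m)"
      by (rule has_sum_finite) simp
    then show "((\<lambda>F. norm (h (m, F))) has_sum g m) (monics m)"
      by (simp add: g_def h_def norm_mult norm_power sum_distrib_right)
  qed auto
  then have "h summable_on Sigma UNIV monics" by (rule abs_summable_summable)
  then obtain S where S: "(h has_sum S) (Sigma UNIV monics)" by (auto simp: summable_on_def)
  have "((\<lambda>m. gsum m f * u ^ m) has_sum S) UNIV"
  proof (rule has_sum_SigmaD[OF S])
    fix m :: nat
    have "((\<lambda>F. h (m, F)) has_sum (\<Sum>F\<in>monics m. h (m, F))) (monics m)"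
      by (rule has_sum_finite) simp
    then show "((\<lambda>F. h (m, F)) has_sum (gsum m f * u ^ m)) (monics m)"
      by (simp add: gsum_def h_def sum_distrib_right)
  qed
  then have sums: "(\<lambda>m. gsum m f * u ^ m) sums S" by (rule has_sum_imp_sums)
  define c where "c = of_nat CARD('a) ^ 4 * u ^ 3"
  have shifted: "(\<lambda>m. if 3 \<le> m then of_nat CARD('a) ^ 4 * gsum (m - 3) f * u ^ m else 0) sums (c * S)"
  proof -
    define k where "k = (\<lambda>m. if 3 \<le> m then of_nat CARD('a) ^ 4 * gsum (m - 3) f * u ^ m else 0)"
    have "(\<lambda>m. c * (gsum m f * u ^ m)) sums (c * S)" by (rule sums_mult[OF sums])
    moreover have "k (m + 3) = c * (gsum m f * u ^ m)" for m
      by (simp add: k_def c_def power_add mult_ac)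
    ultimately have "(\<lambda>m. k (m + 3)) sums (c * S)" by simp
    then have "k sums (c * S + (\<Sum>i<3. k i))" by (simp only: sums_iff_shift)
    moreover have "(\<Sum>i<3. k i) = 0" by (simp add: k_def)
    ultimately show ?thesis by (simp add: k_def)
  qed
  have "(\<lambda>m. gsum m f * u ^ m - (if 3 \<le> m then of_nat CARD('a) ^ 4 * gsum (m - 3) f * u ^ m else 0)) sums (S - c * S)"
    by (rule sums_diff[OF sums shifted])
  moreover have "gsum m f * u ^ m - (if 3 \<le> m then of_nat CARD('a) ^ 4 * gsum (m - 3) f * u ^ m else 0)
      = num_coeff f m * u ^ m" for m
    by (simp add: num_coeff_def left_diff_distrib)
  ultimately have 1: "(\<lambda>m. num_coeff f m * u ^ m) sums (S - c * S)" by simp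
  have "(\<lambda>m. num_coeff f m * u ^ m) sums (\<Sum>m\<in>{..n + 4}. num_coeff f m * u ^ m)"
    by (rule sums_finite) (use num_coeff_eq_0[OF f] in auto)
  with 1 have "S - c * S = num f n u" unfolding num_def by (rule sums_unique2)
  then have eq: "S * den u = num f n u" by (simp add: den_def c_def algebra_simps)
  \<comment> \<open>The disc lies within the radius of the zeros of \<open>den\<close>:
    \<open>q powr (- 3 / 2) / 2\<close> is smaller than \<open>q powr (- 4 / 3)\<close>.\<close>
  have "den u \<noteq> 0"
  proof
    assume "den u = 0"
    then have "norm (of_nat CARD('a) ^ 4 * u ^ 3 :: complex) = norm (1 :: complex)" by (simp add: den_def)
    then have "sqrt_q ^ 8 * norm u ^ 3 = 1" by (simp add: norm_mult norm_power q_power_eq)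
    then have "sqrt_q * 1 = sqrt_q * (sqrt_q ^ 8 * norm u ^ 3)" by simp
    also have "\<dots> = (sqrt_q ^ 3 * norm u) ^ 3" by (simp add: power_mult_distrib flip: power_mult power_Suc mult.assoc)
    also have "\<dots> \<le> (1 / 2) ^ 3" using u sqrt_q_ge_1 by (intro power_mono) auto
    finally show False using sqrt_q_ge_1 by (simp add: power3_eq_cube)
  qed
  then have "S = num f n u / den u" using eq by (simp add: field_simps)
  then have S': "(h has_sum (num f n u / den u)) (Sigma UNIV monics)" using S by simp
  show ?thesis
    by (rule iffD1[OF has_sum_reindex_bij_witness S', where i1 = "\<lambda>F. (degree F, F)" and j1 = snd])
       (auto simp: h_def monics_def)
qed

text \<open>At zeros of \<open>den\<close> the quotient has value 0 by convention, although
  \<open>num\<close> may vanish there too; \<open>remove_sings\<close> gives the normalised function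
  that \<open>Psi\<close> describes, and it agrees with the quotient elsewhere.\<close>

lemma Psi_eq:
  assumes f: "f \<in> monics n" and u: "den u \<noteq> 0"
  shows "Psi \<Omega> f u = num f n u / den u"
proof -
  define R where "R = (\<lambda>u. num f n u / den u)"
  have an: "R analytic_on {v}" if "den v \<noteq> 0" for v
    unfolding R_def num_def den_def
    using that by (intro analytic_intros) (auto simp: den_def)
  have mero: "R meromorphic_on UNIV" unfolding R_def num_def den_def
    by (intro meromorphic_intros)
  define \<Phi> where "\<Phi> = remove_sings R"
  have nice: "\<Phi> nicely_meromorphic_on UNIV" unfolding \<Phi>_def by (rule remove_sings_nicely_meromorphic[OF mero])
  have val: "\<Phi> v = R v" if "den v \<noteq> 0" for v
    unfolding \<Phi>_def by (rule remove_sings_at_analytic[OF an[OF that]])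
  have ev: "\<forall>\<^sub>F v in nhds 0. ((\<lambda>F. gauss_sum \<Omega> f F * v ^ degree F) has_sum \<Phi> v) {F. lead_coeff F = 1}"
  proof -
    have "\<forall>\<^sub>F v :: complex in nhds 0. sqrt_q ^ 3 * norm v < 1 / 2"
    proof (rule order_tendstoD(2))
      show "((\<lambda>v::complex. sqrt_q ^ 3 * norm v) \<longlongrightarrow> sqrt_q ^ 3 * norm (0::complex)) (nhds 0)"
        by (intro tendsto_intros filterlim_ident)
    qed simp
    moreover have "\<forall>\<^sub>F v in nhds 0. den v \<noteq> 0"
    proof -
      have "(den \<longlongrightarrow> den 0) (nhds 0)" unfolding den_def by (intro tendsto_intros filterlim_ident)
      then show ?thesis by (rule tendsto_imp_eventually_ne) (simp add: den_def)
    qed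
    ultimately show ?thesis
    proof eventually_elim
      case (elim v)
      then show ?case using gauss_series_has_sum[OF f, of v] val[of v] by (simp add: R_def)
    qed
  qed
  have "Psi \<Omega> f = \<Phi>"
    unfolding Psi_def
  proof (rule the_equality)
    show "\<Phi> nicely_meromorphic_on UNIV \<and>
      (\<forall>\<^sub>F u in nhds 0. ((\<lambda>F. gauss_sum \<Omega> f F * u ^ degree F) has_sum \<Phi> u) {F. lead_coeff F = 1})"
      using nice ev by blast
  next
    fix \<Phi>' assume \<Phi>': "\<Phi>' nicely_meromorphic_on UNIV \<and>
      (\<forall>\<^sub>F u in nhds 0. ((\<lambda>F. gauss_sum \<Omega> f F * u ^ degree F) has_sum \<Phi>' u) {F. lead_coeff F = 1})"
    have "\<forall>\<^sub>F u in nhds 0. \<Phi>' u = \<Phi> u"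
      using conjunct2[OF \<Phi>'] ev by eventually_elim (rule has_sum_unique)
    then show "\<Phi>' = \<Phi>" by (rule nicely_meromorphic_eqI[OF conjunct1[OF \<Phi>'] nice])
  qed
  then show ?thesis using val[OF u] by (simp add: R_def)
qed

lemma sqrt_q_power: "sqrt_q ^ k = real CARD('a) powr (real k / 2)"
proof -
  have "sqrt_q ^ k = sqrt_q powr real k" using sqrt_q_ge_1 by (simp add: powr_realpow)
  also have "\<dots> = real CARD('a) powr (1 / 2 * real k)"
    by (simp add: sqrt_q_def powr_half_sqrt[symmetric] powr_powr)
  finally show ?thesis by simp
qed

text \<open>For \<open>2 m \<le> n\<close> the trivial bound for the coefficients suffices, for larger \<open>m\<close> the dual one.\<close>

lemma norm_num_term_le:
  assumes f: "f \<in> monics n" and \<sigma>: "1 / 2 \<le> \<sigma>" "\<sigma> \<le> 3 / 2" and u: "norm u = real CARD('a) powr (- \<sigma>)"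
  shows "norm (num_coeff f m * u ^ m) \<le> 16 * real CARD('a) ^ 5 * real (card (monic_divisors f)) *
           real CARD('a) powr (real n * (1 / 2 * (3 / 2 - \<sigma>)))"
proof -
  define q where "q = real CARD('a)"
  have q1: "q > 1" using q_gt_1 by (simp add: q_def)
  have f1: "lead_coeff f = 1" using monicsD[OF f] by blast
  define d where "d = real (card (monic_divisors f))"
  have d0: "d \<ge> 0" by (simp add: d_def)
  define t where "t = real n * (1 / 2 * (3 / 2 - \<sigma>))"
  have um: "norm u ^ m = q powr (- \<sigma> * real m)"
    using q1 by (simp add: u q_def[symmetric] powr_powr flip: powr_realpow)
  have q5: "sqrt_q ^ 10 = q ^ 5" using q_power_eq[of 5] by (simp add: q_def)
  have "norm (num_coeff f m) * norm u ^ m \<le> 16 * q ^ 5 * d * q powr t"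
  proof (cases "2 * m \<le> n")
    case True
    have "norm (num_coeff f m) * norm u ^ m \<le> (2 * d * q powr (real (3 * m) / 2)) * q powr (- \<sigma> * real m)"
      unfolding um using norm_num_coeff_le[OF f1, of m]
      by (intro mult_right_mono) (auto simp: d_def q_def sqrt_q_power)
    also have "\<dots> = 2 * d * q powr (real m * (3 / 2 - \<sigma>))"
      by (simp add: powr_add[symmetric] algebra_simps)
    also have "\<dots> \<le> 2 * d * q powr t"
    proof (intro mult_left_mono powr_mono)
      \<comment> \<open>Since \<open>\<sigma> \<le> 3 / 2\<close>, the exponent does not decrease
        with \<open>m\<close> and is largest at \<open>m = n / 2\<close>.\<close>
      have "real m * (3 / 2 - \<sigma>) \<le> (real n / 2) * (3 / 2 - \<sigma>)"
        using True \<sigma> by (intro mult_right_mono) linarith+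
      then show "real m * (3 / 2 - \<sigma>) \<le> t" by (simp add: t_def)
    qed (use q1 d0 in auto)
    also have "\<dots> \<le> 16 * q ^ 5 * d * q powr t"
    proof -
      have "1 \<le> q ^ 5" using q1 by (intro one_le_power) simp
      then have "2 \<le> 16 * q ^ 5" by simp
      then have "2 * d \<le> 16 * q ^ 5 * d" using d0 by (rule mult_right_mono)
      then show ?thesis by (rule mult_right_mono) simp
    qed
    finally show ?thesis .
  next
    case False
    have "norm (num_coeff f m) * norm u ^ m \<le> (16 * q ^ 5 * d * q powr (real (m + n) / 2)) * q powr (- \<sigma> * real m)"
      unfolding um using norm_num_coeff_le'[OF f, of m]
      by (intro mult_right_mono) (auto simp: d_def q5 sqrt_q_power[of "m + n"] q_def[symmetric])
    also have "\<dots> = 16 * q ^ 5 * d * q powr (real n / 2 - real m * (\<sigma> - 1 / 2))"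
      by (simp add: powr_add[symmetric] algebra_simps add_divide_distrib)
    also have "\<dots> \<le> 16 * q ^ 5 * d * q powr t"
    proof (intro mult_left_mono powr_mono)
      \<comment> \<open>Since \<open>\<sigma> \<ge> 1 / 2\<close>, this exponent does not increase
        with \<open>m\<close>, and at \<open>m = n / 2\<close> it equals \<open>t\<close> as
        well.\<close>
      have "(real n / 2) * (\<sigma> - 1 / 2) \<le> real m * (\<sigma> - 1 / 2)"
        using False \<sigma> by (intro mult_right_mono) linarith+
      then show "real n / 2 - real m * (\<sigma> - 1 / 2) \<le> t" by (simp add: t_def algebra_simps)
    qed (use q1 d0 in auto)
    finally show ?thesis .
  qed
  then show ?thesis by (simp add: norm_mult norm_power d_def q_def t_def)
qed

lemma norm_Psi_le:
  assumes f: "f \<in> monics n" and \<sigma>: "1 / 2 \<le> \<sigma>" "\<sigma> \<le> 3 / 2" and u: "norm u = real CARD('a) powr (- \<sigma>)"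
    and \<delta>: "\<delta> > 0" "norm (u ^ 3 - 1 / of_nat CARD('a) ^ 4) > \<delta>"
  shows "norm (Psi \<Omega> f u) \<le> real (n + 5) * (16 * real CARD('a) ^ 5 * real (card (monic_divisors f)) *
           real CARD('a) powr (real n * (1 / 2 * (3 / 2 - \<sigma>)))) / \<delta>"
    (is "_ \<le> real (n + 5) * ?B / \<delta>")
proof -
  have "den u = - (of_nat CARD('a) ^ 4 * (u ^ 3 - 1 / of_nat CARD('a) ^ 4))"
    by (simp add: den_def right_diff_distrib)
  then have nd: "norm (den u) = real CARD('a) ^ 4 * norm (u ^ 3 - 1 / of_nat CARD('a) ^ 4)"
    by (simp only: norm_minus_cancel norm_mult norm_power norm_of_nat)
  have "1 * \<delta> \<le> norm (den u)"
    unfolding nd using \<delta> q_gt_1 by (intro mult_mono one_le_power) auto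
  then have den: "\<delta> \<le> norm (den u)" by simp
  then have d0: "den u \<noteq> 0" using \<delta>(1) by auto
  have "norm (num f n u) \<le> (\<Sum>m\<le>n + 4. ?B)"
    unfolding num_def by (rule sum_norm_le) (rule norm_num_term_le[OF f \<sigma> u])
  then have "norm (num f n u) \<le> real (n + 5) * ?B" by (simp add: add.commute)
  then show ?thesis unfolding Psi_eq[OF f d0] norm_divide
    using den \<delta>(1) by (intro frac_le) auto
qed

end

section \<open>Uniform choice of the constant for all \<open>f\<close>\<close>

theorem theorem3p10:
  fixes q :: nat and \<delta> \<epsilon> :: real
  assumes "CARD('a::finite_field) = q"
    and "[q = 1] (mod 6)"
    and "\<delta> > 0" and "\<epsilon> > 0"
  shows "\<exists>C::real. \<forall>\<Omega> :: complex \<Rightarrow> 'a. cube_root_iso \<Omega> \<longrightarrow>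
           (\<forall>(f :: 'a poly) (s :: complex) (u :: complex).
              lead_coeff f = 1 \<and> u = of_nat q powr (- s) \<and>
              1 / 2 \<le> Re s \<and> Re s \<le> 3 / 2 \<and>
              norm (u ^ 3 - 1 / of_nat q ^ 4) > \<delta> \<longrightarrow>
              norm (Psi \<Omega> f u) \<le> C * poly_abs f powr (1 / 2 * (3 / 2 - Re s) + \<epsilon>))"
proof -
  define Q where "Q = real CARD('a)"
  have Q1: "Q > 1" using CARD_finite_field_gt_1[where 'a = 'a] by (simp add: Q_def)
  have lQ: "ln Q > 0" using Q1 by simp
  \<comment> \<open>Half of \<open>\<epsilon>\<close> absorbs the divisor function, the other half
    the number \<open>n + 5\<close> of coefficients of \<open>num\<close>.\<close>
  define \<eta> where "\<eta> = \<epsilon> / 2"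
  have eta: "\<eta> > 0" using assms(4) by (simp add: \<eta>_def)
  obtain C1 where C1: "\<And>f :: 'a poly. lead_coeff f = 1 \<Longrightarrow>
      real (card (monic_divisors f)) \<le> C1 * Q powr (\<eta> * real (degree f))"
    using card_monic_divisors_bound[OF eta, where 'a = 'a] unfolding Q_def by blast
  \<comment> \<open>The two summands cover 5 and \<open>n\<close>, both by
    \<open>Q powr t \<ge> 1 + t * ln Q\<close>.\<close>
  define C2 where "C2 = 5 + 1 / (\<eta> * ln Q)"
  have C2: "real (n + 5) \<le> C2 * Q powr (\<eta> * real n)" for n
  proof -
    have 1: "1 + \<eta> * real n * ln Q \<le> Q powr (\<eta> * real n)"
      using Q1 exp_ge_add_one_self[of "\<eta> * real n * ln Q"] by (simp add: powr_def)
    have "0 \<le> \<eta> * real n * ln Q" using eta lQ by simp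
    then have "5 * 1 \<le> 5 * Q powr (\<eta> * real n)" using 1 by linarith
    moreover have "real n \<le> 1 / (\<eta> * ln Q) * Q powr (\<eta> * real n)"
      using 1 eta lQ by (simp add: field_simps)
    ultimately show ?thesis by (simp add: C2_def distrib_right)
  qed
  have C2pos: "C2 > 0" using eta lQ by (simp add: C2_def add_pos_pos)
  define C where "C = C2 * (16 * Q ^ 5 * C1) / \<delta>"
  have main: "norm (Psi \<Omega> f u) \<le> C * poly_abs f powr (1 / 2 * (3 / 2 - Re s) + \<epsilon>)"
    if \<Omega>: "cube_root_iso \<Omega>" and f: "lead_coeff f = 1" and u: "u = of_nat q powr (- s)"
      and s: "1 / 2 \<le> Re s" "Re s \<le> 3 / 2" and nd: "norm (u ^ 3 - 1 / of_nat q ^ 4) > \<delta>"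
    for \<Omega> :: "complex \<Rightarrow> 'a" and f :: "'a poly" and s u :: complex
  proof -
    interpret cubic_residue \<Omega> using \<Omega> assms(1,2) by unfold_locales auto
    define n where "n = degree f"
    have fm: "f \<in> monics n" using f by (simp add: monicsI n_def)
    have nu: "norm u = real CARD('a) powr (- Re s)"
      using q_gt_1 assms(1) by (simp add: u norm_powr_real_powr)
    define B where "B = Q powr (real n * (1 / 2 * (3 / 2 - Re s)))"
    define A where "A = Q powr (\<eta> * real n)"
    have "norm (Psi \<Omega> f u) \<le> real (n + 5) * (16 * Q ^ 5 * real (card (monic_divisors f)) * B) / \<delta>"
      unfolding Q_def B_def by (rule norm_Psi_le[OF fm s nu assms(3)]) (use nd assms(1) in simp)
    also have "\<dots> \<le> (C2 * A) * (16 * Q ^ 5 * (C1 * A) * B) / \<delta>"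
      using C2[of n] C1[OF f] C2pos Q1 assms(3)
      by (intro divide_right_mono mult_mono) (auto simp: A_def B_def n_def)
    also have "\<dots> = C * (B * (A * A))" by (simp add: C_def mult_ac)
    also have "B * (A * A) = Q powr (real n * (1 / 2 * (3 / 2 - Re s) + \<epsilon>))"
      by (simp add: A_def B_def \<eta>_def powr_add[symmetric] algebra_simps)
    also have "\<dots> = poly_abs f powr (1 / 2 * (3 / 2 - Re s) + \<epsilon>)"
    proof -
      have "f \<noteq> 0" using f by auto
      then have "poly_abs f = Q powr real n" using Q1 by (simp add: poly_abs_def n_def Q_def powr_realpow)
      then show ?thesis by (simp add: powr_powr)
    qed
    finally show ?thesis .
  qed
  show ?thesis by (rule exI[of _ C]) (use main in blast)
qed

end
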